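(* Let $(R,\mathfrak m)$ be a commutative noetherian local ring, and suppose that there is a direct sum decomposition $\mathfrak m=I\oplus J$ with $I,J$ non-zero ideals of $R$. Let $M$ be a finitely generated $R$-module with $\operatorname{pd}_RM\ge2$ (possibly infinite). (1) At least one of the following holds true. (i) $\mathfrak m$ is a direct summand of $\Omega_R^3M$ or of $\Omega_R^4M$. (ii) $\mathfrak m$ is a direct summand of $\Omega_R^5M$, and $\Omega_R^2M$ is $R/I$-free. (iii) $\mathfrak m$ is a direct summand of $\Omega_R^5M$, and $\Omega_R^2M$ is $R/J$-free. (iv) $\mathfrak m$ is a direct summand of $\Omega_R^3M\oplus\Omega_R^4M$, $R/I$ is a discrete valuation ring, and $\Omega_R^2M$ is $R/J$-free. (v) $\mathfrak m$ is a direct summand of $\Omega_R^3M\oplus\Omega_R^4M$, $R/J$ is a discrete valuation ring, and $\Omega_R^2M$ is $R/I$-free. (2) If either $R/I$ or $R/J$ has depth $0$, then none of (ii), (iii), (iv), (v) occurs.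
   Context: $\Omega_R^nM$ denotes the $n$-th syzygy of $M$ in its minimal free resolution over $R$. "Direct summand" is up to isomorphism of $R$-modules. For an ideal $K$, an $R$-module is "$R/K$-free" if it is annihilated by $K$ and is free as an $R/K$-module. *)

theory Defs
  imports "HOL-Algebra.Algebra" "HOL-Library.Extended_Nat"
begin

section \<open>Local rings, discrete valuation rings, depth\<close>

locale noetherian_local_ring = cring R + noetherian_ring R for R (structure) +
  fixes m
  assumes maximal: "maximalideal m R"
    and unique_maximal: "\<And>n. maximalideal n R \<Longrightarrow> n = m"

definition discrete_valuation_ring :: "('a, 'k) ring_scheme \<Rightarrow> bool" where
  "discrete_valuation_ring S \<longleftrightarrow>
     principal_domain S \<and> \<not> field S \<and> (\<exists>!n. maximalideal n S)"

definition regular_sequence :: "('a, 'k) ring_scheme \<Rightarrow> 'a list \<Rightarrow> bool" where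
  "regular_sequence S xs \<longleftrightarrow>
     set xs \<subseteq> carrier S \<and>
     (\<forall>i < length xs. \<forall>a \<in> carrier S.
        xs ! i \<otimes>\<^bsub>S\<^esub> a \<in> genideal S (set (take i xs)) \<longrightarrow> a \<in> genideal S (set (take i xs))) \<and>
     genideal S (set xs) \<noteq> carrier S"

text \<open>The depth of a noetherian local ring; the description of the maximal ideal is
  meaningful only if \<open>S\<close> is local.\<close>

definition depth :: "('a, 'k) ring_scheme \<Rightarrow> enat" where
  "depth S =
     (SUP xs \<in> {xs. regular_sequence S xs \<and> set xs \<subseteq> (THE n. maximalideal n S)}. enat (length xs))"


section \<open>Modules\<close>

text \<open>A record of type \<open>module\<close> extends a ring record. Its \<open>mult\<close> and \<open>one\<close> fields play no role in
  the locale \<open>module\<close>, and are filled with \<open>undefined\<close> below.\<close>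

definition module_hom ::
  "('a, 'k) ring_scheme \<Rightarrow> ('a, 'b, 'l) module_scheme \<Rightarrow> ('a, 'c, 'p) module_scheme \<Rightarrow> ('b \<Rightarrow> 'c) set"
  where
  "module_hom R M N =
     {f \<in> carrier M \<rightarrow> carrier N.
        (\<forall>x \<in> carrier M. \<forall>y \<in> carrier M. f (x \<oplus>\<^bsub>M\<^esub> y) = f x \<oplus>\<^bsub>N\<^esub> f y) \<and>
        (\<forall>r \<in> carrier R. \<forall>x \<in> carrier M. f (r \<odot>\<^bsub>M\<^esub> x) = r \<odot>\<^bsub>N\<^esub> f x)}"

definition module_iso ::
  "('a, 'k) ring_scheme \<Rightarrow> ('a, 'b, 'l) module_scheme \<Rightarrow> ('a, 'c, 'p) module_scheme \<Rightarrow> bool" where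
  "module_iso R M N \<longleftrightarrow> (\<exists>f \<in> module_hom R M N. bij_betw f (carrier M) (carrier N))"

definition fin_gen :: "('a, 'k) ring_scheme \<Rightarrow> ('a, 'b, 'l) module_scheme \<Rightarrow> bool" where
  "fin_gen R M \<longleftrightarrow>
     (\<exists>S. finite S \<and> S \<subseteq> carrier M \<and> (\<forall>N. submodule N R M \<and> S \<subseteq> N \<longrightarrow> N = carrier M))"

definition ideal_module :: "('a, 'k) ring_scheme \<Rightarrow> 'a set \<Rightarrow> ('a, 'a) module" where
  "ideal_module R I =
     \<lparr>carrier = I, monoid.mult = undefined, monoid.one = undefined,
      ring.zero = \<zero>\<^bsub>R\<^esub>, ring.add = (\<oplus>\<^bsub>R\<^esub>), smult = (\<otimes>\<^bsub>R\<^esub>)\<rparr>"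

definition direct_sum ::
  "('a, 'b, 'l) module_scheme \<Rightarrow> ('a, 'c, 'p) module_scheme \<Rightarrow> ('a, 'b \<times> 'c) module" where
  "direct_sum M N =
     \<lparr>carrier = carrier M \<times> carrier N, monoid.mult = undefined, monoid.one = undefined,
      ring.zero = (\<zero>\<^bsub>M\<^esub>, \<zero>\<^bsub>N\<^esub>),
      ring.add = (\<lambda>(x, y) (x', y'). (x \<oplus>\<^bsub>M\<^esub> x', y \<oplus>\<^bsub>N\<^esub> y')),
      smult = (\<lambda>r (x, y). (r \<odot>\<^bsub>M\<^esub> x, r \<odot>\<^bsub>N\<^esub> y))\<rparr>"

text \<open>\<open>N\<close> is isomorphic to a direct summand of \<open>M\<close>. A complement is isomorphic to a submodule of
  \<open>M\<close>, so nothing is lost by taking it over the same type as \<open>M\<close>.\<close>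

definition direct_summand ::
  "('a, 'k) ring_scheme \<Rightarrow> ('a, 'b, 'l) module_scheme \<Rightarrow> ('a, 'c, 'p) module_scheme \<Rightarrow> bool" where
  "direct_summand R N M \<longleftrightarrow>
     (\<exists>L :: ('a, 'c) module. module R L \<and> module_iso R (direct_sum N L) M)"

text \<open>The free module with basis indexed by \<open>B\<close>: finitely supported functions, extended by zero
  outside \<open>B\<close>.\<close>

definition free_module :: "('a, 'k) ring_scheme \<Rightarrow> 'i set \<Rightarrow> ('a, 'i \<Rightarrow> 'a) module" where
  "free_module R B =
     \<lparr>carrier = {f. (\<forall>i \<in> B. f i \<in> carrier R) \<and> (\<forall>i. i \<notin> B \<longrightarrow> f i = \<zero>\<^bsub>R\<^esub>) \<and>
                    finite {i. f i \<noteq> \<zero>\<^bsub>R\<^esub>}},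
      monoid.mult = undefined, monoid.one = undefined,
      ring.zero = (\<lambda>i. \<zero>\<^bsub>R\<^esub>), ring.add = (\<lambda>f g i. f i \<oplus>\<^bsub>R\<^esub> g i), smult = (\<lambda>r f i. r \<otimes>\<^bsub>R\<^esub> f i)\<rparr>"

text \<open>A basis of \<open>M\<close> is a subset of its carrier, so the index set may be taken over the type of
  the elements of \<open>M\<close>.\<close>

definition is_free :: "('a, 'k) ring_scheme \<Rightarrow> ('a, 'b, 'l) module_scheme \<Rightarrow> bool" where
  "is_free R M \<longleftrightarrow> module R M \<and> (\<exists>B :: 'b set. module_iso R (free_module R B) M)"

text \<open>A projective module is a direct summand of a free module; one can always use the free module
  on (a generating set contained in) the carrier.\<close>

definition projective :: "('a, 'k) ring_scheme \<Rightarrow> ('a, 'b, 'l) module_scheme \<Rightarrow> bool" where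
  "projective R P \<longleftrightarrow> module R P \<and> (\<exists>B :: 'b set. direct_summand R P (free_module R B))"

text \<open>An \<open>R\<close>-module annihilated by \<open>K\<close>, as an \<open>R/K\<close>-module. The choice of the representative is
  immaterial because of the annihilation.\<close>

definition quot_module ::
  "('a, 'k) ring_scheme \<Rightarrow> 'a set \<Rightarrow> ('a, 'b, 'l) module_scheme \<Rightarrow> ('a set, 'b) module" where
  "quot_module R K M =
     \<lparr>carrier = carrier M, monoid.mult = undefined, monoid.one = undefined,
      ring.zero = \<zero>\<^bsub>M\<^esub>, ring.add = (\<oplus>\<^bsub>M\<^esub>),
      smult = (\<lambda>A x. (SOME r. r \<in> A) \<odot>\<^bsub>M\<^esub> x)\<rparr>"

definition quot_free :: "('a, 'k) ring_scheme \<Rightarrow> 'a set \<Rightarrow> ('a, 'b, 'l) module_scheme \<Rightarrow> bool" where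
  "quot_free R K M \<longleftrightarrow>
     (\<forall>r \<in> K. \<forall>x \<in> carrier M. r \<odot>\<^bsub>M\<^esub> x = \<zero>\<^bsub>M\<^esub>) \<and> is_free (R Quot K) (quot_module R K M)"


section \<open>Resolutions\<close>

text \<open>An exact sequence \<open>\<dots> \<rightarrow> P 2 \<rightarrow> P 1 \<rightarrow> P 0 \<rightarrow> M \<rightarrow> 0\<close> with differentials
  \<open>d (n + 1) : P (n + 1) \<rightarrow> P n\<close> and augmentation \<open>e : P 0 \<rightarrow> M\<close>; the value \<open>d 0\<close> is not used.\<close>

definition resolution ::
  "('a, 'k) ring_scheme \<Rightarrow> ('a, 'b, 'l) module_scheme \<Rightarrow>
   (nat \<Rightarrow> ('a, 'c) module) \<Rightarrow> (nat \<Rightarrow> 'c \<Rightarrow> 'c) \<Rightarrow> ('c \<Rightarrow> 'b) \<Rightarrow> bool" where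
  "resolution R M P d e \<longleftrightarrow>
     (\<forall>n. module R (P n)) \<and>
     (\<forall>n. d (Suc n) \<in> module_hom R (P (Suc n)) (P n)) \<and>
     e \<in> module_hom R (P 0) M \<and>
     e ` carrier (P 0) = carrier M \<and>
     d 1 ` carrier (P 1) = a_kernel (P 0) M e \<and>
     (\<forall>n. d (Suc (Suc n)) ` carrier (P (Suc (Suc n))) = a_kernel (P (Suc n)) (P n) (d (Suc n)))"

text \<open>Any module \<open>M\<close> that has a projective resolution of length \<open>n\<close> has one by modules over the
  element type \<open>(nat + 'a + 'b) \<Rightarrow> 'a\<close>: it contains free modules of rank at least the maximum of
  the cardinalities of \<open>R\<close>, \<open>M\<close> and \<open>nat\<close>, together with their submodules. An infimum over the
  empty set is \<open>\<infinity>\<close>.\<close>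

definition proj_dim :: "('a, 'k) ring_scheme \<Rightarrow> ('a, 'b, 'l) module_scheme \<Rightarrow> enat" where
  "proj_dim R M =
     (INF n \<in> {n. \<exists>(P :: nat \<Rightarrow> ('a, (nat + 'a + 'b) \<Rightarrow> 'a) module) d e.
                   resolution R M P d e \<and> (\<forall>i. projective R (P i)) \<and>
                   (\<forall>i > n. carrier (P i) = {\<zero>\<^bsub>P i\<^esub>})}. enat n)"

text \<open>A minimal free resolution with terms \<open>R\<^bsup>b n\<^esup>\<close> over a local ring with maximal ideal \<open>m\<close>:
  the image of each differential lies in \<open>m R\<^bsup>b n\<^esup> = m \<oplus> \<dots> \<oplus> m\<close>.\<close>

definition minimal_free_resolution ::
  "('a, 'k) ring_scheme \<Rightarrow> 'a set \<Rightarrow> ('a, 'b, 'l) module_scheme \<Rightarrow>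
   (nat \<Rightarrow> nat) \<Rightarrow> (nat \<Rightarrow> (nat \<Rightarrow> 'a) \<Rightarrow> (nat \<Rightarrow> 'a)) \<Rightarrow> ((nat \<Rightarrow> 'a) \<Rightarrow> 'b) \<Rightarrow> bool" where
  "minimal_free_resolution R m M b d e \<longleftrightarrow>
     resolution R M (\<lambda>n. free_module R {..<b n}) d e \<and>
     (\<forall>n. \<forall>f \<in> carrier (free_module R {..<b (Suc n)}). \<forall>i < b n. d (Suc n) f i \<in> m)"

text \<open>For \<open>n \<ge> 1\<close>, the \<open>n\<close>-th syzygy is the image of \<open>d n\<close>, a submodule of \<open>R\<^bsup>b (n - 1)\<^esup>\<close>.\<close>

definition syzygy ::
  "('a, 'k) ring_scheme \<Rightarrow> (nat \<Rightarrow> nat) \<Rightarrow> (nat \<Rightarrow> (nat \<Rightarrow> 'a) \<Rightarrow> (nat \<Rightarrow> 'a)) \<Rightarrow> nat \<Rightarrow>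
   ('a, nat \<Rightarrow> 'a) module" where
  "syzygy R b d n =
     (free_module R {..<b (n - 1)})\<lparr>carrier := d n ` carrier (free_module R {..<b n})\<rparr>"

end

theory Submission
  imports Defs
begin

text \<open>Since \<open>I J = 0\<close>, the kernel of a map of free modules with entries in \<open>m = I \<oplus> J\<close> splits
  coordinatewise, provided that it has coordinates in \<open>m\<close>; hence \<open>\<Omega>\<^sup>2 M = A \<oplus> B\<close> with \<open>J A = 0\<close> and
  \<open>I B = 0\<close>. The first syzygy of a non-zero module killed by \<open>J\<close> has \<open>J\<close> as a direct
  summand, and vice versa. So \<open>m\<close> is a summand of \<open>\<Omega>\<^sup>3 M\<close> if \<open>A\<close> and \<open>B\<close> are both non-zero. If
  \<open>B = 0\<close>, then \<open>\<Omega>\<^sup>3 M = A' \<oplus> J\<^sup>a\<close> with \<open>J A' = 0\<close>; either \<open>A' \<noteq> 0\<close> and \<open>m\<close> is a summand of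
  \<open>\<Omega>\<^sup>4 M\<close>, or \<open>A\<close> is free over \<open>R/J\<close>. In the latter case the same dichotomy for \<open>\<Omega> J\<close> shows
  that \<open>m\<close> is a summand of \<open>\<Omega>\<^sup>5 M\<close>, or that \<open>J\<close> is free over \<open>R/I\<close>, which is then a discrete
  valuation ring. Summands are handled as retracts, and a retract of a module induces a retract
  of syzygies because an endomorphism of \<open>R\<^sup>n\<close> congruent to the identity modulo \<open>m\<close> is bijective.

  For the second part, a basis element of \<open>\<Omega>\<^sup>2 M \<subseteq> m F\<close> over \<open>R/J\<close> is killed by the socle of \<open>R\<close>
  and has annihilator \<open>J\<close>, so that the socle meets \<open>I\<close> trivially. It also meets \<open>J\<close> trivially,
  because a socle element \<open>t\<close> gives socle elements \<open>t e\<^sub>k\<close> of the free \<open>R/J\<close>-module \<open>\<Omega>\<^sup>2 M\<close>, and a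
  socle element of \<open>R/J\<close> lifts to one in \<open>I\<close>.\<close>

subsection \<open>Homomorphisms, submodules and retracts\<close>

text \<open>The splitting can start at the second syzygy because that is the kernel of a map into a
  free module \<open>F\<close>, where \<open>I F\<close> and \<open>J F\<close> meet in zero; the
  first syzygy is the kernel of a map to the arbitrary module \<open>M\<close>. The bound on the
  projective dimension enters as \<open>\<Omega>\<^sup>2 M \<noteq> 0\<close>. The obstacle is that
  the summands \<open>A\<close>, \<open>B\<close>, \<open>I\<close>, \<open>J\<close> whose syzygies
  are needed come without a resolution, while the syzygies of the statement belong to a given one.
  So every syzygy is treated as the kernel of a minimal cover, covers of summands are cut out of
  covers of the larger module, and kernels are compared through retracts instead of a uniqueness
  theorem for resolutions. The discrete valuation ring arises because \<open>m/I\<close> is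
  isomorphic to \<open>J\<close>: a generator of \<open>J\<close> with annihilator \<open>I\<close>
  makes the maximal ideal of \<open>R/I\<close> principal, generated by a non-zero-divisor. Depth
  zero of \<open>R/J\<close> says only that each element of \<open>m\<close> is a zero divisor on
  \<open>R/J\<close>; prime avoidance over associated primes turns this into one non-zero class
  killed by all of \<open>m\<close>.\<close>

lemma module_homI:
  assumes "\<And>x. x \<in> carrier M \<Longrightarrow> f x \<in> carrier N"
    and "\<And>x y. x \<in> carrier M \<Longrightarrow> y \<in> carrier M \<Longrightarrow> f (x \<oplus>\<^bsub>M\<^esub> y) = f x \<oplus>\<^bsub>N\<^esub> f y"
    and "\<And>r x. r \<in> carrier R \<Longrightarrow> x \<in> carrier M \<Longrightarrow> f (r \<odot>\<^bsub>M\<^esub> x) = r \<odot>\<^bsub>N\<^esub> f x"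
  shows "f \<in> module_hom R M N"
  using assms by (auto simp: module_hom_def)

lemma
  assumes "f \<in> module_hom R M N"
  shows hom_closed: "x \<in> carrier M \<Longrightarrow> f x \<in> carrier N"
    and hom_add: "x \<in> carrier M \<Longrightarrow> y \<in> carrier M \<Longrightarrow> f (x \<oplus>\<^bsub>M\<^esub> y) = f x \<oplus>\<^bsub>N\<^esub> f y"
    and hom_smult: "r \<in> carrier R \<Longrightarrow> x \<in> carrier M \<Longrightarrow> f (r \<odot>\<^bsub>M\<^esub> x) = r \<odot>\<^bsub>N\<^esub> f x"
  using assms by (auto simp: module_hom_def)

lemma hom_compose:
  assumes "f \<in> module_hom R L M" "g \<in> module_hom R M N"
  shows "(\<lambda>x. g (f x)) \<in> module_hom R L N"
  using assms by (auto simp: module_hom_def Pi_def)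

lemma hom_zero:
  assumes "module R M" "module R N" "f \<in> module_hom R M N"
  shows "f \<zero>\<^bsub>M\<^esub> = \<zero>\<^bsub>N\<^esub>"
proof -
  interpret M: module R M by fact
  interpret N: module R N by fact
  have "f (\<zero>\<^bsub>R\<^esub> \<odot>\<^bsub>M\<^esub> \<zero>\<^bsub>M\<^esub>) = \<zero>\<^bsub>R\<^esub> \<odot>\<^bsub>N\<^esub> f \<zero>\<^bsub>M\<^esub>"
    by (rule hom_smult[OF assms(3)]) auto
  thus ?thesis
    using hom_closed[OF assms(3) M.M.zero_closed] by simp
qed

lemma hom_diff:
  assumes "module R M" "module R N" "f \<in> module_hom R M N" "x \<in> carrier M" "y \<in> carrier M"
  shows "f (x \<ominus>\<^bsub>M\<^esub> y) = f x \<ominus>\<^bsub>N\<^esub> f y"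
proof -
  interpret M: module R M by fact
  interpret N: module R N by fact
  have 1: "f ((\<ominus>\<^bsub>R\<^esub> \<one>\<^bsub>R\<^esub>) \<odot>\<^bsub>M\<^esub> y) = (\<ominus>\<^bsub>R\<^esub> \<one>\<^bsub>R\<^esub>) \<odot>\<^bsub>N\<^esub> f y"
    by (rule hom_smult[OF assms(3)]) (use assms in auto)
  have 2: "(\<ominus>\<^bsub>R\<^esub> \<one>\<^bsub>R\<^esub>) \<odot>\<^bsub>M\<^esub> y = \<ominus>\<^bsub>M\<^esub> y"
    using M.smult_l_minus[of "\<one>\<^bsub>R\<^esub>" y] assms by auto
  have 3: "(\<ominus>\<^bsub>R\<^esub> \<one>\<^bsub>R\<^esub>) \<odot>\<^bsub>N\<^esub> f y = \<ominus>\<^bsub>N\<^esub> f y"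
    using N.smult_l_minus[of "\<one>\<^bsub>R\<^esub>" "f y"] assms hom_closed[OF assms(3)] by auto
  show ?thesis
    using 1 2 3 hom_add[OF assms(3), of x "\<ominus>\<^bsub>M\<^esub> y"] assms
    by (simp add: a_minus_def)
qed

lemma submoduleI':
  assumes "module R M" "H \<subseteq> carrier M" "\<zero>\<^bsub>M\<^esub> \<in> H"
    and "\<And>a b. a \<in> H \<Longrightarrow> b \<in> H \<Longrightarrow> a \<oplus>\<^bsub>M\<^esub> b \<in> H"
    and smult: "\<And>a x. a \<in> carrier R \<Longrightarrow> x \<in> H \<Longrightarrow> a \<odot>\<^bsub>M\<^esub> x \<in> H"
  shows "submodule H R M"
proof -
  interpret M: module R M by fact
  show ?thesis
  proof (rule M.submoduleI)
    fix a assume "a \<in> H"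
    moreover have "(\<ominus>\<^bsub>R\<^esub> \<one>\<^bsub>R\<^esub>) \<odot>\<^bsub>M\<^esub> a = \<ominus>\<^bsub>M\<^esub> a"
      using M.smult_l_minus[of "\<one>\<^bsub>R\<^esub>" a] assms calculation by auto
    ultimately show "\<ominus>\<^bsub>M\<^esub> a \<in> H"
      using smult[of "\<ominus>\<^bsub>R\<^esub> \<one>\<^bsub>R\<^esub>" a] by auto
  qed (use assms in auto)
qed

lemma module_restrict:
  assumes "module R M" "H \<subseteq> carrier M" "\<zero>\<^bsub>M\<^esub> \<in> H"
    and "\<And>a b. a \<in> H \<Longrightarrow> b \<in> H \<Longrightarrow> a \<oplus>\<^bsub>M\<^esub> b \<in> H"
    and "\<And>a x. a \<in> carrier R \<Longrightarrow> x \<in> H \<Longrightarrow> a \<odot>\<^bsub>M\<^esub> x \<in> H"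
  shows "module R (M\<lparr>carrier := H\<rparr>)"
  using submodule.submodule_is_module[OF submoduleI'[OF assms] assms(1)] .

text \<open>A record update rather than a new record, so that the kernel of a differential is equal,
  and not just isomorphic, to the \<open>syzygy\<close> of the statement.\<close>

definition ker_module ::
  "('a, 'b, 'l) module_scheme \<Rightarrow> ('a, 'c, 'p) module_scheme \<Rightarrow> ('b \<Rightarrow> 'c) \<Rightarrow> ('a, 'b, 'l) module_scheme"
  where "ker_module M N f = M\<lparr>carrier := {x \<in> carrier M. f x = \<zero>\<^bsub>N\<^esub>}\<rparr>"

lemma ker_module_simps [simp]:
  "carrier (ker_module M N f) = {x \<in> carrier M. f x = \<zero>\<^bsub>N\<^esub>}"
  "\<zero>\<^bsub>ker_module M N f\<^esub> = \<zero>\<^bsub>M\<^esub>"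
  "x \<oplus>\<^bsub>ker_module M N f\<^esub> y = x \<oplus>\<^bsub>M\<^esub> y"
  "r \<odot>\<^bsub>ker_module M N f\<^esub> x = r \<odot>\<^bsub>M\<^esub> x"
  by (simp_all add: ker_module_def)

lemma module_ker_module:
  assumes "module R M" "module R N" "f \<in> module_hom R M N"
  shows "module R (ker_module M N f)"
proof -
  interpret M: module R M by fact
  interpret N: module R N by fact
  show ?thesis
    unfolding ker_module_def
    by (rule module_restrict)
      (use assms in \<open>auto simp: hom_zero hom_add hom_smult hom_closed\<close>)
qed

section \<open>Direct sums and retracts\<close>

lemma direct_sum_simps [simp]:
  "carrier (direct_sum M N) = carrier M \<times> carrier N"
  "\<zero>\<^bsub>direct_sum M N\<^esub> = (\<zero>\<^bsub>M\<^esub>, \<zero>\<^bsub>N\<^esub>)"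
  "(x, y) \<oplus>\<^bsub>direct_sum M N\<^esub> (x', y') = (x \<oplus>\<^bsub>M\<^esub> x', y \<oplus>\<^bsub>N\<^esub> y')"
  "r \<odot>\<^bsub>direct_sum M N\<^esub> (x, y) = (r \<odot>\<^bsub>M\<^esub> x, r \<odot>\<^bsub>N\<^esub> y)"
  by (simp_all add: direct_sum_def)

lemma module_direct_sum:
  assumes "module R M" "module R N"
  shows "module R (direct_sum M N)"
proof -
  interpret M: module R M by fact
  interpret N: module R N by fact
  show ?thesis
  proof (rule moduleI)
    show "abelian_group (direct_sum M N)"
    proof (rule abelian_groupI)
      fix x assume "x \<in> carrier (direct_sum M N)"
      then obtain u v where "x = (u, v)" "u \<in> carrier M" "v \<in> carrier N" by auto
      thus "\<exists>y\<in>carrier (direct_sum M N). y \<oplus>\<^bsub>direct_sum M N\<^esub> x = \<zero>\<^bsub>direct_sum M N\<^esub>"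
        by (auto intro!: bexI[of _ "(\<ominus>\<^bsub>M\<^esub> u, \<ominus>\<^bsub>N\<^esub> v)"] simp: M.M.l_neg N.M.l_neg)
    qed (auto simp: M.M.a_ac N.M.a_ac)
  qed (auto simp: module.axioms(1)[OF assms(2)] M.smult_l_distr N.smult_l_distr M.smult_r_distr N.smult_r_distr
      M.smult_assoc1 N.smult_assoc1)
qed

text \<open>A direct summand whose complement is left unnamed: retracts compose and add by composing
  and pairing maps, over any element types. A complement is produced only where
  \<open>direct_summand\<close> has to be exhibited.\<close>

definition retract ::
  "('a, 'k) ring_scheme \<Rightarrow> ('a, 'b, 'l) module_scheme \<Rightarrow> ('a, 'c, 'p) module_scheme \<Rightarrow> bool" where
  "retract R N M \<longleftrightarrow>
     (\<exists>i \<in> module_hom R N M. \<exists>r \<in> module_hom R M N. \<forall>x \<in> carrier N. r (i x) = x)"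

lemma retractI:
  assumes "i \<in> module_hom R N M" "r \<in> module_hom R M N" "\<And>x. x \<in> carrier N \<Longrightarrow> r (i x) = x"
  shows "retract R N M"
  using assms by (auto simp: retract_def)

lemma retract_trans:
  assumes "retract R L M" "retract R M N"
  shows "retract R L N"
proof -
  obtain i r where 1: "i \<in> module_hom R L M" "r \<in> module_hom R M L" "\<And>x. x \<in> carrier L \<Longrightarrow> r (i x) = x"
    using assms(1) by (auto simp: retract_def)
  obtain j s where 2: "j \<in> module_hom R M N" "s \<in> module_hom R N M" "\<And>x. x \<in> carrier M \<Longrightarrow> s (j x) = x"
    using assms(2) by (auto simp: retract_def)
  show ?thesis
    by (rule retractI[OF hom_compose[OF 1(1) 2(1)] hom_compose[OF 2(2) 1(2)]])
      (use 1 2 in \<open>auto simp: hom_closed\<close>)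
qed

lemma retract_direct_sum:
  assumes "retract R M M'" "retract R N N'"
  shows "retract R (direct_sum M N) (direct_sum M' N')"
proof -
  obtain i r where 1: "i \<in> module_hom R M M'" "r \<in> module_hom R M' M" "\<And>x. x \<in> carrier M \<Longrightarrow> r (i x) = x"
    using assms(1) by (auto simp: retract_def)
  obtain j s where 2: "j \<in> module_hom R N N'" "s \<in> module_hom R N' N" "\<And>x. x \<in> carrier N \<Longrightarrow> s (j x) = x"
    using assms(2) by (auto simp: retract_def)
  show ?thesis
    by (rule retractI[of "\<lambda>(x, y). (i x, j y)" _ _ _ "\<lambda>(x, y). (r x, s y)"])
      (use 1 2 in \<open>auto intro!: module_homI simp: hom_closed hom_add hom_smult\<close>)
qed

lemma
  assumes "module R M" "module R N"
  shows retract_direct_sum1: "retract R M (direct_sum M N)"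
    and retract_direct_sum2: "retract R N (direct_sum M N)"
proof -
  interpret M: module R M by fact
  interpret N: module R N by fact
  show "retract R M (direct_sum M N)"
    by (rule retractI[of "\<lambda>x. (x, \<zero>\<^bsub>N\<^esub>)" _ _ _ fst]) (auto intro!: module_homI)
  show "retract R N (direct_sum M N)"
    by (rule retractI[of "\<lambda>x. (\<zero>\<^bsub>M\<^esub>, x)" _ _ _ snd]) (auto intro!: module_homI)
qed

text \<open>The complement is the kernel of the retraction \<open>r\<close>, since \<open>z\<close>
  is the sum of \<open>i (r z)\<close> and \<open>z - i (r z)\<close>.\<close>

lemma retract_imp_direct_summand:
  fixes M :: "('a, 'c, 'p) module_scheme"
  assumes "module R N" "module R M" "retract R N M"
  shows "direct_summand R N M"
proof -
  interpret N: module R N by fact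
  interpret M: module R M by fact
  obtain i r where 1: "i \<in> module_hom R N M" "r \<in> module_hom R M N" "\<And>x. x \<in> carrier N \<Longrightarrow> r (i x) = x"
    using assms(3) by (auto simp: retract_def)
  note hom = hom_closed[OF 1(1)] hom_closed[OF 1(2)] hom_add[OF 1(1)] hom_add[OF 1(2)]
     hom_smult[OF 1(1)] hom_smult[OF 1(2)] hom_zero[OF assms(1,2) 1(1)] hom_zero[OF assms(2,1) 1(2)]
  \<comment> \<open>Written out field by field because \<open>direct_summand\<close> asks for a
    plain module record, while \<open>M\<close> may have further fields.\<close>
  define L :: "('a, 'c) module" where "L = \<lparr>carrier = {x \<in> carrier M. r x = \<zero>\<^bsub>N\<^esub>},
    monoid.mult = undefined, monoid.one = undefined,
    ring.zero = \<zero>\<^bsub>M\<^esub>, ring.add = (\<oplus>\<^bsub>M\<^esub>), smult = (\<odot>\<^bsub>M\<^esub>)\<rparr>"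
  have L: "carrier L = {x \<in> carrier M. r x = \<zero>\<^bsub>N\<^esub>}" "\<zero>\<^bsub>L\<^esub> = \<zero>\<^bsub>M\<^esub>"
    "\<And>x y. x \<oplus>\<^bsub>L\<^esub> y = x \<oplus>\<^bsub>M\<^esub> y" "\<And>a x. a \<odot>\<^bsub>L\<^esub> x = a \<odot>\<^bsub>M\<^esub> x"
    by (simp_all add: L_def)
  have "module R L"
  proof (rule moduleI)
    show "abelian_group L"
    proof (rule abelian_groupI)
      fix x assume x: "x \<in> carrier L"
      have "r (\<ominus>\<^bsub>M\<^esub> x) = \<zero>\<^bsub>N\<^esub>"
        using hom_diff[OF assms(2,1) 1(2), of "\<zero>\<^bsub>M\<^esub>" x] x by (simp add: L hom a_minus_def)
      thus "\<exists>y\<in>carrier L. y \<oplus>\<^bsub>L\<^esub> x = \<zero>\<^bsub>L\<^esub>"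
        using x by (intro bexI[of _ "\<ominus>\<^bsub>M\<^esub> x"]) (auto simp: L M.M.l_neg)
    qed (auto simp: L M.M.a_ac hom)
  qed (auto simp: L module.axioms(1)[OF assms(2)] M.smult_l_distr M.smult_r_distr M.smult_assoc1 hom)
  moreover have "module_iso R (direct_sum N L) M"
    unfolding module_iso_def
  proof (rule bexI)
    let ?f = "\<lambda>(x, y). i x \<oplus>\<^bsub>M\<^esub> y"
    show "?f \<in> module_hom R (direct_sum N L) M"
      by (auto intro!: module_homI simp: L hom M.M.a_ac M.smult_r_distr)
    show "bij_betw ?f (carrier (direct_sum N L)) (carrier M)"
    proof (rule bij_betw_byWitness[where f' = "\<lambda>z. (r z, z \<ominus>\<^bsub>M\<^esub> i (r z))"])
      have "i x \<oplus>\<^bsub>M\<^esub> y \<ominus>\<^bsub>M\<^esub> i x = y" if "x \<in> carrier N" "y \<in> carrier M" for x y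
        using that hom(1)[of x] M.M.add.m_comm[of "i x" y]
        by (simp add: a_minus_def M.M.a_assoc M.M.r_neg)
      thus "\<forall>a\<in>carrier (direct_sum N L). (r (?f a), ?f a \<ominus>\<^bsub>M\<^esub> i (r (?f a))) = a"
        by (auto simp: L hom 1)
      have "i (r z) \<oplus>\<^bsub>M\<^esub> (z \<ominus>\<^bsub>M\<^esub> i (r z)) = z" if "z \<in> carrier M" for z
        using that hom(2)[of z] hom(1)[of "r z"]
          M.M.a_lcomm[of "i (r z)" z "\<ominus>\<^bsub>M\<^esub> i (r z)"]
        by (simp add: a_minus_def M.M.r_neg)
      thus "\<forall>a'\<in>carrier M. ?f (r a', a' \<ominus>\<^bsub>M\<^esub> i (r a')) = a'"
        by auto
      have "r (z \<ominus>\<^bsub>M\<^esub> i (r z)) = \<zero>\<^bsub>N\<^esub>" if "z \<in> carrier M" for z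
        using that hom_diff[OF assms(2,1) 1(2), of z "i (r z)"] 1(3)[of "r z"]
        by (simp add: hom N.M.r_neg a_minus_def)
      thus "(\<lambda>z. (r z, z \<ominus>\<^bsub>M\<^esub> i (r z))) ` carrier M \<subseteq> carrier (direct_sum N L)"
        by (auto simp: L hom)
    qed (auto simp: L hom)
  qed
  ultimately show ?thesis
    by (auto simp: direct_summand_def)
qed

lemma hom_inverse:
  assumes "module R M" "module R N" "f \<in> module_hom R M N" "bij_betw f (carrier M) (carrier N)"
  obtains g where "g \<in> module_hom R N M" "\<And>x. x \<in> carrier M \<Longrightarrow> g (f x) = x"
    "\<And>y. y \<in> carrier N \<Longrightarrow> f (g y) = y"
proof -
  interpret M: module R M by fact
  interpret N: module R N by fact
  note f = assms(3,4)
  define g where "g = inv_into (carrier M) f"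
  have gf: "\<And>x. x \<in> carrier M \<Longrightarrow> g (f x) = x"
    using f(2) by (auto simp: g_def bij_betw_def)
  have fg: "\<And>x. x \<in> carrier N \<Longrightarrow> f (g x) = x \<and> g x \<in> carrier M"
    using f(2) unfolding g_def bij_betw_def by (auto intro: f_inv_into_f inv_into_into)
  have g: "g \<in> module_hom R N M"
  proof (rule module_homI)
    fix x y assume xy: "x \<in> carrier N" "y \<in> carrier N"
    show "g (x \<oplus>\<^bsub>N\<^esub> y) = g x \<oplus>\<^bsub>M\<^esub> g y"
      using xy fg gf[of "g x \<oplus>\<^bsub>M\<^esub> g y"] hom_add[OF f(1), of "g x" "g y"] by simp
  next
    fix r x assume xy: "r \<in> carrier R" "x \<in> carrier N"
    show "g (r \<odot>\<^bsub>N\<^esub> x) = r \<odot>\<^bsub>M\<^esub> g x"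
      using xy fg gf[of "r \<odot>\<^bsub>M\<^esub> g x"] hom_smult[OF f(1), of r "g x"] by simp
  qed (use fg in auto)
  show thesis using that g gf fg by blast
qed

subsection \<open>Free modules\<close>

text \<open>The multiple \<open>r e_i\<close> of the \<open>i\<close>-th unit vector.\<close>

definition single :: "('a, 'k) ring_scheme \<Rightarrow> 'i \<Rightarrow> 'a \<Rightarrow> 'i \<Rightarrow> 'a" where
  "single R i r = (\<lambda>j. if j = i then r else \<zero>\<^bsub>R\<^esub>)"

lemma single_apply: "single R i r j = (if j = i then r else \<zero>\<^bsub>R\<^esub>)"
  by (simp add: single_def)

lemma free_module_simps [simp]:
  "\<zero>\<^bsub>free_module R B\<^esub> = (\<lambda>i. \<zero>\<^bsub>R\<^esub>)"
  "f \<oplus>\<^bsub>free_module R B\<^esub> g = (\<lambda>i. f i \<oplus>\<^bsub>R\<^esub> g i)"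
  "r \<odot>\<^bsub>free_module R B\<^esub> f = (\<lambda>i. r \<otimes>\<^bsub>R\<^esub> f i)"
  by (simp_all add: free_module_def)

context cring
begin

lemma mem_free_module:
  "f \<in> carrier (free_module R B) \<longleftrightarrow>
    (\<forall>i\<in>B. f i \<in> carrier R) \<and> (\<forall>i. i \<notin> B \<longrightarrow> f i = \<zero>) \<and> finite {i. f i \<noteq> \<zero>}"
  by (simp add: free_module_def)

lemma mem_free_module_finite:
  assumes "finite B"
  shows "f \<in> carrier (free_module R B) \<longleftrightarrow> (\<forall>i\<in>B. f i \<in> carrier R) \<and> (\<forall>i. i \<notin> B \<longrightarrow> f i = \<zero>)"
proof -
  have "finite {i. f i \<noteq> \<zero>}" if "\<forall>i. i \<notin> B \<longrightarrow> f i = \<zero>"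
    by (rule finite_subset[OF _ assms]) (use that in auto)
  thus ?thesis by (auto simp: mem_free_module)
qed

lemma free_module_apply_closed [simp, intro]: "f \<in> carrier (free_module R B) \<Longrightarrow> f i \<in> carrier R"
  by (cases "i \<in> B") (auto simp: mem_free_module)

lemma single_closed [simp, intro]: "i \<in> B \<Longrightarrow> r \<in> carrier R \<Longrightarrow> single R i r \<in> carrier (free_module R B)"
  by (auto simp: mem_free_module single_def)

lemma module_free_module: "module R (free_module R B)"
proof (rule moduleI)
  have add: "(\<lambda>i. f i \<oplus> g i) \<in> carrier (free_module R B)"
    if "f \<in> carrier (free_module R B)" "g \<in> carrier (free_module R B)" for f g
  proof -
    have "finite {i. f i \<oplus> g i \<noteq> \<zero>}"
      by (rule finite_subset[of _ "{i. f i \<noteq> \<zero>} \<union> {i. g i \<noteq> \<zero>}"])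
        (use that in \<open>auto simp: mem_free_module\<close>)
    thus ?thesis using that by (auto simp: mem_free_module)
  qed
  have smult: "(\<lambda>i. r \<otimes> f i) \<in> carrier (free_module R B)"
    if "f \<in> carrier (free_module R B)" "r \<in> carrier R" for f r
  proof -
    have "finite {i. r \<otimes> f i \<noteq> \<zero>}"
      by (rule finite_subset[of _ "{i. f i \<noteq> \<zero>}"])
        (use that in \<open>auto simp: mem_free_module\<close>)
    thus ?thesis using that by (auto simp: mem_free_module)
  qed
  show "abelian_group (free_module R B)"
  proof (rule abelian_groupI)
    fix x assume x: "x \<in> carrier (free_module R B)"
    show "\<exists>y\<in>carrier (free_module R B). y \<oplus>\<^bsub>free_module R B\<^esub> x = \<zero>\<^bsub>free_module R B\<^esub>"
    proof (rule bexI)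
      have "(\<ominus> \<one>) \<otimes> x i \<oplus> x i = \<zero>" for i
        using x free_module_apply_closed[OF x, of i] by (simp add: l_minus l_neg)
      thus "(\<lambda>i. (\<ominus> \<one>) \<otimes> x i) \<oplus>\<^bsub>free_module R B\<^esub> x = \<zero>\<^bsub>free_module R B\<^esub>"
        by simp
      show "(\<lambda>i. (\<ominus> \<one>) \<otimes> x i) \<in> carrier (free_module R B)"
        by (rule smult) (use x in auto)
    qed
  next
    fix x y z assume "x \<in> carrier (free_module R B)" "y \<in> carrier (free_module R B)" "z \<in> carrier (free_module R B)"
    thus "x \<oplus>\<^bsub>free_module R B\<^esub> y \<oplus>\<^bsub>free_module R B\<^esub> z = x \<oplus>\<^bsub>free_module R B\<^esub> (y \<oplus>\<^bsub>free_module R B\<^esub> z)"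
      by (auto intro!: ext a_assoc)
  next
    fix x y assume "x \<in> carrier (free_module R B)" "y \<in> carrier (free_module R B)"
    thus "x \<oplus>\<^bsub>free_module R B\<^esub> y = y \<oplus>\<^bsub>free_module R B\<^esub> x"
      by (auto intro!: ext a_comm)
  next
    fix x assume "x \<in> carrier (free_module R B)"
    thus "\<zero>\<^bsub>free_module R B\<^esub> \<oplus>\<^bsub>free_module R B\<^esub> x = x" by (auto intro!: ext l_zero)
  qed (auto simp: add, auto simp: mem_free_module)
  show "cring R" ..
  fix a x assume "a \<in> carrier R" "x \<in> carrier (free_module R B)"
  thus "a \<odot>\<^bsub>free_module R B\<^esub> x \<in> carrier (free_module R B)" using smult by auto
next
  fix a b x assume "a \<in> carrier R" "b \<in> carrier R" "x \<in> carrier (free_module R B)"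
  thus "(a \<oplus> b) \<odot>\<^bsub>free_module R B\<^esub> x = a \<odot>\<^bsub>free_module R B\<^esub> x \<oplus>\<^bsub>free_module R B\<^esub> b \<odot>\<^bsub>free_module R B\<^esub> x"
    by (auto intro!: ext l_distr)
next
  fix a x y assume "a \<in> carrier R" "x \<in> carrier (free_module R B)" "y \<in> carrier (free_module R B)"
  thus "a \<odot>\<^bsub>free_module R B\<^esub> (x \<oplus>\<^bsub>free_module R B\<^esub> y) = a \<odot>\<^bsub>free_module R B\<^esub> x \<oplus>\<^bsub>free_module R B\<^esub> a \<odot>\<^bsub>free_module R B\<^esub> y"
    by (auto intro!: ext r_distr)
next
  fix a b x assume "a \<in> carrier R" "b \<in> carrier R" "x \<in> carrier (free_module R B)"
  thus "a \<otimes> b \<odot>\<^bsub>free_module R B\<^esub> x = a \<odot>\<^bsub>free_module R B\<^esub> (b \<odot>\<^bsub>free_module R B\<^esub> x)"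
    by (auto intro!: ext m_assoc)
next
  fix x assume "x \<in> carrier (free_module R B)"
  thus "\<one> \<odot>\<^bsub>free_module R B\<^esub> x = x" by (auto intro!: ext l_one)
qed

lemma free_module_closed [simp, intro]:
  "(\<lambda>i. \<zero>) \<in> carrier (free_module R B)"
  "f \<in> carrier (free_module R B) \<Longrightarrow> g \<in> carrier (free_module R B) \<Longrightarrow> (\<lambda>i. f i \<oplus> g i) \<in> carrier (free_module R B)"
  "r \<in> carrier R \<Longrightarrow> f \<in> carrier (free_module R B) \<Longrightarrow> (\<lambda>i. r \<otimes> f i) \<in> carrier (free_module R B)"
proof -
  interpret F: module R "free_module R B" by (rule module_free_module)
  show "(\<lambda>i. \<zero>) \<in> carrier (free_module R B)"
    using F.M.zero_closed by simp
  show "f \<in> carrier (free_module R B) \<Longrightarrow> g \<in> carrier (free_module R B) \<Longrightarrow> (\<lambda>i. f i \<oplus> g i) \<in> carrier (free_module R B)"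
    using F.M.a_closed[of f g] by simp
  show "r \<in> carrier R \<Longrightarrow> f \<in> carrier (free_module R B) \<Longrightarrow> (\<lambda>i. r \<otimes> f i) \<in> carrier (free_module R B)"
    using F.smult_closed[of r f] by simp
qed

lemma free_module_a_inv:
  assumes "f \<in> carrier (free_module R B)"
  shows "\<ominus>\<^bsub>free_module R B\<^esub> f = (\<lambda>i. \<ominus> f i)"
proof -
  interpret F: module R "free_module R B" by (rule module_free_module)
  have "(\<ominus> \<one>) \<odot>\<^bsub>free_module R B\<^esub> f = \<ominus>\<^bsub>free_module R B\<^esub> (\<one> \<odot>\<^bsub>free_module R B\<^esub> f)"
    by (rule F.smult_l_minus) (use assms in auto)
  moreover have "(\<ominus> \<one>) \<otimes> f i = \<ominus> f i" "\<one> \<otimes> f i = f i" for i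
    using free_module_apply_closed[OF assms, of i] by (simp_all add: l_minus)
  ultimately show ?thesis by simp
qed

lemma free_module_minus:
  assumes "f \<in> carrier (free_module R B)" "g \<in> carrier (free_module R B)"
  shows "f \<ominus>\<^bsub>free_module R B\<^esub> g = (\<lambda>i. f i \<ominus> g i)"
  using assms by (simp add: a_minus_def free_module_a_inv)

lemma free_module_minus_closed [simp, intro]:
  assumes "f \<in> carrier (free_module R B)" "g \<in> carrier (free_module R B)"
  shows "(\<lambda>i. f i \<ominus> g i) \<in> carrier (free_module R B)"
proof -
  interpret F: module R "free_module R B" by (rule module_free_module)
  show ?thesis using F.M.minus_closed[OF assms] free_module_minus[OF assms] by simp
qed

lemma hom_free_diff:
  assumes "module R N" "h \<in> module_hom R (free_module R B) N"
    and "x \<in> carrier (free_module R B)" "y \<in> carrier (free_module R B)"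
  shows "h (\<lambda>i. x i \<ominus> y i) = h x \<ominus>\<^bsub>N\<^esub> h y"
  using hom_diff[OF module_free_module assms] free_module_minus[OF assms(3,4)] by simp

lemma smult_single: "r \<in> carrier R \<Longrightarrow> s \<in> carrier R \<Longrightarrow> (\<lambda>j. r \<otimes> single R i s j) = single R i (r \<otimes> s)"
  by (auto simp: single_def fun_eq_iff)

text \<open>Induction on the support. The set \<open>K\<close> of allowed coordinates lets one rule
  serve both for the whole free module \<open>F\<close> (with \<open>K\<close> the carrier of
  \<open>R\<close>) and for \<open>K F\<close> with \<open>K\<close> an ideal.\<close>

lemma free_induct [consumes 3, case_names zero step]:
  assumes "v \<in> carrier (free_module R B)" "\<forall>i\<in>B. v i \<in> K" "\<zero> \<in> K"
    and "P (\<lambda>i. \<zero>)"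
    and step: "\<And>x i r. x \<in> carrier (free_module R B) \<Longrightarrow> P x \<Longrightarrow> i \<in> B \<Longrightarrow> r \<in> K \<Longrightarrow>
       r \<in> carrier R \<Longrightarrow> P (\<lambda>j. x j \<oplus> single R i r j)"
  shows "P v"
proof -
  \<comment> \<open>The support is only bounded by a finite set \<open>D\<close>, so that resetting
    a coordinate shrinks the bound whether or not the coordinate was non-zero.\<close>
  have "P v" if "finite D" "{i. v i \<noteq> \<zero>} \<subseteq> D" "v \<in> carrier (free_module R B)" "\<And>i. i \<in> B \<Longrightarrow> v i \<in> K" for D v
    using that
  proof (induction D arbitrary: v rule: finite_induct)
    case empty
    hence "v = (\<lambda>i. \<zero>)" by auto
    thus ?case using assms(4) by simp
  next
    case (insert k D)
    show ?case
    proof (cases "k \<in> B")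
      case True
      define v' where "v' = v(k := \<zero>)"
      have fin: "finite {i. v' i \<noteq> \<zero>}"
        by (rule finite_subset[OF _ insert.hyps(1)]) (use insert.prems in \<open>auto simp: v'_def\<close>)
      have v': "v' \<in> carrier (free_module R B)"
        using insert.prems(2) fin by (auto simp: mem_free_module v'_def)
      have "P v'"
      proof (rule insert.IH[OF _ v'])
        show "{i. v' i \<noteq> \<zero>} \<subseteq> D" "\<And>i. i \<in> B \<Longrightarrow> v' i \<in> K"
          using insert.prems assms(3) by (auto simp: v'_def)
      qed
      hence "P (\<lambda>j. v' j \<oplus> single R k (v k) j)"
        by (intro step) (use insert.prems True v' in auto)
      also have "(\<lambda>j. v' j \<oplus> single R k (v k) j) = v"
        using insert.prems(2) by (auto simp: v'_def single_def fun_eq_iff)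
      finally show ?thesis .
    next
      case False
      show ?thesis
        by (rule insert.IH) (use insert.prems False in \<open>auto simp: mem_free_module\<close>)
    qed
  qed
  from this[of "{i. v i \<noteq> \<zero>}" v] assms show ?thesis
    by (auto simp: mem_free_module)
qed

text \<open>\<open>h (r e_i) = r h (e_i)\<close> has its coordinates in \<open>K\<close> for
  \<open>r\<close> in \<open>K\<close>.\<close>

lemma ideal_hom_coord:
  assumes K: "ideal K R" and h: "h \<in> module_hom R (free_module R B) (free_module R C)"
    and v: "v \<in> carrier (free_module R B)" "\<forall>i\<in>B. v i \<in> K"
  shows "h v j \<in> K"
proof -
  interpret K: ideal K R by fact
  have "\<forall>j. h v j \<in> K"
    using v K.zero_closed
  proof (induction v rule: free_induct)
    case zero
    show ?case using hom_zero[OF module_free_module module_free_module h] K.zero_closed by simp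
  next
    case (step x i r)
    have "h (\<lambda>j. x j \<oplus> single R i r j) = (\<lambda>j. h x j \<oplus> h (single R i r) j)"
      using hom_add[OF h, of x "single R i r"] step by simp
    moreover have "h (single R i r) = (\<lambda>j. r \<otimes> h (single R i \<one>) j)"
      using hom_smult[OF h, of r "single R i \<one>"] step by (simp add: smult_single)
    moreover have "h (single R i \<one>) j \<in> carrier R" for j
      using hom_closed[OF h, of "single R i \<one>"] step by auto
    ultimately show ?case using step by (auto intro: K.I_r_closed)
  qed
  thus ?thesis by blast
qed

lemma free_hom_exists:
  assumes "finite B" "module R N" "\<And>i. i \<in> B \<Longrightarrow> y i \<in> carrier N"
  obtains g where "g \<in> module_hom R (free_module R B) N"
    "\<And>i r. i \<in> B \<Longrightarrow> r \<in> carrier R \<Longrightarrow> g (single R i r) = r \<odot>\<^bsub>N\<^esub> y i"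
proof -
  interpret N: module R N by fact
  define g where "g = (\<lambda>v. \<Oplus>\<^bsub>N\<^esub>i\<in>B. v i \<odot>\<^bsub>N\<^esub> y i)"
  have 1: "g \<in> module_hom R (free_module R B) N"
  proof (rule module_homI)
    fix x z assume xz: "x \<in> carrier (free_module R B)" "z \<in> carrier (free_module R B)"
    have "g (x \<oplus>\<^bsub>free_module R B\<^esub> z) = (\<Oplus>\<^bsub>N\<^esub>i\<in>B. x i \<odot>\<^bsub>N\<^esub> y i \<oplus>\<^bsub>N\<^esub> z i \<odot>\<^bsub>N\<^esub> y i)"
      unfolding g_def using assms(3) xz by (intro N.M.finsum_cong') (auto simp: N.smult_l_distr)
    also have "\<dots> = g x \<oplus>\<^bsub>N\<^esub> g z"
      unfolding g_def using assms(3) xz by (intro N.M.finsum_addf) auto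
    finally show "g (x \<oplus>\<^bsub>free_module R B\<^esub> z) = g x \<oplus>\<^bsub>N\<^esub> g z" .
  next
    fix r x assume "r \<in> carrier R" "x \<in> carrier (free_module R B)"
    thus "g (r \<odot>\<^bsub>free_module R B\<^esub> x) = r \<odot>\<^bsub>N\<^esub> g x"
      using assms unfolding g_def
      by (subst N.finsum_smult_ldistr) (auto intro!: N.M.finsum_cong' N.smult_assoc1)
  qed (use assms in \<open>auto simp: g_def intro!: N.M.finsum_closed\<close>)
  have 2: "g (single R i r) = r \<odot>\<^bsub>N\<^esub> y i" if "i \<in> B" "r \<in> carrier R" for i r
  proof -
    have "g (single R i r) = (\<Oplus>\<^bsub>N\<^esub>j\<in>B. if i = j then r \<odot>\<^bsub>N\<^esub> y j else \<zero>\<^bsub>N\<^esub>)"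
      unfolding g_def by (rule N.M.finsum_cong') (use that assms in \<open>auto simp: single_def\<close>)
    also have "\<dots> = r \<odot>\<^bsub>N\<^esub> y i"
      by (rule N.M.finsum_singleton) (use that assms in auto)
    finally show ?thesis .
  qed
  show thesis using that 1 2 by blast
qed

lemma free_hom_eqI:
  assumes "module R N" "g \<in> module_hom R (free_module R B) N" "h \<in> module_hom R (free_module R B) N"
    and "\<And>i. i \<in> B \<Longrightarrow> g (single R i \<one>) = h (single R i \<one>)"
    and "v \<in> carrier (free_module R B)"
  shows "g v = h v"
  using assms(5) ballI[OF free_module_apply_closed[OF assms(5)]] zero_closed
proof (induction v rule: free_induct)
  case zero
  show ?case
    using hom_zero[OF module_free_module assms(1,2)] hom_zero[OF module_free_module assms(1,3)] by simp
next
  case (step x i r)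
  have "k (\<lambda>j. x j \<oplus> single R i r j) = k x \<oplus>\<^bsub>N\<^esub> r \<odot>\<^bsub>N\<^esub> k (single R i \<one>)"
    if k: "k \<in> module_hom R (free_module R B) N" for k
    using hom_add[OF k, of x "single R i r"] hom_smult[OF k, of r "single R i \<one>"] step
    by (simp add: smult_single)
  from this[OF assms(2)] this[OF assms(3)] show ?case using assms(4) step by simp
qed

text \<open>Projectivity of \<open>R\<^sup>B\<close>: it suffices to choose preimages of the images
  of the unit vectors, because a map out of \<open>R\<^sup>B\<close> can be prescribed on them and
  is determined by them.\<close>

lemma free_lift:
  assumes "finite B" "module R Z" "module R Y"
    and p: "p \<in> module_hom R (free_module R B) Y"
    and q: "q \<in> module_hom R Z Y" "q ` carrier Z = carrier Y"
  obtains g where "g \<in> module_hom R (free_module R B) Z"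
    "\<And>v. v \<in> carrier (free_module R B) \<Longrightarrow> q (g v) = p v"
proof -
  interpret Z: module R Z by fact
  have "\<exists>x. x \<in> carrier Z \<and> q x = p (single R i \<one>)" if "i \<in> B" for i
  proof -
    have "p (single R i \<one>) \<in> q ` carrier Z"
      using q(2) hom_closed[OF p single_closed[OF that one_closed]] by simp
    thus ?thesis by (elim imageE) metis
  qed
  then obtain y where y: "\<And>i. i \<in> B \<Longrightarrow> y i \<in> carrier Z \<and> q (y i) = p (single R i \<one>)"
    by metis
  obtain g where g: "g \<in> module_hom R (free_module R B) Z"
    "\<And>i r. i \<in> B \<Longrightarrow> r \<in> carrier R \<Longrightarrow> g (single R i r) = r \<odot>\<^bsub>Z\<^esub> y i"
    using free_hom_exists[OF assms(1,2), of y] y by metis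
  show thesis
  proof (rule that[OF g(1)])
    fix v assume v: "v \<in> carrier (free_module R B)"
    have "q (g (single R i \<one>)) = p (single R i \<one>)" if "i \<in> B" for i
      using g(2)[OF that one_closed] y[OF that] by simp
    from free_hom_eqI[OF assms(3) hom_compose[OF g(1) q(1)] p this v]
    show "q (g v) = p v" .
  qed
qed

end

subsection \<open>Minimal covers over a local ring\<close>

text \<open>Only the fact that elements outside \<open>m\<close> are units is retained; the
  noetherian hypothesis is brought in separately where a maximum condition is needed.\<close>

locale local_ring = cring R for R (structure) +
  fixes m
  assumes m_ideal: "ideal m R"
    and one_notin_m: "\<one> \<notin> m"
    and Units_if_notin_m: "x \<in> carrier R \<Longrightarrow> x \<notin> m \<Longrightarrow> x \<in> Units R"
begin

sublocale m: ideal m R by (rule m_ideal)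

lemma m_minus_closed: "a \<in> m \<Longrightarrow> b \<in> m \<Longrightarrow> a \<ominus> b \<in> m"
  by (simp add: a_minus_def)

text \<open>Nakayama's lemma for a submodule of \<open>R\<^sup>C\<close>: the coordinates are removed one at a time
  from the set \<open>D\<close> of those at which the error term may be non-zero.\<close>

lemma nakayama_free:
  assumes "finite C" and N: "N \<subseteq> carrier (free_module R C)"
    and add: "\<And>x y. x \<in> N \<Longrightarrow> y \<in> N \<Longrightarrow> (\<lambda>i. x i \<oplus> y i) \<in> N"
    and smult: "\<And>r x. r \<in> carrier R \<Longrightarrow> x \<in> N \<Longrightarrow> (\<lambda>i. r \<otimes> x i) \<in> N"
    and gen: "\<And>x. x \<in> carrier (free_module R C) \<Longrightarrow> \<exists>z\<in>N. \<forall>i. x i \<ominus> z i \<in> m"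
  shows "N = carrier (free_module R C)"
proof -
  define P where "P D \<longleftrightarrow> (\<forall>x\<in>carrier (free_module R C). \<exists>z\<in>N.
    (\<forall>i. x i \<ominus> z i \<in> m) \<and> (\<forall>i. i \<notin> D \<longrightarrow> x i \<ominus> z i = \<zero>))" for D
  have closed: "x i \<in> carrier R" if "x \<in> N \<or> x \<in> carrier (free_module R C)" for x i
    using that N by auto
  have "P {}" if "finite D" "D \<subseteq> C" "P D" for D
    using that
  proof (induction D)
    case (insert k D)
    have "P D"
      unfolding P_def
    proof
      fix x assume x: "x \<in> carrier (free_module R C)"
      obtain z where z: "z \<in> N" "\<And>i. single R k \<one> i \<ominus> z i \<in> m"
        "\<And>i. i \<notin> insert k D \<Longrightarrow> single R k \<one> i \<ominus> z i = \<zero>"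
        using insert.prems bspec[OF insert.prems(2)[unfolded P_def], of "single R k \<one>"] by auto
      have zc: "z i \<in> carrier R" for i using closed z(1) by blast
      have "z k \<notin> m"
      proof
        assume "z k \<in> m"
        moreover have "\<one> = (\<one> \<ominus> z k) \<oplus> z k"
          using zc[of k] by (simp add: a_minus_def a_assoc l_neg)
        ultimately show False
          using z(2)[of k] one_notin_m m.a_closed[of "\<one> \<ominus> z k" "z k"] by (simp add: single_def)
      qed
      hence u: "z k \<in> Units R" using Units_if_notin_m zc by blast
      define z' where "z' = (\<lambda>i. inv (z k) \<otimes> z i)"
      have z': "z' \<in> N" "z' k = \<one>" and z'c: "\<And>i. z' i \<in> carrier R"
        using u z(1) zc smult by (auto simp: z'_def)
      have z'0: "z' i = \<zero>" if "i \<notin> insert k D" for i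
      proof -
        have "\<zero> \<ominus> z i = \<zero>" using z(3)[OF that] that by (simp add: single_def split: if_splits)
        hence "z i = \<zero>" using zc[of i] by (simp add: a_minus_def)
        thus ?thesis using u by (simp add: z'_def)
      qed
      obtain y where y: "y \<in> N" "\<And>i. x i \<ominus> y i \<in> m"
        "\<And>i. i \<notin> insert k D \<Longrightarrow> x i \<ominus> y i = \<zero>"
        using bspec[OF insert.prems(2)[unfolded P_def] x] by auto
      define c where "c = x k \<ominus> y k"
      have xy: "x i \<in> carrier R" "y i \<in> carrier R" for i using closed x y(1) by blast+
      have c: "c \<in> carrier R" "c \<in> m" using y(2) xy by (auto simp: c_def)
      define y' where "y' = (\<lambda>i. y i \<oplus> c \<otimes> z' i)"
      have eq: "x i \<ominus> y' i = (x i \<ominus> y i) \<ominus> c \<otimes> z' i" for i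
        using xy[of i] c z'c[of i] by (simp add: y'_def a_minus_def minus_add a_assoc)
      show "\<exists>z\<in>N. (\<forall>i. x i \<ominus> z i \<in> m) \<and> (\<forall>i. i \<notin> D \<longrightarrow> x i \<ominus> z i = \<zero>)"
      proof (intro bexI[of _ y'] conjI allI impI)
        show "y' \<in> N" unfolding y'_def using add[OF y(1) smult[OF c(1) z'(1)]] by simp
        fix i show "x i \<ominus> y' i \<in> m"
          unfolding eq using m_minus_closed[OF y(2) m.I_r_closed[OF c(2) z'c]] .
        assume "i \<notin> D"
        show "x i \<ominus> y' i = \<zero>"
        proof (cases "i = k")
          case True
          show ?thesis
            unfolding eq True c_def[symmetric] using c z'(2) by (simp add: a_minus_def r_neg)
        next
          case False
          show ?thesis
            unfolding eq using c y(3)[of i] z'0[of i] \<open>i \<notin> D\<close> False by (simp add: a_minus_def)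
        qed
      qed
    qed
    thus ?case using insert by blast
  qed auto
  moreover have "P C"
    unfolding P_def
  proof
    fix x assume x: "x \<in> carrier (free_module R C)"
    from gen[OF this] obtain z where z: "z \<in> N" "\<forall>i. x i \<ominus> z i \<in> m" by blast
    have "x i \<ominus> z i = \<zero>" if "i \<notin> C" for i
      using that x z(1) N by (auto simp: mem_free_module a_minus_def)
    thus "\<exists>z\<in>N. (\<forall>i. x i \<ominus> z i \<in> m) \<and> (\<forall>i. i \<notin> C \<longrightarrow> x i \<ominus> z i = \<zero>)"
      using z by blast
  qed
  ultimately have P: "P {}" using assms(1) by blast
  show ?thesis
  proof
    show "carrier (free_module R C) \<subseteq> N"
    proof
      fix x assume x: "x \<in> carrier (free_module R C)"
      then obtain z where z: "z \<in> N" "\<And>i. x i \<ominus> z i = \<zero>"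
        using P by (auto simp: P_def)
      have "x i = z i" for i
        using z(2)[of i] closed[of x i] closed[of z i] x z(1) by (simp add: r_right_minus_eq)
      hence "x = z" by auto
      thus "x \<in> N" using z by simp
    qed
  qed (rule N)
qed

text \<open>\<open>x = f x + (x - f x)\<close> shows that the image of \<open>f\<close> and
  \<open>m R\<^sup>C\<close> together fill \<open>R\<^sup>C\<close>, as Nakayama's lemma
  requires.\<close>

lemma near_id_surj:
  assumes "finite C" and f: "f \<in> module_hom R (free_module R C) (free_module R C)"
    and near: "\<And>v i. v \<in> carrier (free_module R C) \<Longrightarrow> f v i \<ominus> v i \<in> m"
  shows "f ` carrier (free_module R C) = carrier (free_module R C)"
proof (rule nakayama_free[OF assms(1)])
  show "f ` carrier (free_module R C) \<subseteq> carrier (free_module R C)"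
    using hom_closed[OF f] by auto
  show "\<And>x y. x \<in> f ` carrier (free_module R C) \<Longrightarrow> y \<in> f ` carrier (free_module R C) \<Longrightarrow>
    (\<lambda>i. x i \<oplus> y i) \<in> f ` carrier (free_module R C)"
  proof (elim imageE, goal_cases)
    case (1 x y v w)
    thus ?case using hom_add[OF f, of v w] by (intro image_eqI[of _ _ "\<lambda>i. v i \<oplus> w i"]) auto
  qed
  show "\<And>r x. r \<in> carrier R \<Longrightarrow> x \<in> f ` carrier (free_module R C) \<Longrightarrow>
    (\<lambda>i. r \<otimes> x i) \<in> f ` carrier (free_module R C)"
  proof (elim imageE, goal_cases)
    case (1 r x v)
    thus ?case using hom_smult[OF f, of r v] by (intro image_eqI[of _ _ "\<lambda>i. r \<otimes> v i"]) auto
  qed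
  fix x assume x: "x \<in> carrier (free_module R C)"
  have "x i \<ominus> f x i \<in> m" for i
  proof -
    have c: "x i \<in> carrier R" "f x i \<in> carrier R" using x hom_closed[OF f x] by auto
    hence "x i \<ominus> f x i = \<ominus> (f x i \<ominus> x i)"
      by (simp add: a_minus_def minus_add a_comm)
    thus ?thesis using near[OF x, of i] by simp
  qed
  thus "\<exists>z\<in>f ` carrier (free_module R C). \<forall>i. x i \<ominus> z i \<in> m" using x by blast
qed

text \<open>Injectivity: a section \<open>s\<close> of \<open>f\<close> is again congruent to the identity, hence surjective.\<close>

lemma near_id_bij:
  assumes "finite C" and f: "f \<in> module_hom R (free_module R C) (free_module R C)"
    and near: "\<And>v i. v \<in> carrier (free_module R C) \<Longrightarrow> f v i \<ominus> v i \<in> m"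
  shows "bij_betw f (carrier (free_module R C)) (carrier (free_module R C))"
proof -
  let ?F = "free_module R C"
  interpret F: module R ?F by (rule module_free_module)
  have id: "(\<lambda>v. v) \<in> module_hom R ?F ?F" by (rule module_homI) auto
  have surj: "f ` carrier ?F = carrier ?F" by (rule near_id_surj[OF assms])
  obtain s where s: "s \<in> module_hom R ?F ?F" "\<And>v. v \<in> carrier ?F \<Longrightarrow> f (s v) = v"
    using free_lift[OF assms(1) module_free_module module_free_module id f surj] by blast
  have "s v i \<ominus> v i \<in> m" if v: "v \<in> carrier ?F" for v i
  proof -
    have sv: "s v \<in> carrier ?F" using hom_closed[OF s(1) v] .
    have c: "v i \<in> carrier R" "s v i \<in> carrier R" using v sv by auto
    have "v i \<ominus> s v i \<in> m" using near[OF sv, of i] s(2)[OF v] by simp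
    moreover have "s v i \<ominus> v i = \<ominus> (v i \<ominus> s v i)"
      using c by (simp add: a_minus_def minus_add a_comm)
    ultimately show ?thesis by simp
  qed
  hence surj_s: "s ` carrier ?F = carrier ?F" by (rule near_id_surj[OF assms(1) s(1)])
  have "inj_on f (carrier ?F)"
  proof (rule inj_onI)
    fix x y assume xy: "x \<in> carrier ?F" "y \<in> carrier ?F" "f x = f y"
    have "x \<in> s ` carrier ?F" "y \<in> s ` carrier ?F" using xy surj_s by simp_all
    then obtain v w where "v \<in> carrier ?F" "x = s v" "w \<in> carrier ?F" "y = s w" by blast
    thus "x = y" using s(2) xy(3) by metis
  qed
  thus ?thesis using surj by (simp add: bij_betw_def)
qed

text \<open>A minimal free cover of finite rank, with kernel inside \<open>m R\<^sup>B\<close>. The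
  index type is left open: sums of covers are indexed by sum types, the terms of the given
  resolution by \<open>nat\<close>.\<close>

definition cover ::
  "'i set \<Rightarrow> (('i \<Rightarrow> 'a) \<Rightarrow> 'c) \<Rightarrow> ('a, 'c, 'p) module_scheme \<Rightarrow> bool" where
  "cover B p Y \<longleftrightarrow> finite B \<and> p \<in> module_hom R (free_module R B) Y \<and>
     p ` carrier (free_module R B) = carrier Y \<and>
     (\<forall>v\<in>carrier (free_module R B). p v = \<zero>\<^bsub>Y\<^esub> \<longrightarrow> (\<forall>i. v i \<in> m))"

abbreviation syz ::
  "'i set \<Rightarrow> (('i \<Rightarrow> 'a) \<Rightarrow> 'c) \<Rightarrow> ('a, 'c, 'p) module_scheme \<Rightarrow> ('a, 'i \<Rightarrow> 'a) module" where
  "syz B p Y \<equiv> ker_module (free_module R B) Y p"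

lemma coverD:
  assumes "cover B p Y"
  shows "finite B" "p \<in> module_hom R (free_module R B) Y"
     "p ` carrier (free_module R B) = carrier Y"
     "\<And>v i. v \<in> carrier (free_module R B) \<Longrightarrow> p v = \<zero>\<^bsub>Y\<^esub> \<Longrightarrow> v i \<in> m"
  using assms by (auto simp: cover_def)

lemma module_syz: "module R Y \<Longrightarrow> cover B p Y \<Longrightarrow> module R (syz B p Y)"
  by (rule module_ker_module[OF module_free_module]) (auto dest: coverD)

text \<open>Inclusion and retraction lift to the covers. The composite \<open>f\<close> of the lifts
  lifts the identity of \<open>Y'\<close>, so it differs from the identity by vectors in the kernel
  of \<open>p'\<close>, whose coordinates are in \<open>m\<close>. Hence \<open>f\<close> is
  invertible, and its inverse corrects \<open>r'\<close>. For \<open>Y = Y'\<close> this compares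
  the syzygies of two covers of one module.\<close>

lemma syz_retract:
  assumes Y: "module R Y" "module R Y'" and c: "cover B p Y" "cover B' p' Y'"
    and ret: "retract R Y' Y"
  shows "retract R (syz B' p' Y') (syz B p Y)"
proof -
  let ?F = "free_module R B" and ?F' = "free_module R B'"
  note F = module_free_module[of B] and F' = module_free_module[of B']
  interpret Y: module R Y by fact
  interpret Y': module R Y' by fact
  obtain i r where i: "i \<in> module_hom R Y' Y" and r: "r \<in> module_hom R Y Y'"
    and ri: "\<And>x. x \<in> carrier Y' \<Longrightarrow> r (i x) = x"
    using ret by (auto simp: retract_def)
  note p = coverD[OF c(1)] and p' = coverD[OF c(2)]
  obtain i' where i': "i' \<in> module_hom R ?F' ?F" "\<And>v. v \<in> carrier ?F' \<Longrightarrow> p (i' v) = i (p' v)"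
    using free_lift[OF p'(1) F Y(1) hom_compose[OF p'(2) i] p(2,3)] by blast
  obtain r' where r': "r' \<in> module_hom R ?F ?F'" "\<And>v. v \<in> carrier ?F \<Longrightarrow> p' (r' v) = r (p v)"
    using free_lift[OF p(1) F' Y(2) hom_compose[OF p(2) r] p'(2,3)] by blast
  define f where "f = (\<lambda>v. r' (i' v))"
  have f: "f \<in> module_hom R ?F' ?F'"
    unfolding f_def by (rule hom_compose[OF i'(1) r'(1)])
  have p'f: "p' (f v) = p' v" if "v \<in> carrier ?F'" for v
    using that i' r' ri hom_closed[OF i'(1)] hom_closed[OF p'(2)] by (simp add: f_def)
  have "f v j \<ominus> v j \<in> m" if v: "v \<in> carrier ?F'" for v j
  proof -
    have fv: "f v \<in> carrier ?F'" using hom_closed[OF f v] .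
    have "p' (\<lambda>i. f v i \<ominus> v i) = \<zero>\<^bsub>Y'\<^esub>"
      using hom_free_diff[OF Y(2) p'(2) fv v] p'f[OF v] hom_closed[OF p'(2) v]
      by (simp add: a_minus_def[of Y'] Y'.M.r_neg)
    thus ?thesis using p'(4)[of "\<lambda>i. f v i \<ominus> v i" j] fv v by simp
  qed
  hence "bij_betw f (carrier ?F') (carrier ?F')" by (rule near_id_bij[OF p'(1) f])
  then obtain g where g: "g \<in> module_hom R ?F' ?F'" "\<And>x. x \<in> carrier ?F' \<Longrightarrow> g (f x) = x"
    "\<And>x. x \<in> carrier ?F' \<Longrightarrow> f (g x) = x"
    using hom_inverse[OF F' F' f] by blast
  \<comment> \<open>The inverse \<open>g\<close> lifts the identity as well, so \<open>g r'\<close>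
    still carries the kernel of \<open>p\<close> into the kernel of \<open>p'\<close>.\<close>
  have p'g: "p' (g v) = p' v" if "v \<in> carrier ?F'" for v
    using p'f[of "g v"] g(3)[OF that] hom_closed[OF g(1) that] by simp
  show ?thesis
  proof (rule retractI)
    show "i' \<in> module_hom R (syz B' p' Y') (syz B p Y)"
      by (rule module_homI)
        (use hom_closed[OF i'(1)] hom_add[OF i'(1)] hom_smult[OF i'(1)] i'(2)
          hom_zero[OF Y(2) Y(1) i] in auto)
    show "(\<lambda>v. g (r' v)) \<in> module_hom R (syz B p Y) (syz B' p' Y')"
      by (rule module_homI)
        (use hom_closed[OF hom_compose[OF r'(1) g(1)]] hom_add[OF hom_compose[OF r'(1) g(1)]]
          hom_smult[OF hom_compose[OF r'(1) g(1)]] r'(2) p'g hom_closed[OF r'(1)]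
          hom_zero[OF Y(1) Y(2) r] in auto)
    show "\<And>x. x \<in> carrier (syz B' p' Y') \<Longrightarrow> g (r' (i' x)) = x"
      using g(2) by (auto simp: f_def)
  qed
qed

section \<open>Covers of direct sums, and existence of covers\<close>

lemma mem_free_module_Plus:
  assumes "finite B" "finite C"
  shows "v \<in> carrier (free_module R (Sum_Type.Plus B C)) \<longleftrightarrow>
    (\<lambda>i. v (Inl i)) \<in> carrier (free_module R B) \<and> (\<lambda>i. v (Inr i)) \<in> carrier (free_module R C)"
proof -
  have "finite (Sum_Type.Plus B C)" using assms by (rule finite_Plus)
  show ?thesis
    unfolding mem_free_module_finite[OF \<open>finite (Sum_Type.Plus B C)\<close>] mem_free_module_finite[OF assms(1)]
      mem_free_module_finite[OF assms(2)]
    by (auto simp: split_sum_all)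
qed

text \<open>Both blocks of coordinates are handled separately on the disjoint union of
  \<open>B\<close> and \<open>C\<close>; minimality concerns single coordinates and therefore
  survives.\<close>

lemma cover_sum:
  assumes Y: "module R Y" "module R Z" and c: "cover B p Y" "cover C q Z"
  defines "s \<equiv> \<lambda>f. (p (\<lambda>i. f (Inl i)), q (\<lambda>i. f (Inr i)))"
  shows "cover (Sum_Type.Plus B C) s (direct_sum Y Z)"
    and "retract R (direct_sum (syz B p Y) (syz C q Z)) (syz (Sum_Type.Plus B C) s (direct_sum Y Z))"
proof -
  note p = coverD[OF c(1)] and q = coverD[OF c(2)]
  note mem = mem_free_module_Plus[OF p(1) q(1)]
  show "cover (Sum_Type.Plus B C) s (direct_sum Y Z)"
    unfolding cover_def
  proof (intro conjI ballI impI allI)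
    show "s \<in> module_hom R (free_module R (Sum_Type.Plus B C)) (direct_sum Y Z)"
    proof (rule module_homI)
      fix x y assume "x \<in> carrier (free_module R (Sum_Type.Plus B C))" "y \<in> carrier (free_module R (Sum_Type.Plus B C))"
      thus "s (x \<oplus>\<^bsub>free_module R (Sum_Type.Plus B C)\<^esub> y) = s x \<oplus>\<^bsub>direct_sum Y Z\<^esub> s y"
        using hom_add[OF p(2), of "\<lambda>i. x (Inl i)" "\<lambda>i. y (Inl i)"]
          hom_add[OF q(2), of "\<lambda>i. x (Inr i)" "\<lambda>i. y (Inr i)"] by (simp add: mem s_def)
    next
      fix r x assume "r \<in> carrier R" "x \<in> carrier (free_module R (Sum_Type.Plus B C))"
      thus "s (r \<odot>\<^bsub>free_module R (Sum_Type.Plus B C)\<^esub> x) = r \<odot>\<^bsub>direct_sum Y Z\<^esub> s x"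
        using hom_smult[OF p(2), of r "\<lambda>i. x (Inl i)"]
          hom_smult[OF q(2), of r "\<lambda>i. x (Inr i)"] by (simp add: mem s_def)
    qed (auto simp: mem s_def hom_closed[OF p(2)] hom_closed[OF q(2)])
    show "s ` carrier (free_module R (Sum_Type.Plus B C)) = carrier (direct_sum Y Z)"
    proof (intro equalityI subsetI)
      fix z assume "z \<in> carrier (direct_sum Y Z)"
      then obtain a b where ab: "z = (a, b)" "a \<in> p ` carrier (free_module R B)"
        "b \<in> q ` carrier (free_module R C)" using p(3) q(3) by auto
      then obtain u v where "a = p u" "u \<in> carrier (free_module R B)"
        "b = q v" "v \<in> carrier (free_module R C)" by blast
      thus "z \<in> s ` carrier (free_module R (Sum_Type.Plus B C))"
        using ab(1) by (intro image_eqI[of _ _ "case_sum u v"]) (auto simp: s_def mem)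
    qed (auto simp: mem s_def hom_closed[OF p(2)] hom_closed[OF q(2)])
    fix v i assume "v \<in> carrier (free_module R (Sum_Type.Plus B C))" "s v = \<zero>\<^bsub>direct_sum Y Z\<^esub>"
    thus "v i \<in> m"
      using p(4)[of "\<lambda>i. v (Inl i)"] q(4)[of "\<lambda>i. v (Inr i)"]
      by (cases i) (auto simp: s_def mem)
  qed (use finite_Plus[OF p(1) q(1)] in auto)
  show "retract R (direct_sum (syz B p Y) (syz C q Z)) (syz (Sum_Type.Plus B C) s (direct_sum Y Z))"
    by (rule retractI[of "\<lambda>(u, v). case_sum u v" _ _ _ "\<lambda>f. (\<lambda>i. f (Inl i), \<lambda>i. f (Inr i))"])
      (auto intro!: module_homI simp: mem s_def fun_eq_iff split: sum.splits)
qed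

lemma syz_retract_sum:
  assumes "module R W" "module R Y" "module R Z"
    and "cover A w W" "cover B p Y" "cover C q Z"
    and "retract R (direct_sum Y Z) W"
  shows "retract R (direct_sum (syz B p Y) (syz C q Z)) (syz A w W)"
  using retract_trans[OF cover_sum(2)[OF assms(2,3,5,6)]
      syz_retract[OF assms(1) module_direct_sum[OF assms(2,3)] assms(4) cover_sum(1)[OF assms(2,3,5,6)] assms(7)]] .

lemma cover_exists:
  assumes "module R Y" "finite B" "p \<in> module_hom R (free_module R B) Y"
    "p ` carrier (free_module R B) = carrier Y"
  shows "\<exists>B'. cover B' p Y"
  using assms(2-)
proof (induction B rule: finite_psubset_induct)
  case (psubset B)
  interpret Y: module R Y by fact
  let ?F = "free_module R B"
  note p = psubset.prems
  show ?case
  proof (cases "cover B p Y")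
    case False
    then obtain v k where v: "v \<in> carrier ?F" "p v = \<zero>\<^bsub>Y\<^esub>" "v k \<notin> m"
      using psubset by (auto simp: cover_def)
    have k: "k \<in> B"
      using v(1,3) m.zero_closed by (auto simp: mem_free_module)
    have u: "v k \<in> Units R" using Units_if_notin_m v(1,3) by auto
    let ?F' = "free_module R (B - {k})"
    have sub: "x \<in> carrier ?F" if "x \<in> carrier ?F'" for x
      using that by (auto simp: mem_free_module)
    show ?thesis
    proof (rule psubset.IH[of "B - {k}"])
      show "p \<in> module_hom R ?F' Y"
        using hom_closed[OF p(1)] hom_add[OF p(1)] hom_smult[OF p(1)] sub
        by (intro module_homI) auto
      show "p ` carrier ?F' = carrier Y"
      proof (intro equalityI subsetI)
        fix y assume "y \<in> carrier Y"
        hence "y \<in> p ` carrier ?F" using p(2) by simp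
        then obtain x where x: "x \<in> carrier ?F" "y = p x" by blast
        \<comment> \<open>This \<open>c\<close> makes the \<open>k\<close>-th coordinate of
          \<open>x - c v\<close> vanish, and \<open>p v = 0\<close> keeps the image
          unchanged.\<close>
        define c where "c = x k \<otimes> inv (v k)"
        have c: "c \<in> carrier R" using x u by (auto simp: c_def)
        define x' where "x' = (\<lambda>i. x i \<ominus> c \<otimes> v i)"
        have cv: "(\<lambda>i. c \<otimes> v i) \<in> carrier ?F" using c v by simp
        have x'F: "x' \<in> carrier ?F" unfolding x'_def using x c v by simp
        have "x' k = \<zero>"
          using u x by (auto simp: x'_def c_def m_assoc Units_closed a_minus_def r_neg)
        hence "x' \<in> carrier ?F'" using x'F by (auto simp: mem_free_module)
        moreover have "p x' = y"
          using hom_free_diff[OF assms(1) p(1) x(1) cv] hom_smult[OF p(1) c v(1)]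
            v(2) x hom_closed[OF p(1) x(1)] c
          by (simp add: x'_def a_minus_def[of Y])
        ultimately show "y \<in> p ` carrier ?F'" by auto
      qed (use sub hom_closed[OF p(1)] in auto)
    qed (use k in auto)
  qed auto
qed

text \<open>A retract of \<open>Y\<close> is a quotient of \<open>Y\<close>, hence of the free
  module covering it. The index type of the given cover is kept, so the new cover can be obtained
  inside a proof, where types are fixed.\<close>

lemma cover_exists_retract:
  fixes B :: "'i set"
  assumes "module R Y" "module R Y'" "cover B p Y" "retract R Y' Y"
  obtains B' p' where "cover (B' :: 'i set) p' Y'"
proof -
  obtain i r where i: "i \<in> module_hom R Y' Y" and r: "r \<in> module_hom R Y Y'"
    and ri: "\<And>x. x \<in> carrier Y' \<Longrightarrow> r (i x) = x"
    using assms(4) by (auto simp: retract_def)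
  note p = coverD[OF assms(3)]
  have "carrier Y' = r ` carrier Y"
    using hom_closed[OF i] hom_closed[OF r] ri by (force intro: image_eqI[of _ r "i _"])
  hence "(\<lambda>v. r (p v)) ` carrier (free_module R B) = carrier Y'"
    using p(3) by (simp add: image_image[of r p, symmetric])
  from cover_exists[OF assms(2) p(1) hom_compose[OF p(2) r] this] show thesis
    using that by blast
qed

end

subsection \<open>Decomposable maximal ideals\<close>

lemma ideal_module_simps [simp]:
  "carrier (ideal_module R K) = K" "\<zero>\<^bsub>ideal_module R K\<^esub> = \<zero>\<^bsub>R\<^esub>"
  "x \<oplus>\<^bsub>ideal_module R K\<^esub> y = x \<oplus>\<^bsub>R\<^esub> y" "r \<odot>\<^bsub>ideal_module R K\<^esub> x = r \<otimes>\<^bsub>R\<^esub> x"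
  by (simp_all add: ideal_module_def)

lemma (in cring) module_ideal_module:
  assumes "ideal K R"
  shows "module R (ideal_module R K)"
proof -
  interpret K: ideal K R by fact
  show ?thesis
  proof (rule moduleI)
    show "abelian_group (ideal_module R K)"
    proof (rule abelian_groupI)
      fix x assume "x \<in> carrier (ideal_module R K)"
      thus "\<exists>y\<in>carrier (ideal_module R K). y \<oplus>\<^bsub>ideal_module R K\<^esub> x = \<zero>\<^bsub>ideal_module R K\<^esub>"
        by (intro bexI[of _ "\<ominus> x"]) (auto simp: l_neg K.Icarr)
    qed (auto simp: a_ac K.Icarr)
  qed (auto simp: is_cring l_distr r_distr m_assoc K.Icarr K.I_l_closed)
qed

text \<open>For \<open>N\<close> inside a free module \<open>F\<close> this is the intersection of
  \<open>N\<close> with \<open>K F\<close>. The \<open>I\<close>-part and the \<open>J\<close>-part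
  of the second syzygy are the modules \<open>A\<close> and \<open>B\<close> of the
  decomposition.\<close>

definition part :: "'a set \<Rightarrow> ('a, 'i \<Rightarrow> 'a) module \<Rightarrow> ('a, 'i \<Rightarrow> 'a) module" where
  "part K N = N\<lparr>carrier := {f \<in> carrier N. \<forall>i. f i \<in> K}\<rparr>"

lemma part_simps [simp]:
  "carrier (part K N) = {f \<in> carrier N. \<forall>i. f i \<in> K}" "\<zero>\<^bsub>part K N\<^esub> = \<zero>\<^bsub>N\<^esub>"
  "x \<oplus>\<^bsub>part K N\<^esub> y = x \<oplus>\<^bsub>N\<^esub> y" "r \<odot>\<^bsub>part K N\<^esub> x = r \<odot>\<^bsub>N\<^esub> x"
  by (simp_all add: part_def)

lemma (in cring) module_part:
  assumes "ideal K R" "module R N" "h \<in> module_hom R (free_module R B) N"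
  shows "module R (part K (ker_module (free_module R B) N h))"
proof -
  interpret K: ideal K R by fact
  note ker = module_ker_module[OF module_free_module assms(2,3)]
  interpret N: module R "ker_module (free_module R B) N h" by (rule ker)
  show ?thesis
    unfolding part_def
    by (rule module_restrict[OF ker])
      (use N.M.zero_closed N.M.a_closed N.smult_closed in \<open>auto simp: K.I_l_closed\<close>)
qed

text \<open>\<open>h (r e_i) = r h (e_i)\<close> is zero for \<open>r\<close> in \<open>K\<close>,
  so the kernel contains \<open>K R\<^sup>B\<close>.\<close>

lemma (in cring) hom_annihilated:
  assumes "module R N" "h \<in> module_hom R (free_module R B) N" "ideal K R"
    and ann: "\<And>r x. r \<in> K \<Longrightarrow> x \<in> carrier N \<Longrightarrow> r \<odot>\<^bsub>N\<^esub> x = \<zero>\<^bsub>N\<^esub>"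
    and v: "v \<in> carrier (free_module R B)" "\<And>i. v i \<in> K"
  shows "h v = \<zero>\<^bsub>N\<^esub>"
proof -
  interpret K: ideal K R by fact
  interpret N: module R N by fact
  have "\<forall>i\<in>B. v i \<in> K" using v by blast
  with v(1) show ?thesis
    using K.zero_closed
  proof (induction v rule: free_induct)
    case zero
    show ?case using hom_zero[OF module_free_module assms(1,2)] by simp
  next
    case (step x i r)
    have "h (single R i r) = r \<odot>\<^bsub>N\<^esub> h (single R i \<one>)"
      using hom_smult[OF assms(2), of r "single R i \<one>"] step by (simp add: smult_single)
    also have "\<dots> = \<zero>\<^bsub>N\<^esub>"
      using ann step hom_closed[OF assms(2)] by simp
    finally show ?case using hom_add[OF assms(2), of x "single R i r"] step by simp
  qed
qed

text \<open>The projection of \<open>I \<oplus> J\<close> onto the ideal named first, along the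
  second; exchanging them gives the other component. The value outside the sum is
  unspecified.\<close>

definition pr :: "('a, 'k) ring_scheme \<Rightarrow> 'a set \<Rightarrow> 'a set \<Rightarrow> 'a \<Rightarrow> 'a" where
  "pr R I J x = (SOME a. a \<in> I \<and> (\<exists>b\<in>J. x = a \<oplus>\<^bsub>R\<^esub> b))"

locale split_local = local_ring +
  fixes I J
  assumes I_ideal: "ideal I R" and J_ideal: "ideal J R"
    and I_nz: "I \<noteq> {\<zero>}" and J_nz: "J \<noteq> {\<zero>}"
    and m_eq: "m = I <+>\<^bsub>R\<^esub> J" and I_Int_J: "I \<inter> J = {\<zero>}"
begin

sublocale I: ideal I R by (rule I_ideal)
sublocale J: ideal J R by (rule J_ideal)

text \<open>The hypotheses are symmetric in the two ideals, so each result has a mirror image,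
  available through the interpretation \<open>sw\<close>.\<close>

lemma swap: "split_local R m J I"
  using I_ideal J_ideal I_nz J_nz m_eq I_Int_J set_add_comm[OF I.a_subset J.a_subset]
  by unfold_locales auto

lemma mem_m: "x \<in> m \<longleftrightarrow> (\<exists>a\<in>I. \<exists>b\<in>J. x = a \<oplus> b)"
  unfolding m_eq set_add_def' by auto

lemma I_m: "a \<in> I \<Longrightarrow> a \<in> m"
  unfolding mem_m by (rule bexI[of _ a], rule bexI[of _ \<zero>]) (simp_all add: I.Icarr)

lemma J_m: "b \<in> J \<Longrightarrow> b \<in> m"
  unfolding mem_m by (rule bexI[of _ \<zero>], rule bexI[of _ b]) (simp_all add: J.Icarr)

lemma I_J_zero: "a \<in> I \<Longrightarrow> b \<in> J \<Longrightarrow> a \<otimes> b = \<zero>"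
  using I.I_r_closed[OF _ J.Icarr, of a b] J.I_l_closed[OF _ I.Icarr, of b a] I_Int_J by auto

lemma J_I_zero: "a \<in> I \<Longrightarrow> b \<in> J \<Longrightarrow> b \<otimes> a = \<zero>"
  using I_J_zero[of a b] m_comm[of a b] by (simp add: I.Icarr J.Icarr)

lemma pr_unique:
  assumes "a \<in> I" "b \<in> J" "a' \<in> I" "b' \<in> J" "a \<oplus> b = a' \<oplus> b'"
  shows "a = a'"
proof -
  have c: "a \<in> carrier R" "b \<in> carrier R" "a' \<in> carrier R" "b' \<in> carrier R"
    using assms by auto
  have "a \<ominus> a' = ((a \<oplus> b) \<ominus> b) \<ominus> a'"
    using c by (simp add: a_minus_def a_assoc r_neg)
  also have "\<dots> = b' \<ominus> b"
    unfolding assms(5) using c a_lcomm[of a' b' "\<ominus> a' \<oplus> \<ominus> b"]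
    by (simp add: a_minus_def a_assoc a_comm[of "\<ominus> b" "\<ominus> a'"] r_neg2)
  finally have eq: "a \<ominus> a' = b' \<ominus> b" .
  have "a \<ominus> a' \<in> I" using assms by (simp add: a_minus_def)
  moreover have "a \<ominus> a' \<in> J" unfolding eq using assms by (simp add: a_minus_def)
  ultimately have "a \<ominus> a' = \<zero>" using I_Int_J by blast
  thus ?thesis using c by (simp add: r_right_minus_eq)
qed

lemma pr_eq:
  assumes "a \<in> I" "b \<in> J"
  shows "pr R I J (a \<oplus> b) = a"
  unfolding pr_def
proof (rule some_equality)
  fix x assume "x \<in> I \<and> (\<exists>b'\<in>J. a \<oplus> b = x \<oplus> b')"
  then obtain b' where "x \<in> I" "b' \<in> J" "x \<oplus> b' = a \<oplus> b" by metis
  thus "x = a" using assms pr_unique by metis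
qed (use assms in blast)

lemma pr_I: "a \<in> I \<Longrightarrow> pr R I J a = a"
  using pr_eq[of a \<zero>] by simp

lemma pr_decomp:
  assumes "x \<in> m"
  shows "pr R I J x \<in> I" "pr R J I x \<in> J" "pr R I J x \<oplus> pr R J I x = x"
proof -
  interpret sw: split_local R m J I by (rule swap)
  obtain a b where ab: "a \<in> I" "b \<in> J" "x = a \<oplus> b" using assms mem_m by blast
  hence "x = b \<oplus> a" using a_comm[of a b] by simp
  hence "pr R I J x = a" "pr R J I x = b" using ab pr_eq[of a b] sw.pr_eq[of b a] by simp_all
  thus "pr R I J x \<in> I" "pr R J I x \<in> J" "pr R I J x \<oplus> pr R J I x = x" using ab by simp_all
qed

lemma pr_add:
  assumes "x \<in> m" "y \<in> m"
  shows "pr R I J (x \<oplus> y) = pr R I J x \<oplus> pr R I J y"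
proof -
  obtain a b where ab: "a \<in> I" "b \<in> J" "x = a \<oplus> b" using assms mem_m by blast
  obtain a' b' where ab': "a' \<in> I" "b' \<in> J" "y = a' \<oplus> b'" using assms mem_m by blast
  have "x \<oplus> y = (a \<oplus> a') \<oplus> (b \<oplus> b')"
    using ab ab' by (simp add: a_ac I.Icarr J.Icarr)
  thus ?thesis using ab ab' by (simp add: pr_eq)
qed

lemma pr_smult:
  assumes "x \<in> m" "r \<in> carrier R"
  shows "pr R I J (r \<otimes> x) = r \<otimes> pr R I J x"
proof -
  obtain a b where ab: "a \<in> I" "b \<in> J" "x = a \<oplus> b" using assms mem_m by blast
  have "r \<otimes> x = r \<otimes> a \<oplus> r \<otimes> b"
    using ab assms by (simp add: r_distr I.Icarr J.Icarr)
  thus ?thesis using ab assms by (simp add: pr_eq I.I_l_closed J.I_l_closed)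
qed

lemma pr_zero: "pr R I J \<zero> = \<zero>"
  using pr_I by simp

lemma pr_free_closed:
  assumes "v \<in> carrier (free_module R B)" "\<And>i. v i \<in> m"
  shows "(\<lambda>i. pr R I J (v i)) \<in> carrier (free_module R B)"
proof -
  have "finite {i. pr R I J (v i) \<noteq> \<zero>}"
    by (rule finite_subset[of _ "{i. v i \<noteq> \<zero>}"]) (use assms pr_zero in \<open>auto simp: mem_free_module\<close>)
  thus ?thesis using assms pr_decomp(1) pr_zero by (auto simp: mem_free_module I.Icarr)
qed

text \<open>This reduces the search for a copy of \<open>m\<close> to separate copies of
  \<open>I\<close> and \<open>J\<close>.\<close>

lemma retract_m_direct_sum:
  "retract R (ideal_module R m) (direct_sum (ideal_module R I) (ideal_module R J))"
proof -
  interpret sw: split_local R m J I by (rule swap)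
  show ?thesis
  proof (rule retractI)
    show "(\<lambda>x. (pr R I J x, pr R J I x)) \<in>
        module_hom R (ideal_module R m) (direct_sum (ideal_module R I) (ideal_module R J))"
      by (rule module_homI) (auto simp: pr_decomp pr_add pr_smult sw.pr_add sw.pr_smult)
    show "(\<lambda>(a, b). a \<oplus> b) \<in>
        module_hom R (direct_sum (ideal_module R I) (ideal_module R J)) (ideal_module R m)"
      by (rule module_homI) (auto simp: I_m J_m r_distr I.Icarr J.Icarr a_ac)
  qed (auto simp: pr_decomp)
qed

lemma module_I: "module R (ideal_module R I)" and module_J: "module R (ideal_module R J)"
  by (rule module_ideal_module[OF I_ideal], rule module_ideal_module[OF J_ideal])

text \<open>The kernel of a minimal cover by \<open>R\<^sup>B\<close> of a module killed by \<open>J\<close> contains \<open>J R\<^sup>B\<close>.\<close>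

lemma retract_syz_annihilated:
  assumes Y: "module R Y" and c: "cover B p Y" and k: "k \<in> B"
    and ann: "\<And>r x. r \<in> J \<Longrightarrow> x \<in> carrier Y \<Longrightarrow> r \<odot>\<^bsub>Y\<^esub> x = \<zero>\<^bsub>Y\<^esub>"
  shows "retract R (direct_sum (part I (syz B p Y)) (ideal_module R J)) (syz B p Y)"
proof -
  interpret sw: split_local R m J I by (rule swap)
  interpret Y: module R Y by fact
  note p = coverD[OF c]
  have p0: "p v = \<zero>\<^bsub>Y\<^esub>" if "v \<in> carrier (free_module R B)" "\<And>i. v i \<in> J" for v
    using hom_annihilated[OF Y p(2) J_ideal ann that] .
  have ps: "p (single R k j) = \<zero>\<^bsub>Y\<^esub>" if "j \<in> J" for j
    using p0[OF single_closed[OF k J.Icarr[OF that]]] that by (simp add: single_apply)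
  \<comment> \<open>The kernel is its \<open>I\<close>-part plus \<open>J R\<^sup>B\<close>. Only
    the copy of \<open>J\<close> at the coordinate \<open>k\<close> is kept, so the retraction reads
    off all \<open>I\<close>-components and the single \<open>J\<close>-component at
    \<open>k\<close>.\<close>
  define i where "i = (\<lambda>(a, j) l. a l \<oplus> single R k j l)"
  define r where "r = (\<lambda>f. (\<lambda>l. pr R I J (f l), pr R J I (f k)))"
  show ?thesis
  proof (rule retractI)
    show "i \<in> module_hom R (direct_sum (part I (syz B p Y)) (ideal_module R J)) (syz B p Y)"
    proof (rule module_homI)
      fix x assume "x \<in> carrier (direct_sum (part I (syz B p Y)) (ideal_module R J))"
      then obtain a j where x: "x = (a, j)" "a \<in> carrier (free_module R B)" "p a = \<zero>\<^bsub>Y\<^esub>" "j \<in> J"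
        by auto
      thus "i x \<in> carrier (syz B p Y)"
        using hom_add[OF p(2), of a "single R k j"] k by (simp add: i_def ps J.Icarr)
    next
      fix x y assume "x \<in> carrier (direct_sum (part I (syz B p Y)) (ideal_module R J))"
        "y \<in> carrier (direct_sum (part I (syz B p Y)) (ideal_module R J))"
      thus "i (x \<oplus>\<^bsub>direct_sum (part I (syz B p Y)) (ideal_module R J)\<^esub> y) = i x \<oplus>\<^bsub>syz B p Y\<^esub> i y"
        by (auto simp: i_def single_apply a_ac I.Icarr J.Icarr)
    next
      fix s x assume "s \<in> carrier R" "x \<in> carrier (direct_sum (part I (syz B p Y)) (ideal_module R J))"
      thus "i (s \<odot>\<^bsub>direct_sum (part I (syz B p Y)) (ideal_module R J)\<^esub> x) = s \<odot>\<^bsub>syz B p Y\<^esub> i x"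
        by (auto simp: i_def single_apply r_distr I.Icarr J.Icarr)
    qed
    show "r \<in> module_hom R (syz B p Y) (direct_sum (part I (syz B p Y)) (ideal_module R J))"
    proof (rule module_homI)
      fix f assume f: "f \<in> carrier (syz B p Y)"
      hence fm: "\<And>l. f l \<in> m" and fF: "f \<in> carrier (free_module R B)" using p(4) by auto
      note c1 = pr_free_closed[OF fF fm] and c2 = sw.pr_free_closed[OF fF fm]
      \<comment> \<open>The vector of \<open>J\<close>-components lies in the kernel anyway, hence
        so does the vector of \<open>I\<close>-components.\<close>
      have "p (\<lambda>l. pr R I J (f l) \<oplus> pr R J I (f l)) = p (\<lambda>l. pr R I J (f l)) \<oplus>\<^bsub>Y\<^esub> p (\<lambda>l. pr R J I (f l))"
        using hom_add[OF p(2) c1 c2] by simp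
      hence "p (\<lambda>l. pr R I J (f l)) = \<zero>\<^bsub>Y\<^esub>"
        using f p0[OF c2] pr_decomp[OF fm] hom_closed[OF p(2) c1] by simp
      thus "r f \<in> carrier (direct_sum (part I (syz B p Y)) (ideal_module R J))"
        using c1 pr_decomp[OF fm] by (simp add: r_def)
    qed (auto simp: r_def pr_add pr_smult sw.pr_add sw.pr_smult p(4))
    fix x assume "x \<in> carrier (direct_sum (part I (syz B p Y)) (ideal_module R J))"
    then obtain a j where x: "x = (a, j)" "a \<in> carrier (free_module R B)" "\<And>l. a l \<in> I" "j \<in> J"
      by auto
    have "pr R I J (a l \<oplus> single R k j l) = a l" for l
      using x by (intro pr_eq) (auto simp: single_apply)
    moreover have "pr R J I (a k \<oplus> single R k j k) = j"
      using x sw.pr_eq[of j "a k"] a_comm[of j "a k"] by (simp add: single_apply I.Icarr J.Icarr)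
    ultimately show "r (i x) = x" by (simp add: x(1) i_def r_def)
  qed
qed

section \<open>Copies of \<open>I\<close>, \<open>J\<close> and \<open>m\<close> inside
  syzygies\<close>

lemma cover_nonempty:
  assumes "module R Y" "cover B p Y" "carrier Y \<noteq> {\<zero>\<^bsub>Y\<^esub>}"
  shows "B \<noteq> {}"
proof
  assume [simp]: "B = {}"
  have "carrier (free_module R B) = {\<lambda>i. \<zero>}" by (auto simp: mem_free_module)
  hence "carrier Y = {p (\<lambda>i. \<zero>)}" using coverD(3)[OF assms(2)] by simp
  thus False
    using hom_zero[OF module_free_module assms(1) coverD(2)[OF assms(2)]] assms(3) by simp
qed

lemma retract_J_syz:
  assumes "module R Y" "cover B p Y" "carrier Y \<noteq> {\<zero>\<^bsub>Y\<^esub>}"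
    and "\<And>r x. r \<in> J \<Longrightarrow> x \<in> carrier Y \<Longrightarrow> r \<odot>\<^bsub>Y\<^esub> x = \<zero>\<^bsub>Y\<^esub>"
  shows "retract R (ideal_module R J) (syz B p Y)"
proof -
  obtain k where "k \<in> B" using cover_nonempty[OF assms(1-3)] by blast
  from retract_trans[OF retract_direct_sum2[OF module_part[OF I_ideal assms(1) coverD(2)[OF assms(2)]] module_J]
      retract_syz_annihilated[OF assms(1,2) this assms(4)]] show ?thesis by simp
qed

text \<open>The mechanism behind every copy of \<open>m\<close> inside a single syzygy; it serves
  with \<open>Y\<close> the second, the third and the fourth syzygy. The modules \<open>A\<close>
  and \<open>C\<close> inherit covers from \<open>Y\<close>, being retracts of it.\<close>

lemma retract_m_syz:
  fixes B :: "'i set"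
  assumes Y: "module R Y" "cover B p Y"
    and A: "module R A" "carrier A \<noteq> {\<zero>\<^bsub>A\<^esub>}" "\<And>r x. r \<in> J \<Longrightarrow> x \<in> carrier A \<Longrightarrow> r \<odot>\<^bsub>A\<^esub> x = \<zero>\<^bsub>A\<^esub>"
    and C: "module R C" "carrier C \<noteq> {\<zero>\<^bsub>C\<^esub>}" "\<And>r x. r \<in> I \<Longrightarrow> x \<in> carrier C \<Longrightarrow> r \<odot>\<^bsub>C\<^esub> x = \<zero>\<^bsub>C\<^esub>"
    and ret: "retract R (direct_sum A C) Y"
  shows "retract R (ideal_module R m) (syz B p Y)"
proof -
  interpret sw: split_local R m J I by (rule swap)
  obtain B1 p1 where c1: "cover (B1 :: 'i set) p1 A"
    using cover_exists_retract[OF Y(1) A(1) Y(2) retract_trans[OF retract_direct_sum1[OF A(1) C(1)] ret]] .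
  obtain B2 p2 where c2: "cover (B2 :: 'i set) p2 C"
    using cover_exists_retract[OF Y(1) C(1) Y(2) retract_trans[OF retract_direct_sum2[OF A(1) C(1)] ret]] .
  have "retract R (direct_sum (ideal_module R J) (ideal_module R I)) (direct_sum (syz B1 p1 A) (syz B2 p2 C))"
    using retract_direct_sum[OF retract_J_syz[OF A(1) c1 A(2,3)] sw.retract_J_syz[OF C(1) c2 C(2,3)]] .
  from retract_trans[OF sw.retract_m_direct_sum
      retract_trans[OF this syz_retract_sum[OF Y(1) A(1) C(1) Y(2) c1 c2 ret]]]
  show ?thesis .
qed

text \<open>If \<open>R\<^sup>C \<rightarrow> J\<close> is a minimal cover with kernel \<open>I R\<^sup>C\<close>, then the relation between
  the generators \<open>y\<^sub>k, y\<^sub>l\<close> given by \<open>y\<^sub>l y\<^sub>k = y\<^sub>k y\<^sub>l\<close> has coordinates in \<open>J\<close>, so that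
  there is only one generator.\<close>

lemma principal_if_free:
  assumes c: "cover C q (ideal_module R J)"
    and triv: "carrier (part J (syz C q (ideal_module R J))) = {\<lambda>i. \<zero>}"
  obtains y where "y \<in> J" "\<And>x. x \<in> J \<Longrightarrow> \<exists>r\<in>carrier R. x = r \<otimes> y"
    "\<And>a. a \<in> carrier R \<Longrightarrow> a \<otimes> y = \<zero> \<Longrightarrow> a \<in> I"
proof -
  note q = coverD[OF c]
  have triv': "v i = \<zero>" if "v \<in> carrier (free_module R C)" "q v = \<zero>" "\<And>i. v i \<in> J" for v i
  proof -
    have "v \<in> carrier (part J (syz C q (ideal_module R J)))" using that by simp
    thus ?thesis unfolding triv by simp
  qed
  obtain k where k: "k \<in> C" using cover_nonempty[OF module_J c] J_nz by auto
  have qs: "q (single R i r) = r \<otimes> q (single R i \<one>)" "q (single R i r) \<in> J"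
    if "i \<in> C" "r \<in> carrier R" for i r
    using hom_smult[OF q(2), of r "single R i \<one>"] hom_closed[OF q(2), of "single R i r"] that
    by (simp_all add: smult_single)
  define y where "y = q (single R k \<one>)"
  have y: "y \<in> J" using qs(2)[OF k] by (simp add: y_def)
  have y_nz: "y \<noteq> \<zero>"
    using q(4)[of "single R k \<one>" k] k one_notin_m by (auto simp: y_def single_apply)
  have only: "l = k" if l: "l \<in> C" for l
  proof (rule ccontr)
    assume "l \<noteq> k"
    define z where "z = q (single R l \<one>)"
    have z: "z \<in> J" using qs(2)[OF l] by (simp add: z_def)
    have mem: "single R l y \<in> carrier (free_module R C)" "single R k z \<in> carrier (free_module R C)"
      using k l y z by auto
    have "q (\<lambda>i. single R l y i \<ominus> single R k z i) = y \<otimes> z \<oplus> \<ominus> (z \<otimes> y)"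
      using hom_free_diff[OF module_J q(2) mem] qs(1)[OF l, of y] qs(1)[OF k, of z] y z
        module.smult_l_minus[OF module_J, of \<one> "z \<otimes> y"]
      by (simp add: y_def[symmetric] z_def[symmetric] a_minus_def[of "ideal_module R J"] J.Icarr l_minus J.I_l_closed)
    also have "\<dots> = \<zero>" using y z by (simp add: m_comm J.Icarr r_neg)
    finally have q0: "q (\<lambda>i. single R l y i \<ominus> single R k z i) = \<zero>" .
    have inJ: "single R l y i \<ominus> single R k z i \<in> J" for i
      using y z by (simp add: single_apply a_minus_def)
    have "single R l y l \<ominus> single R k z l = \<zero>"
      using triv'[OF free_module_minus_closed[OF mem] q0 inJ] .
    thus False using \<open>l \<noteq> k\<close> y y_nz by (simp add: single_apply a_minus_def J.Icarr)
  qed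
  show thesis
  proof (rule that[OF y])
    fix x assume "x \<in> J"
    hence "x \<in> q ` carrier (free_module R C)" using q(3) by simp
    then obtain v where v: "v \<in> carrier (free_module R C)" "x = q v" by blast
    have "v = single R k (v k)"
      using v(1) only by (auto simp: single_apply fun_eq_iff mem_free_module)
    hence "x = v k \<otimes> y" using qs(1)[OF k, of "v k"] v by (simp add: y_def)
    thus "\<exists>r\<in>carrier R. x = r \<otimes> y" using v by blast
  next
    fix a assume a: "a \<in> carrier R" "a \<otimes> y = \<zero>"
    \<comment> \<open>Minimality puts \<open>a\<close> into \<open>m\<close>. Its
      \<open>I\<close>-component kills \<open>y\<close> because \<open>I J = 0\<close>, so its
      \<open>J\<close>-component gives a relation with coordinates in \<open>J\<close>, which is
      zero by \<open>triv\<close>.\<close>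
    have "single R k a k \<in> m"
      by (rule q(4)) (use a k qs(1)[OF k a(1)] in \<open>auto simp: y_def\<close>)
    hence "a \<in> m" by (simp add: single_apply)
    then obtain i j where ij: "i \<in> I" "j \<in> J" "a = i \<oplus> j" using mem_m by blast
    have "j \<otimes> y = \<zero>"
      using a(2) ij y I_J_zero[of i y] by (simp add: l_distr I.Icarr J.Icarr)
    hence "q (single R k j) = \<zero>" using qs(1)[OF k, of j] ij by (simp add: y_def J.Icarr)
    moreover have "single R k j i \<in> J" for i using ij by (simp add: single_apply)
    ultimately have "single R k j k = \<zero>"
      using triv'[OF single_closed[OF k J.Icarr[OF ij(2)]]] by blast
    thus "a \<in> I" using ij by (simp add: single_apply I.Icarr)
  qed
qed

lemma part_I_annihilated:
  "r \<in> J \<Longrightarrow> x \<in> carrier (part I (syz B p Y)) \<Longrightarrow> r \<odot>\<^bsub>part I (syz B p Y)\<^esub> x = \<zero>\<^bsub>part I (syz B p Y)\<^esub>"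
  by (simp add: J_I_zero)

text \<open>With \<open>Y\<close> in the role of the second syzygy, the iterated kernels are the
  third, fourth and fifth; the first two cases are named after the one that contains
  \<open>m\<close>. In the last case \<open>y\<close> has annihilator \<open>I\<close>, so
  \<open>J\<close> is isomorphic to \<open>R/I\<close>; a copy of \<open>J\<close> is found in the
  third syzygy and one of \<open>I\<close> in the fourth, which puts \<open>m\<close> into their
  sum.\<close>

lemma annihilated_cases:
  fixes B1 :: "'i set"
  assumes Y: "module R Y" "cover B p Y" "carrier Y \<noteq> {\<zero>\<^bsub>Y\<^esub>}"
    and ann: "\<And>r x. r \<in> J \<Longrightarrow> x \<in> carrier Y \<Longrightarrow> r \<odot>\<^bsub>Y\<^esub> x = \<zero>\<^bsub>Y\<^esub>"
    and c1: "cover B1 p1 (syz B p Y)" and c2: "cover B2 p2 (syz B1 p1 (syz B p Y))"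
  obtains (fourth) "retract R (ideal_module R m) (syz B1 p1 (syz B p Y))"
  | (fifth) "carrier (part I (syz B p Y)) = {\<lambda>i. \<zero>}"
      "retract R (ideal_module R m) (syz B2 p2 (syz B1 p1 (syz B p Y)))"
  | (dvr) y where "carrier (part I (syz B p Y)) = {\<lambda>i. \<zero>}"
      "retract R (ideal_module R m) (direct_sum (syz B p Y) (syz B1 p1 (syz B p Y)))"
      "y \<in> J" "\<And>x. x \<in> J \<Longrightarrow> \<exists>r\<in>carrier R. x = r \<otimes> y"
      "\<And>a. a \<in> carrier R \<Longrightarrow> a \<otimes> y = \<zero> \<Longrightarrow> a \<in> I"
proof -
  interpret sw: split_local R m J I by (rule swap)
  let ?Y1 = "syz B p Y" and ?Y2 = "syz B1 p1 (syz B p Y)"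
  have Y1: "module R ?Y1" using module_syz[OF Y(1,2)] .
  have Y2: "module R ?Y2" using module_syz[OF Y1 c1] .
  have A: "module R (part I ?Y1)" using module_part[OF I_ideal Y(1) coverD(2)[OF Y(2)]] .
  obtain k where k: "k \<in> B" using cover_nonempty[OF Y] by blast
  note ret = retract_syz_annihilated[OF Y(1,2) k ann]
  have annJ: "r \<odot>\<^bsub>ideal_module R J\<^esub> x = \<zero>\<^bsub>ideal_module R J\<^esub>" if "r \<in> I" "x \<in> carrier (ideal_module R J)" for r x
    using that by (simp add: I_J_zero)
  have annI: "r \<odot>\<^bsub>ideal_module R I\<^esub> x = \<zero>\<^bsub>ideal_module R I\<^esub>" if "r \<in> J" "x \<in> carrier (ideal_module R I)" for r x
    using that by (simp add: J_I_zero)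
  show thesis
  proof (cases "carrier (part I ?Y1) = {\<zero>\<^bsub>part I ?Y1\<^esub>}")
    case False
    have "retract R (ideal_module R m) ?Y2"
      by (rule retract_m_syz[OF Y1 c1 A False part_I_annihilated module_J _ annJ ret])
        (use J_nz in auto)
    thus thesis by (rule fourth)
  next
    case True
    hence A0: "carrier (part I ?Y1) = {\<lambda>i. \<zero>}" by simp
    have J1: "retract R (ideal_module R J) ?Y1"
      using retract_J_syz[OF Y ann] .
    obtain C q where q: "cover (C :: 'i set) q (ideal_module R J)"
      using cover_exists_retract[OF Y1 module_J c1 J1] .
    let ?K = "syz C q (ideal_module R J)"
    have K: "module R ?K" using module_syz[OF module_J q] .
    have T: "module R (part J ?K)" using module_part[OF J_ideal module_J coverD(2)[OF q]] .
    \<comment> \<open>\<open>J\<close> is a retract of the third syzygy, so its syzygy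
      \<open>?K\<close> is a retract of the fourth, and summands of \<open>?K\<close> may be used
      there.\<close>
    have KY2: "retract R ?K ?Y2" using syz_retract[OF Y1 module_J c1 q J1] .
    obtain l where l: "l \<in> C" using cover_nonempty[OF module_J q] J_nz by auto
    have T2: "retract R (direct_sum (part J ?K) (ideal_module R I)) ?Y2"
      using retract_trans[OF sw.retract_syz_annihilated[OF module_J q l annJ] KY2] .
    show thesis
    proof (cases "carrier (part J ?K) = {\<zero>\<^bsub>part J ?K\<^esub>}")
      case False
      \<comment> \<open>The roles of the ideals are exchanged here: the \<open>J\<close>-part of
        \<open>?K\<close> is killed by \<open>I\<close>, and the summand \<open>I\<close> is killed
        by \<open>J\<close>.\<close>
      have "retract R (ideal_module R m) (syz B2 p2 ?Y2)"
        by (rule sw.retract_m_syz[OF Y2 c2 T False sw.part_I_annihilated module_I _ annI T2])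
          (use I_nz in auto)
      with A0 show thesis by (rule fifth)
    next
      case True
      hence "carrier (part J ?K) = {\<lambda>i. \<zero>}" by simp
      then obtain y where y: "y \<in> J"
        "\<And>x. x \<in> J \<Longrightarrow> \<exists>r\<in>carrier R. x = r \<otimes> y"
        "\<And>a. a \<in> carrier R \<Longrightarrow> a \<otimes> y = \<zero> \<Longrightarrow> a \<in> I"
        using principal_if_free[OF q] by metis
      have I2: "retract R (ideal_module R I) ?Y2"
        using retract_trans[OF retract_direct_sum2[OF T module_I] T2] .
      have "retract R (ideal_module R m) (direct_sum ?Y1 ?Y2)"
        using retract_trans[OF sw.retract_m_direct_sum retract_direct_sum[OF J1 I2]] .
      from dvr[OF A0 this y] show thesis .
    qed
  qed
qed

text \<open>If \<open>a + b\<close> is in the kernel, with \<open>a\<close> over \<open>I\<close>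
  and \<open>b\<close> over \<open>J\<close>, then \<open>h a\<close> and \<open>h b\<close> have
  coordinates in \<open>I\<close> and in \<open>J\<close> and add up to zero. As the target is free
  and \<open>I \<inter> J = 0\<close>, both vanish.\<close>

lemma retract_parts:
  assumes h: "h \<in> module_hom R (free_module R B) (free_module R C)"
    and hm: "\<And>v i. v \<in> carrier (free_module R B) \<Longrightarrow> h v = (\<lambda>i. \<zero>) \<Longrightarrow> v i \<in> m"
  defines "K \<equiv> ker_module (free_module R B) (free_module R C) h"
  shows "retract R (direct_sum (part I K) (part J K)) K"
    and "v \<in> carrier K \<Longrightarrow> (\<lambda>i. pr R I J (v i)) \<in> carrier (part I K)"
proof -
  interpret sw: split_local R m J I by (rule swap)
  interpret C: module R "free_module R C" by (rule module_free_module)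
  have pr: "(\<lambda>i. pr R I J (v i)) \<in> carrier (part I K) \<and> (\<lambda>i. pr R J I (v i)) \<in> carrier (part J K)"
    if v: "v \<in> carrier K" for v
  proof -
    have vF: "v \<in> carrier (free_module R B)" and vm: "\<And>i. v i \<in> m" and hv: "h v = (\<lambda>i. \<zero>)"
      using v hm by (auto simp: K_def)
    let ?a = "\<lambda>i. pr R I J (v i)" and ?b = "\<lambda>i. pr R J I (v i)"
    note c1 = pr_free_closed[OF vF vm] and c2 = sw.pr_free_closed[OF vF vm]
    have "h (\<lambda>l. ?a l \<oplus> ?b l) = (\<lambda>i. h ?a i \<oplus> h ?b i)"
      using hom_add[OF h c1 c2] by simp
    hence sum: "h ?a i \<oplus> h ?b i = \<zero>" for i
      using pr_decomp(3)[OF vm] hv by (simp add: fun_eq_iff)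
    have hI: "h ?a i \<in> I" and hJ: "h ?b i \<in> J" for i
      using ideal_hom_coord[OF I_ideal h c1] ideal_hom_coord[OF J_ideal h c2] pr_decomp[OF vm] by auto
    have a0: "h ?a i = \<zero>" for i
    proof -
      have "h ?a i \<oplus> h ?b i = \<zero> \<oplus> \<zero>" using sum[of i] by simp
      from pr_unique[OF hI hJ I.zero_closed J.zero_closed this] show ?thesis .
    qed
    moreover have "h ?b i = \<zero>" for i
      using a0[of i] sum[of i] hJ[of i] by (simp add: J.Icarr)
    ultimately show ?thesis
      using c1 c2 pr_decomp[OF vm] by (auto simp: K_def)
  qed
  show "v \<in> carrier K \<Longrightarrow> (\<lambda>i. pr R I J (v i)) \<in> carrier (part I K)" using pr by blast
  have m: "v i \<in> m" if "v \<in> carrier K" for v i using that hm by (auto simp: K_def)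
  have KM: "module R K" unfolding K_def by (rule module_ker_module[OF module_free_module module_free_module h])
  interpret K: module R K by (rule KM)
  have Ksimps: "x \<oplus>\<^bsub>K\<^esub> y = (\<lambda>i. x i \<oplus> y i)" "r \<odot>\<^bsub>K\<^esub> x = (\<lambda>i. r \<otimes> x i)" for x y r
    by (simp_all add: K_def)
  have Kc: "v i \<in> carrier R" if "v \<in> carrier K" for v i using that by (auto simp: K_def)
  show "retract R (direct_sum (part I K) (part J K)) K"
  proof (rule retractI)
    show "(\<lambda>(a, b). a \<oplus>\<^bsub>K\<^esub> b) \<in> module_hom R (direct_sum (part I K) (part J K)) K"
      by (rule module_homI) (auto simp: K.M.a_ac K.smult_r_distr)
    show "(\<lambda>v. (\<lambda>i. pr R I J (v i), \<lambda>i. pr R J I (v i))) \<in> module_hom R K (direct_sum (part I K) (part J K))"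
    proof (rule module_homI)
      show "\<And>x. x \<in> carrier K \<Longrightarrow> (\<lambda>i. pr R I J (x i), \<lambda>i. pr R J I (x i)) \<in> carrier (direct_sum (part I K) (part J K))"
        unfolding direct_sum_simps using pr by blast
    qed (auto simp: Ksimps pr_add pr_smult sw.pr_add sw.pr_smult m)
    fix x assume "x \<in> carrier (direct_sum (part I K) (part J K))"
    then obtain a b where x: "x = (a, b)" "a \<in> carrier K" "b \<in> carrier K" "\<And>i. a i \<in> I" "\<And>i. b i \<in> J"
      by auto
    have "pr R J I (a i \<oplus> b i) = b i" for i
      using sw.pr_eq[of "b i" "a i"] x a_comm[of "a i" "b i"] by (simp add: Kc)
    thus "(\<lambda>v. (\<lambda>i. pr R I J (v i), \<lambda>i. pr R J I (v i))) ((\<lambda>(a, b). a \<oplus>\<^bsub>K\<^esub> b) x) = x"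
      using x by (simp add: Ksimps pr_eq)
  qed
qed

end

subsection \<open>Quotient rings\<close>

context cring
begin

lemma
  assumes K: "ideal K R"
  shows mem_quot: "c \<in> carrier (R Quot K) \<longleftrightarrow> (\<exists>a\<in>carrier R. c = K +> a)"
    and quot_zero: "\<zero>\<^bsub>R Quot K\<^esub> = K"
    and quot_one: "\<one>\<^bsub>R Quot K\<^esub> = K +> \<one>"
    and coset_closed: "a \<in> carrier R \<Longrightarrow> K +> a \<in> carrier (R Quot K)"
    and coset_mult: "a \<in> carrier R \<Longrightarrow> b \<in> carrier R \<Longrightarrow> (K +> a) \<otimes>\<^bsub>R Quot K\<^esub> (K +> b) = K +> (a \<otimes> b)"
    and coset_add: "a \<in> carrier R \<Longrightarrow> b \<in> carrier R \<Longrightarrow> (K +> a) \<oplus>\<^bsub>R Quot K\<^esub> (K +> b) = K +> (a \<oplus> b)"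
    and coset_eq_iff: "a \<in> carrier R \<Longrightarrow> b \<in> carrier R \<Longrightarrow> K +> a = K +> b \<longleftrightarrow> a \<ominus> b \<in> K"
    and coset_eq_zero_iff: "a \<in> carrier R \<Longrightarrow> K +> a = K \<longleftrightarrow> a \<in> K"
proof -
  interpret K: ideal K R by fact
  show "c \<in> carrier (R Quot K) \<longleftrightarrow> (\<exists>a\<in>carrier R. c = K +> a)"
    by (auto simp: FactRing_def A_RCOSETS_def')
  show "\<zero>\<^bsub>R Quot K\<^esub> = K" "\<one>\<^bsub>R Quot K\<^esub> = K +> \<one>" by (simp_all add: FactRing_def)
  show "a \<in> carrier R \<Longrightarrow> K +> a \<in> carrier (R Quot K)"
    using ring_hom_closed[OF K.rcos_ring_hom] by simp
  show "a \<in> carrier R \<Longrightarrow> b \<in> carrier R \<Longrightarrow> (K +> a) \<otimes>\<^bsub>R Quot K\<^esub> (K +> b) = K +> (a \<otimes> b)"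
    using ring_hom_mult[OF K.rcos_ring_hom] by simp
  show "a \<in> carrier R \<Longrightarrow> b \<in> carrier R \<Longrightarrow> (K +> a) \<oplus>\<^bsub>R Quot K\<^esub> (K +> b) = K +> (a \<oplus> b)"
    using ring_hom_add[OF K.rcos_ring_hom] by simp
  show *: "K +> a = K +> b \<longleftrightarrow> a \<ominus> b \<in> K" if "a \<in> carrier R" "b \<in> carrier R" for a b
    using quotient_eq_iff_same_a_r_cos[OF K that] by simp
  show "a \<in> carrier R \<Longrightarrow> K +> a = K \<longleftrightarrow> a \<in> K"
    using *[of a \<zero>] by (simp add: a_minus_def K.a_subset)
qed

lemma coset_rep:
  assumes K: "ideal K R" and c: "c \<in> carrier (R Quot K)"
  shows "(SOME r. r \<in> c) \<in> carrier R" "K +> (SOME r. r \<in> c) = c"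
proof -
  interpret K: ideal K R by fact
  obtain a where a: "a \<in> carrier R" "c = K +> a" using c mem_quot[OF K] by blast
  have "a \<in> c" using K.a_rcos_self a by simp
  hence r: "(SOME r. r \<in> c) \<in> K +> a" using a someI by metis
  show "(SOME r. r \<in> c) \<in> carrier R"
    using r a_r_coset_subset_G[OF K.a_subset a(1)] by blast
  show "K +> (SOME r. r \<in> c) = c"
    using K.a_repr_independence'[OF r a(1)] a(2) by simp
qed

end

text \<open>The maximum condition: in a noetherian ring the union of a non-empty chain of ideals
  belongs to the chain, which supplies the upper bounds for Zorn's lemma.\<close>

lemma (in noetherian_ring) maximal_ideal_exists:
  assumes "S \<noteq> {}" "\<And>K. K \<in> S \<Longrightarrow> ideal K R"
  shows "\<exists>M\<in>S. \<forall>Z\<in>S. M \<subseteq> Z \<longrightarrow> Z = M"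
proof (rule subset_Zorn_nonempty[OF assms(1)])
  fix C assume C: "C \<noteq> {}" "subset.chain S C"
  hence sub: "C \<subseteq> S" by (simp add: subset_chain_def)
  moreover have "S \<subseteq> {I. ideal I R}" using assms(2) by blast
  ultimately have "subset.chain {I. ideal I R} C"
    using C(2) by (simp add: subset_chain_def)
  from ideal_chain_is_trivial[OF C(1) this] show "\<Union>C \<in> S" using sub by blast
qed

text \<open>A non-unit \<open>x\<close> generates a proper ideal. An ideal maximal among the proper
  ideals containing \<open>x\<close> is a maximal ideal, hence equal to \<open>m\<close>, so
  \<open>x\<close> is in \<open>m\<close>.\<close>

lemma (in noetherian_local_ring) local_ring: "local_ring R m"
proof (intro local_ring.intro local_ring_axioms.intro is_cring)
  interpret m: maximalideal m R by (rule maximal)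
  show "ideal m R" ..
  show "\<one> \<notin> m" using m.I_notcarr m.one_imp_carrier by auto
  fix x assume x: "x \<in> carrier R" "x \<notin> m"
  show "x \<in> Units R"
  proof (rule ccontr)
    assume nu: "x \<notin> Units R"
    let ?S = "{K. ideal K R \<and> K \<noteq> carrier R \<and> x \<in> K}"
    have "\<one> \<notin> PIdl x"
    proof
      assume "\<one> \<in> PIdl x"
      then obtain y where "y \<in> carrier R" "\<one> = y \<otimes> x" by (auto simp: cgenideal_def)
      thus False using nu x(1) m_comm[of x y] by (auto simp: Units_def)
    qed
    hence "PIdl x \<in> ?S"
      using cgenideal_ideal[OF x(1)] cgenideal_self[OF x(1)] by auto
    hence "?S \<noteq> {}" by blast
    then obtain N where N: "N \<in> ?S" "\<And>Z. Z \<in> ?S \<Longrightarrow> N \<subseteq> Z \<Longrightarrow> Z = N"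
      using maximal_ideal_exists[of ?S] by blast
    have "maximalideal N R"
      using N by (intro maximalidealI) auto
    thus False using unique_maximal N(1) x(2) by blast
  qed
qed

text \<open>A coset outside the image of \<open>m\<close> is represented by a unit, so every proper
  ideal of \<open>R/K\<close> lies in that image. The equivalence settles both the uniqueness in
  \<open>discrete_valuation_ring\<close> and the description inside \<open>depth\<close>.\<close>

lemma (in local_ring) quot_maximalideal:
  assumes K: "ideal K R" and "K \<subseteq> m"
  shows "maximalideal N (R Quot K) \<longleftrightarrow> N = (+>) K ` m"
proof -
  interpret K: ideal K R by fact
  let ?Q = "R Quot K" and ?n = "(+>) K ` m"
  interpret Q: cring ?Q by (rule K.quotient_is_cring[OF is_cring])
  have n: "ideal ?n ?Q" by (rule ring_ideal_imp_quot_ideal[OF K m_ideal])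
  have "\<one>\<^bsub>?Q\<^esub> \<notin> ?n"
  proof
    assume "\<one>\<^bsub>?Q\<^esub> \<in> ?n"
    then obtain a where a: "a \<in> m" "K +> \<one> = K +> a" by (auto simp: quot_one[OF K])
    hence "\<one> \<ominus> a \<in> m" using coset_eq_iff[OF K, of \<one> a] assms(2) m.Icarr by auto
    hence "(\<one> \<ominus> a) \<oplus> a \<in> m" using a by simp
    thus False using one_notin_m a m.Icarr[of a] by (simp add: a_minus_def a_assoc l_neg)
  qed
  hence neq: "?n \<noteq> carrier ?Q" using Q.one_closed by metis
  have sub: "N \<subseteq> ?n" if N: "ideal N ?Q" "N \<noteq> carrier ?Q" for N
  proof
    interpret N: ideal N ?Q by fact
    fix c assume c: "c \<in> N"
    then obtain a where a: "a \<in> carrier R" "c = K +> a" using mem_quot[OF K] N.Icarr by blast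
    show "c \<in> ?n"
    proof (rule ccontr)
      assume "c \<notin> ?n"
      hence "a \<in> Units R" using a Units_if_notin_m by blast
      hence "(K +> inv a) \<otimes>\<^bsub>?Q\<^esub> c = \<one>\<^bsub>?Q\<^esub>"
        using a by (simp add: coset_mult[OF K] quot_one[OF K])
      moreover have "(K +> inv a) \<otimes>\<^bsub>?Q\<^esub> c \<in> N"
        using c \<open>a \<in> Units R\<close> by (intro N.I_l_closed coset_closed[OF K]) auto
      ultimately show False using N.one_imp_carrier N(2) by simp
    qed
  qed
  show ?thesis
  proof
    assume "N = ?n"
    moreover have "Z = ?n \<or> Z = carrier ?Q" if "ideal Z ?Q" "?n \<subseteq> Z" for Z
      using sub[OF that(1)] that(2) by blast
    ultimately show "maximalideal N ?Q" using n neq by (intro maximalidealI) auto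
  next
    assume "maximalideal N ?Q"
    then interpret N: maximalideal N ?Q .
    have "N \<subseteq> ?n" using sub[OF N.is_ideal] N.I_notcarr by blast
    moreover have "?n \<subseteq> carrier ?Q" using additive_subgroup.a_subset[OF ideal.axioms(1)[OF n]] .
    ultimately show "N = ?n" using N.I_maximal[OF n] neq by blast
  qed
qed

text \<open>Modulo \<open>I\<close> the maximal ideal becomes \<open>J\<close>, generated by the
  non-zero-divisor \<open>y\<close>. Hence every non-zero class is a unit times a power of
  \<open>y\<close>, so \<open>R/I\<close> is a domain and each non-zero ideal is generated by a
  power of \<open>y\<close>.\<close>

lemma (in split_local) discrete_valuation_ring_quot:
  assumes noeth: "noetherian_ring R"
    and y: "y \<in> J" and gen: "\<And>x. x \<in> J \<Longrightarrow> \<exists>r\<in>carrier R. x = r \<otimes> y"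
    and reg: "\<And>a. a \<in> carrier R \<Longrightarrow> a \<otimes> y = \<zero> \<Longrightarrow> a \<in> I"
  shows "discrete_valuation_ring (R Quot I)"
proof -
  interpret N: noetherian_ring R by fact
  let ?Q = "R Quot I"
  interpret Q: cring ?Q by (rule I.quotient_is_cring[OF is_cring])
  have yc: "y \<in> carrier R" using y by (rule J.Icarr)
  have I_ne: "\<one> \<notin> I" using one_notin_m I_m by blast
  have diff_I: "a \<in> I \<longleftrightarrow> b \<in> I" if "a \<ominus> b \<in> I" "a \<in> carrier R" "b \<in> carrier R" for a b
    using coset_eq_iff[OF I_ideal that(2,3)] coset_eq_zero_iff[OF I_ideal] that by metis
  \<comment> \<open>The product \<open>a y\<close> lies in \<open>I\<close> and in \<open>J\<close>,
    so it is zero.\<close>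
  have reg': "a \<in> I" if "a \<in> carrier R" "a \<otimes> y \<in> I" for a
    using that reg[of a] J.I_l_closed[OF y, of a] I_Int_J by blast
  have reg_pow: "a \<in> carrier R \<Longrightarrow> a \<otimes> y [^] (n::nat) \<in> I \<Longrightarrow> a \<in> I" for a n
  proof (induction n)
    case (Suc n)
    have "(a \<otimes> y [^] n) \<otimes> y \<in> I" using Suc.prems yc by (simp add: m_assoc)
    from reg'[OF m_closed[OF Suc.prems(1) nat_pow_closed[OF yc]] this]
    show ?case by (rule Suc.IH[OF Suc.prems(1)])
  qed simp
  define good where "good x \<longleftrightarrow> (\<exists>u\<in>Units R. \<exists>n::nat. x \<ominus> u \<otimes> y [^] n \<in> I)" for x
  have good: "good x" if "x \<in> carrier R" "x \<notin> I" for x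
  proof (rule ccontr)
    assume "\<not> good x"
    \<comment> \<open>Among the counterexamples take \<open>z\<close> with \<open>I + (z)\<close>
      maximal. Being a non-unit, \<open>z\<close> is congruent to some \<open>r y\<close> modulo
      \<open>I\<close>, and \<open>r\<close> is again a counterexample, with \<open>I + (z)\<close>
      inside \<open>I + (r)\<close>. Equality gives \<open>r = a + s z\<close> with \<open>a\<close>
      in \<open>I\<close>, so \<open>r (1 - s y)\<close> is in \<open>I\<close>; the second factor
      is a unit, and \<open>r\<close> would be in \<open>I\<close>.\<close>
    let ?E = "\<lambda>x. I <+>\<^bsub>R\<^esub> PIdl x"
    let ?S = "?E ` {x \<in> carrier R. x \<notin> I \<and> \<not> good x}"
    have idl: "ideal (?E x) R" if "x \<in> carrier R" for x
      by (rule add_ideals[OF I_ideal cgenideal_ideal[OF that]])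
    have memE: "w \<in> ?E x \<longleftrightarrow> (\<exists>a\<in>I. \<exists>s\<in>carrier R. w = a \<oplus> s \<otimes> x)" for w x
      unfolding set_add_def' cgenideal_def by blast
    have "?S \<noteq> {}" using that \<open>\<not> good x\<close> by blast
    moreover have "\<And>K. K \<in> ?S \<Longrightarrow> ideal K R" using idl by blast
    ultimately have "\<exists>M\<in>?S. \<forall>Z\<in>?S. M \<subseteq> Z \<longrightarrow> Z = M"
      by (rule N.maximal_ideal_exists)
    then obtain M where M: "M \<in> ?S" "\<forall>Z\<in>?S. M \<subseteq> Z \<longrightarrow> Z = M"
      by (elim bexE)
    obtain z where z: "z \<in> carrier R" "z \<notin> I" "\<not> good z" "M = ?E z"
      using M(1) by (elim imageE CollectE conjE) (rule that)
    have z_max: "?E w = ?E z" if "w \<in> carrier R" "w \<notin> I" "\<not> good w" "?E z \<subseteq> ?E w" for w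
    proof -
      have "?E w \<in> ?S" using that(1-3) by (intro imageI) simp
      from bspec[OF M(2) this] that(4) z(4) show ?thesis by simp
    qed
    have "z \<notin> Units R"
    proof
      assume "z \<in> Units R"
      moreover have "z \<ominus> z \<otimes> y [^] (0::nat) \<in> I" using z(1) by (simp add: a_minus_def r_neg)
      ultimately show False using z(3) unfolding good_def by blast
    qed
    hence "z \<in> m" using Units_if_notin_m z(1) by blast
    then obtain i j where ij: "i \<in> I" "j \<in> J" "z = i \<oplus> j" using mem_m by blast
    then obtain r where r: "r \<in> carrier R" "j = r \<otimes> y" using gen by blast
    have c: "i \<in> carrier R" "j \<in> carrier R" using ij I.Icarr J.Icarr by blast+
    have "r \<notin> I" using z(2) ij r yc I.I_r_closed[of r y] by auto
    have "\<not> good r"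
    proof
      assume "good r"
      then obtain u n where u: "u \<in> Units R" "r \<ominus> u \<otimes> y [^] (n::nat) \<in> I" by (auto simp: good_def)
      have "z \<ominus> u \<otimes> y [^] Suc n = i \<oplus> (r \<ominus> u \<otimes> y [^] n) \<otimes> y"
        using ij r u(1) yc c Units_closed[OF u(1)]
        by (simp add: a_minus_def l_distr l_minus m_assoc a_assoc)
      also have "\<dots> \<in> I" using u(2) ij yc by (simp add: I.I_r_closed)
      finally show False using z(3) u(1) good_def by blast
    qed
    have "?E z \<subseteq> ?E r"
    proof
      fix w assume "w \<in> ?E z"
      then obtain a s where w: "a \<in> I" "s \<in> carrier R" "w = a \<oplus> s \<otimes> z"
        unfolding memE by (elim bexE)
      have "w = (a \<oplus> s \<otimes> i) \<oplus> (s \<otimes> y) \<otimes> r"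
        using w ij r yc c I.Icarr[OF w(1)] m_comm[of r y] by (simp add: r_distr m_assoc a_assoc)
      moreover have "a \<oplus> s \<otimes> i \<in> I" using w ij by (simp add: I.I_l_closed)
      moreover have "s \<otimes> y \<in> carrier R" using w yc by simp
      ultimately show "w \<in> ?E r" unfolding memE by (intro bexI)
    qed
    from z_max[OF r(1) \<open>r \<notin> I\<close> \<open>\<not> good r\<close> this] have "?E r = ?E z" .
    moreover have "r \<in> ?E r"
    proof -
      have "r = \<zero> \<oplus> \<one> \<otimes> r" using r(1) by simp
      hence "\<exists>s\<in>carrier R. r = \<zero> \<oplus> s \<otimes> r" using one_closed by (rule bexI)
      hence "\<exists>a\<in>I. \<exists>s\<in>carrier R. r = a \<oplus> s \<otimes> r" using I.zero_closed by (rule bexI)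
      thus ?thesis unfolding memE .
    qed
    ultimately have "r \<in> ?E z" by simp
    then obtain a s where as: "a \<in> I" "s \<in> carrier R" "r = a \<oplus> s \<otimes> z"
      unfolding memE by (elim bexE)
    have ac: "a \<in> carrier R" using as I.Icarr by blast
    have "\<one> \<ominus> s \<otimes> y \<notin> m"
    proof
      assume "\<one> \<ominus> s \<otimes> y \<in> m"
      hence "(\<one> \<ominus> s \<otimes> y) \<oplus> s \<otimes> y \<in> m" using J_m[OF y] as m.I_l_closed by simp
      thus False using one_notin_m as yc by (simp add: a_minus_def a_assoc l_neg)
    qed
    hence u: "\<one> \<ominus> s \<otimes> y \<in> Units R" using Units_if_notin_m as yc by simp
    have "r \<otimes> (\<one> \<ominus> s \<otimes> y) = r \<ominus> s \<otimes> j"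
      using r as(2) yc by (simp add: a_minus_def r_distr r_minus m_lcomm)
    also have "\<dots> = (a \<oplus> (s \<otimes> i \<oplus> s \<otimes> j)) \<ominus> s \<otimes> j"
      using as(3) ij(3) as(2) c by (simp add: r_distr)
    also have "\<dots> = a \<oplus> s \<otimes> i"
      using ac as(2) c by (simp add: a_minus_def a_assoc r_neg)
    also have "\<dots> \<in> I" using as ij by (simp add: I.I_l_closed)
    finally have "r \<otimes> (\<one> \<ominus> s \<otimes> y) \<otimes> inv (\<one> \<ominus> s \<otimes> y) \<in> I"
      using I.I_r_closed u by simp
    moreover have "r \<otimes> (\<one> \<ominus> s \<otimes> y) \<otimes> inv (\<one> \<ominus> s \<otimes> y) = r"
      using u r(1) Units_closed[OF u] by (simp add: m_assoc)
    ultimately show False using \<open>r \<notin> I\<close> by simp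
  qed
  have prime: "primeideal I R"
  proof (rule primeidealI[OF I_ideal is_cring])
    show "carrier R \<noteq> I" using I_ne by auto
    fix a b assume ab: "a \<in> carrier R" "b \<in> carrier R" "a \<otimes> b \<in> I"
    show "a \<in> I \<or> b \<in> I"
    proof (rule ccontr)
      \<comment> \<open>Modulo \<open>I\<close> the product is \<open>u v y^(n + k)\<close>;
        cancelling the power of \<open>y\<close> by \<open>reg_pow\<close> would put the unit
        \<open>u v\<close> into \<open>I\<close>.\<close>
      assume "\<not> (a \<in> I \<or> b \<in> I)"
      then obtain u n v k where u: "u \<in> Units R" "a \<ominus> u \<otimes> y [^] (n::nat) \<in> I"
        and v: "v \<in> Units R" "b \<ominus> v \<otimes> y [^] (k::nat) \<in> I"
        using good[OF ab(1)] good[OF ab(2)] unfolding good_def by blast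
      note c = Units_closed[OF u(1)] Units_closed[OF v(1)]
      have "I +> a = I +> (u \<otimes> y [^] n)" "I +> b = I +> (v \<otimes> y [^] k)"
        using u v ab yc c by (simp_all add: coset_eq_iff[OF I_ideal])
      hence "I +> (a \<otimes> b) = I +> ((u \<otimes> y [^] n) \<otimes> (v \<otimes> y [^] k))"
        using ab yc c by (simp flip: coset_mult[OF I_ideal])
      hence "(u \<otimes> y [^] n) \<otimes> (v \<otimes> y [^] k) \<in> I"
        using ab yc c coset_eq_zero_iff[OF I_ideal] by (metis m_closed nat_pow_closed)
      also have "(u \<otimes> y [^] n) \<otimes> (v \<otimes> y [^] k) = (u \<otimes> v) \<otimes> y [^] (n + k)"
        using c yc by (simp add: m_ac flip: nat_pow_mult)
      finally have "u \<otimes> v \<in> I" using reg_pow c by blast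
      from I.I_l_closed[OF this Units_inv_closed[OF Units_m_closed[OF u(1) v(1)]]]
      show False using I_ne Units_l_inv[OF Units_m_closed[OF u(1) v(1)]] by simp
    qed
  qed
  interpret P: primeideal I R by (rule prime)
  interpret Q: "domain" ?Q by (rule P.quotient_is_domain)
  have "principal_domain ?Q"
  proof (unfold_locales)
    fix K assume K: "ideal K ?Q"
    interpret K: ideal K ?Q by fact
    show "\<exists>a\<in>carrier ?Q. K = PIdl\<^bsub>?Q\<^esub> a"
    proof (cases "K = {\<zero>\<^bsub>?Q\<^esub>}")
      case True
      thus ?thesis
        using Q.cgenideal_eq_genideal[OF Q.zero_closed] Q.genideal_zero by (metis Q.zero_closed)
    next
      case False
      have pow: "I +> (y [^] n) \<in> K" if "c \<in> carrier R" "u \<in> Units R" "c \<ominus> u \<otimes> y [^] (n::nat) \<in> I" "I +> c \<in> K" for c u n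
      proof -
        have "I +> c = I +> (u \<otimes> y [^] n)"
          using that yc Units_closed by (simp add: coset_eq_iff[OF I_ideal])
        hence "(I +> inv u) \<otimes>\<^bsub>?Q\<^esub> (I +> (u \<otimes> y [^] n)) \<in> K"
          using that by (intro K.I_l_closed coset_closed[OF I_ideal]) auto
        moreover have "inv u \<otimes> (u \<otimes> y [^] n) = y [^] n"
          using that yc Units_closed by (simp add: m_assoc[symmetric])
        ultimately show ?thesis using that yc Units_closed by (simp add: coset_mult[OF I_ideal])
      qed
      have ex: "\<exists>a u n. a \<in> carrier R \<and> c = I +> a \<and> u \<in> Units R \<and> a \<ominus> u \<otimes> y [^] (n::nat) \<in> I"
        if cK: "c \<in> K" "c \<noteq> I" for c
      proof -
        obtain a where a: "a \<in> carrier R" "c = I +> a"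
          using K.Icarr[OF cK(1)] unfolding mem_quot[OF I_ideal] by (elim bexE)
        hence "a \<notin> I" using cK(2) coset_eq_zero_iff[OF I_ideal a(1)] by simp
        from good[OF a(1) this] obtain u n where "u \<in> Units R" "a \<ominus> u \<otimes> y [^] (n::nat) \<in> I"
          unfolding good_def by (elim bexE exE)
        with a show ?thesis by (intro exI conjI)
      qed
      have "\<exists>c\<in>K. c \<noteq> I"
        using False K.zero_closed quot_zero[OF I_ideal] by auto
      then obtain c0 where c0: "c0 \<in> K" "c0 \<noteq> I" by (elim bexE)
      from ex[OF this] obtain a0 u0 n0 where a0: "a0 \<in> carrier R" "c0 = I +> a0" "u0 \<in> Units R"
        "a0 \<ominus> u0 \<otimes> y [^] (n0::nat) \<in> I" by (elim exE conjE)
      have n0: "I +> (y [^] n0) \<in> K"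
        using pow[OF a0(1,3,4)] c0(1) a0(2) by simp
      \<comment> \<open>The smallest power of \<open>y\<close> in \<open>K\<close>. A non-zero class
        in \<open>K\<close> is a unit times some \<open>y^k\<close>, so \<open>y^k\<close> is in
        \<open>K\<close> and \<open>n \<le> k\<close>.\<close>
      define n where "n = (LEAST n. I +> (y [^] (n::nat)) \<in> K)"
      have n: "I +> (y [^] n) \<in> K"
        unfolding n_def by (rule LeastI[of "\<lambda>n. I +> (y [^] n) \<in> K", OF n0])
      have least: "n \<le> k" if "I +> (y [^] k) \<in> K" for k
        unfolding n_def by (rule Least_le[of "\<lambda>n. I +> (y [^] n) \<in> K", OF that])
      have nc: "I +> (y [^] n) \<in> carrier ?Q" using K.Icarr[OF n] .
      have "K \<subseteq> PIdl\<^bsub>?Q\<^esub> (I +> (y [^] n))"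
      proof
        fix c assume c: "c \<in> K"
        show "c \<in> PIdl\<^bsub>?Q\<^esub> (I +> (y [^] n))"
        proof (cases "c = I")
          case True
          have "\<zero>\<^bsub>?Q\<^esub> \<in> PIdl\<^bsub>?Q\<^esub> (I +> (y [^] n))"
            using ideal.axioms(1)[OF Q.cgenideal_ideal[OF nc]] by (rule additive_subgroup.zero_closed)
          thus ?thesis using True quot_zero[OF I_ideal] by simp
        next
          case False
          obtain a u k where a: "a \<in> carrier R" "c = I +> a" "u \<in> Units R" "a \<ominus> u \<otimes> y [^] (k::nat) \<in> I"
            using ex[OF c False] by (elim exE conjE)
          have "n \<le> k" using least[OF pow[OF a(1,3,4)]] c a(2) by simp
          have uc: "u \<in> carrier R" using a(3) by (rule Units_closed)
          have "c = I +> (u \<otimes> y [^] k)" using a yc uc by (simp add: coset_eq_iff[OF I_ideal])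
          also have "u \<otimes> y [^] k = (u \<otimes> y [^] (k - n)) \<otimes> y [^] n"
            using \<open>n \<le> k\<close> uc yc by (simp add: m_assoc nat_pow_mult)
          also have "I +> \<dots> = (I +> (u \<otimes> y [^] (k - n))) \<otimes>\<^bsub>?Q\<^esub> (I +> (y [^] n))"
            using uc yc by (simp add: coset_mult[OF I_ideal])
          finally have "c = (I +> (u \<otimes> y [^] (k - n))) \<otimes>\<^bsub>?Q\<^esub> (I +> (y [^] n))" .
          moreover have "I +> (u \<otimes> y [^] (k - n)) \<in> carrier ?Q"
            using uc yc by (intro coset_closed[OF I_ideal]) simp
          ultimately show ?thesis unfolding cgenideal_def by blast
        qed
      qed
      moreover have "PIdl\<^bsub>?Q\<^esub> (I +> (y [^] n)) \<subseteq> K" by (rule Q.cgenideal_minimal[OF K n])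
      ultimately show ?thesis using nc by blast
    qed
  qed
  moreover have "\<not> field ?Q"
  proof
    assume "field ?Q"
    then interpret F: field ?Q .
    have "y \<noteq> \<zero>" using reg[of \<one>] I_ne by auto
    hence "y \<notin> I" using y I_Int_J by blast
    hence "I +> y \<noteq> \<zero>\<^bsub>?Q\<^esub>" using coset_eq_zero_iff[OF I_ideal yc] quot_zero[OF I_ideal] by simp
    hence "I +> y \<in> Units ?Q" using F.field_Units coset_closed[OF I_ideal yc] by blast
    then obtain c where c: "c \<in> carrier ?Q" "c \<otimes>\<^bsub>?Q\<^esub> (I +> y) = \<one>\<^bsub>?Q\<^esub>" by (auto simp: Units_def)
    obtain a where "a \<in> carrier R" "c = I +> a"
      using c(1) unfolding mem_quot[OF I_ideal] by (elim bexE)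
    hence a: "a \<in> carrier R" "I +> (a \<otimes> y) = I +> \<one>"
      using c(2) yc by (simp_all add: coset_mult[OF I_ideal] quot_one[OF I_ideal])
    hence "I +> \<one> = I +> (a \<otimes> y)" by simp
    hence "\<one> \<ominus> a \<otimes> y \<in> m" using a yc coset_eq_iff[OF I_ideal, of \<one> "a \<otimes> y"] I_m by simp
    hence "(\<one> \<ominus> a \<otimes> y) \<oplus> a \<otimes> y \<in> m" using J_m[OF y] a m.I_l_closed by simp
    thus False using one_notin_m a yc by (simp add: a_minus_def a_assoc l_neg)
  qed
  moreover have "\<exists>!n. maximalideal n ?Q"
  proof (rule ex1I)
    have "I \<subseteq> m" using I_m by (rule subsetI)
    note max = quot_maximalideal[OF I_ideal this]
    show "maximalideal ((+>) I ` m) ?Q" unfolding max ..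
    show "\<And>n. maximalideal n ?Q \<Longrightarrow> n = (+>) I ` m" unfolding max .
  qed
  ultimately show ?thesis by (simp add: discrete_valuation_ring_def)
qed

subsection \<open>Prime avoidance and depth zero\<close>

text \<open>A product of elements chosen from each \<open>Q\<close> outside the prime lies in every
  \<open>Q\<close> and stays outside the prime.\<close>

lemma (in primeideal) avoid_Inter:
  assumes "finite F" "\<And>Q. Q \<in> F \<Longrightarrow> ideal Q R" "\<And>Q. Q \<in> F \<Longrightarrow> \<not> Q \<subseteq> I"
  shows "\<exists>z\<in>carrier R. z \<notin> I \<and> (\<forall>Q\<in>F. z \<in> Q)"
  using assms
proof (induction F)
  case empty
  have "\<one> \<notin> I" using I_notcarr one_imp_carrier by auto
  thus ?case by auto
next
  case (insert Q F)
  then obtain z where z: "z \<in> carrier R" "z \<notin> I" "\<forall>Q\<in>F. z \<in> Q" by auto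
  interpret Q: ideal Q R using insert by blast
  obtain q where q: "q \<in> Q" "q \<notin> I" using insert.prems(2)[of Q] by blast
  show ?case
  proof (intro bexI[of _ "q \<otimes> z"] conjI ballI)
    show "q \<otimes> z \<notin> I" using I_prime[of q z] q z Q.Icarr by blast
    show "q \<otimes> z \<in> carrier R" using q z Q.Icarr by simp
    fix P assume P: "P \<in> insert Q F"
    interpret P: ideal P R using insert.prems(1)[OF P] .
    show "q \<otimes> z \<in> P"
      using P q z Q.I_r_closed[of q z] P.I_l_closed[of z q] Q.Icarr[of q] by auto
  qed
qed

text \<open>By induction some \<open>x\<close> in \<open>N\<close> avoids \<open>F\<close>. If it
  falls into the new prime \<open>P\<close>, it is changed by \<open>n z\<close>, with
  \<open>n\<close> in \<open>N\<close> but not in \<open>P\<close>, and \<open>z\<close> in every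
  member of \<open>F\<close> but not in \<open>P\<close>; incomparability of the primes provides
  \<open>z\<close>.\<close>

lemma (in cring) prime_avoidance:
  assumes "finite F" "\<And>P. P \<in> F \<Longrightarrow> primeideal P R"
    and "\<And>P Q. P \<in> F \<Longrightarrow> Q \<in> F \<Longrightarrow> P \<subseteq> Q \<Longrightarrow> P = Q"
    and N: "ideal N R" and "\<And>P. P \<in> F \<Longrightarrow> \<not> N \<subseteq> P"
  shows "\<exists>x\<in>N. \<forall>P\<in>F. x \<notin> P"
  using assms(1-3,5)
proof (induction F)
  case empty
  interpret N: ideal N R by (rule N)
  show ?case using N.zero_closed by blast
next
  case (insert P F)
  interpret N: ideal N R by (rule N)
  interpret P: primeideal P R using insert by blast
  have "\<exists>x\<in>N. \<forall>P\<in>F. x \<notin> P" using insert by (intro insert.IH) auto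
  then obtain x where x: "x \<in> N" "\<forall>P\<in>F. x \<notin> P" by blast
  show ?case
  proof (cases "x \<in> P")
    case True
    have "\<exists>z\<in>carrier R. z \<notin> P \<and> (\<forall>Q\<in>F. z \<in> Q)"
    proof (rule P.avoid_Inter[OF insert.hyps(1)])
      fix Q assume Q: "Q \<in> F"
      interpret Q: primeideal Q R using insert Q by blast
      show "ideal Q R" by (rule Q.is_ideal)
      show "\<not> Q \<subseteq> P" using insert.prems(2)[of Q P] insert.hyps(2) Q by blast
    qed
    then obtain z where z: "z \<in> carrier R" "z \<notin> P" "\<forall>Q\<in>F. z \<in> Q" by blast
    obtain n where n: "n \<in> N" "n \<notin> P" using insert.prems(3)[of P] by blast
    have nc: "n \<in> carrier R" and xc: "x \<in> carrier R" using n x N.Icarr by blast+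
    have nz: "n \<otimes> z \<notin> P" using P.I_prime[of n z] n z nc by blast
    have diff: "b \<in> Q" if "ideal Q R" "a \<in> Q" "a \<oplus> b \<in> Q" "b \<in> carrier R" for a b Q
    proof -
      interpret Q: ideal Q R by fact
      have "\<ominus> a \<oplus> (a \<oplus> b) \<in> Q" using that by simp
      thus ?thesis using that Q.Icarr[of a] by (simp add: r_neg1)
    qed
    show ?thesis
    proof (intro bexI[of _ "x \<oplus> n \<otimes> z"] ballI)
      show "x \<oplus> n \<otimes> z \<in> N" using x n z by (simp add: N.I_r_closed)
      fix Q assume "Q \<in> insert P F"
      then consider "Q = P" | "Q \<in> F" by blast
      thus "x \<oplus> n \<otimes> z \<notin> Q"
      proof cases
        case 1
        thus ?thesis using diff[OF P.is_ideal True _ m_closed[OF nc z(1)]] nz by blast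
      next
        case 2
        then interpret Q: primeideal Q R using insert by blast
        have "n \<otimes> z \<in> Q" using 2 z nc by (simp add: Q.I_l_closed)
        thus ?thesis using diff[OF Q.is_ideal _ _ xc, of "n \<otimes> z"] x(2) 2 a_comm[OF xc m_closed[OF nc z(1)]]
          by auto
      qed
    qed
  qed (use x in blast)
qed

text \<open>An ideal of zero divisors on \<open>R/J\<close> is contained in a single associated prime: the maximal
  ones among the colon ideals \<open>J : a\<close> are prime, and there are finitely many of them because
  finitely many of the \<open>a\<close> generate the ideal generated by all of them.\<close>

lemma zero_divisors_annihilated:
  fixes R (structure)
  assumes "cring R" "noetherian_ring R" and J: "ideal J R" and N: "ideal N R"
    and zd: "\<And>x. x \<in> N \<Longrightarrow> \<exists>a\<in>carrier R - J. x \<otimes> a \<in> J"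
  shows "\<exists>a\<in>carrier R - J. \<forall>x\<in>N. x \<otimes> a \<in> J"
proof -
  interpret cring R by fact
  interpret R: noetherian_ring R by fact
  interpret J: ideal J R by fact
  interpret N: ideal N R by fact
  define col where "col a = {r \<in> carrier R. r \<otimes> a \<in> J}" for a
  have col: "ideal (col a) R" if a: "a \<in> carrier R" for a
  proof (rule idealI[OF ring_axioms])
    show "subgroup (col a) (add_monoid R)"
    proof (rule add.subgroupI)
      show "col a \<noteq> {}" using a by (auto simp: col_def intro!: exI[of _ \<zero>])
      fix x assume "x \<in> col a"
      moreover have "(\<ominus> x) \<otimes> a = \<ominus> (x \<otimes> a)" using a calculation by (auto simp: col_def l_minus)
      ultimately show "\<ominus> x \<in> col a" by (auto simp: col_def)
    qed (use a in \<open>auto simp: col_def l_distr\<close>)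
    fix x y assume "x \<in> col a" "y \<in> carrier R"
    thus "y \<otimes> x \<in> col a" using a by (auto simp: col_def m_assoc J.I_l_closed)
    thus "x \<otimes> y \<in> col a" using \<open>x \<in> col a\<close> \<open>y \<in> carrier R\<close> by (auto simp: col_def m_comm)
  qed
  \<comment> \<open>The elements outside \<open>J\<close> whose colon ideal is maximal; these colon
    ideals are the maximal associated primes of \<open>R/J\<close>.\<close>
  define A where "A = {a \<in> carrier R - J. \<forall>c \<in> carrier R - J. col a \<subseteq> col c \<longrightarrow> col c = col a}"
  have A: "a \<in> carrier R" "a \<notin> J" "\<And>c. c \<in> carrier R \<Longrightarrow> c \<notin> J \<Longrightarrow> col a \<subseteq> col c \<Longrightarrow> col c = col a"
    if "a \<in> A" for a using that by (auto simp: A_def)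
  have ex: "\<exists>c\<in>A. col a \<subseteq> col c" if a: "a \<in> carrier R" "a \<notin> J" for a
  proof -
    let ?S = "col ` {c \<in> carrier R - J. col a \<subseteq> col c}"
    have "\<exists>M\<in>?S. \<forall>Z\<in>?S. M \<subseteq> Z \<longrightarrow> Z = M"
      by (rule R.maximal_ideal_exists) (use a col in auto)
    then obtain c where c: "c \<in> carrier R" "c \<notin> J" "col a \<subseteq> col c"
      "\<And>d. d \<in> carrier R \<Longrightarrow> d \<notin> J \<Longrightarrow> col a \<subseteq> col d \<Longrightarrow> col c \<subseteq> col d \<Longrightarrow> col d = col c"
      by auto
    hence "c \<in> A" by (auto simp: A_def)
    thus ?thesis using c by blast
  qed
  have prime: "primeideal (col a) R" if a: "a \<in> A" for a
  proof (rule primeidealI[OF col[OF A(1)[OF a]] is_cring])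
    have "\<one> \<notin> col a" using A[OF a] by (simp add: col_def)
    thus "carrier R \<noteq> col a" by auto
    fix r s assume rs: "r \<in> carrier R" "s \<in> carrier R" "r \<otimes> s \<in> col a"
    show "r \<in> col a \<or> s \<in> col a"
    proof (rule disjCI)
      \<comment> \<open>Since \<open>s a\<close> is not in \<open>J\<close>, maximality forces
        \<open>J : s a = J : a\<close>, and \<open>r\<close> lies in the left-hand side.\<close>
      assume "s \<notin> col a"
      hence "s \<otimes> a \<notin> J" using rs by (simp add: col_def)
      moreover have "col a \<subseteq> col (s \<otimes> a)"
      proof
        fix x assume "x \<in> col a"
        thus "x \<in> col (s \<otimes> a)"
          using J.I_l_closed[of "x \<otimes> a" s] m_lcomm[of s x a] A(1)[OF a] rs(2) by (simp add: col_def)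
      qed
      ultimately have "col (s \<otimes> a) = col a" using A(3)[OF a] A(1)[OF a] rs by simp
      moreover have "r \<in> col (s \<otimes> a)" using rs A(1)[OF a] by (simp add: col_def m_assoc)
      ultimately show "r \<in> col a" by simp
    qed
  qed
  have Asub: "A \<subseteq> carrier R" using A(1) by blast
  let ?S = "{Idl F | F. finite F \<and> F \<subseteq> A}"
  have "\<exists>M\<in>?S. \<forall>Z\<in>?S. M \<subseteq> Z \<longrightarrow> Z = M"
  proof (rule R.maximal_ideal_exists)
    fix K assume "K \<in> ?S"
    thus "ideal K R" using genideal_ideal Asub by blast
  qed auto
  then obtain M where M: "M \<in> ?S" "\<forall>Z\<in>?S. M \<subseteq> Z \<longrightarrow> Z = M" by (elim bexE)
  obtain F where F: "finite F" "F \<subseteq> A" "M = Idl F"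
    using M(1) by (elim CollectE exE conjE)
  have F_max: "Idl G = Idl F" if "finite G" "G \<subseteq> A" "Idl F \<subseteq> Idl G" for G
  proof -
    have "Idl G \<in> ?S" using that(1,2) by blast
    from bspec[OF M(2) this] show ?thesis using that(3) F(3) by simp
  qed
  have Fc: "F \<subseteq> carrier R" using F(2) Asub by blast
  have AF: "a \<in> Idl F" if a: "a \<in> A" for a
  proof -
    have c: "insert a F \<subseteq> carrier R" using Fc A(1)[OF a] by blast
    have "Idl F \<subseteq> Idl (insert a F)" by (rule subset_Idl_subset[OF c]) blast
    hence "Idl (insert a F) = Idl F" using F(1,2) a by (intro F_max) auto
    thus ?thesis using genideal_self[OF c] by blast
  qed
  \<comment> \<open>That \<open>a z\<close> is in \<open>J\<close> is symmetric in \<open>a\<close>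
    and \<open>z\<close>. If \<open>J : a\<close> differed from all \<open>J : b\<close> with
    \<open>b\<close> in \<open>F\<close>, some \<open>z\<close> would lie in all of these but not in
    \<open>J : a\<close>. Then \<open>J : z\<close> contains \<open>F\<close>, hence the ideal
    generated by \<open>F\<close>, hence \<open>a\<close>; but this says that \<open>z\<close> is in
    \<open>J : a\<close>.\<close>
  have fin: "\<exists>b\<in>F. col a = col b" if a: "a \<in> A" for a
  proof (rule ccontr)
    assume neg: "\<not> (\<exists>b\<in>F. col a = col b)"
    interpret P: primeideal "col a" R by (rule prime[OF a])
    have "\<exists>z\<in>carrier R. z \<notin> col a \<and> (\<forall>Q\<in>col ` F. z \<in> Q)"
    proof (rule P.avoid_Inter)
      fix Q assume "Q \<in> col ` F"
      then obtain b where b: "b \<in> F" "Q = col b" by blast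
      show "ideal Q R" using b col Fc by blast
      show "\<not> Q \<subseteq> col a" using A[OF a] A(3)[of b a] neg b F(2) by blast
    qed (use F in auto)
    then obtain z where z: "z \<in> carrier R" "z \<notin> col a" "\<forall>b\<in>F. z \<in> col b" by blast
    have "F \<subseteq> col z"
    proof
      fix b assume b: "b \<in> F"
      hence bc: "b \<in> carrier R" using Fc by blast
      have "z \<in> col b" using bspec[OF z(3) b] .
      hence "b \<otimes> z \<in> J" unfolding col_def m_comm[OF bc z(1)] by blast
      thus "b \<in> col z" using bc unfolding col_def by blast
    qed
    hence "Idl F \<subseteq> col z" by (rule genideal_minimal[OF col[OF z(1)]])
    hence "a \<in> col z" using AF[OF a] by blast
    hence "z \<otimes> a \<in> J" unfolding col_def m_comm[OF z(1) A(1)[OF a]] by blast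
    thus False using z(1,2) unfolding col_def by blast
  qed
  show ?thesis
  proof (rule ccontr)
    assume neg: "\<not> ?thesis"
    \<comment> \<open>If no colon ideal \<open>J : a\<close> with \<open>a\<close> outside
      \<open>J\<close> contains \<open>N\<close>, prime avoidance gives an \<open>x\<close> in
      \<open>N\<close> outside the finitely many maximal ones. As a zero divisor on
      \<open>R/J\<close>, however, \<open>x\<close> lies in some colon ideal, hence in a maximal
      one.\<close>
    have "\<exists>x\<in>N. \<forall>P\<in>col ` F. x \<notin> P"
    proof (rule prime_avoidance[OF _ _ _ N])
      fix P Q assume "P \<in> col ` F" "Q \<in> col ` F" "P \<subseteq> Q"
      then obtain a b where "a \<in> A" "b \<in> A" "P = col a" "Q = col b" using F(2) by blast
      thus "P = Q" using A(3)[of a b] A[of b] \<open>P \<subseteq> Q\<close> by blast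
    next
      fix P assume "P \<in> col ` F"
      then obtain a where a: "a \<in> A" "P = col a" using F(2) by blast
      hence "\<exists>x\<in>N. x \<otimes> a \<notin> J" using neg A[OF a(1)] by blast
      thus "\<not> N \<subseteq> P" using a by (auto simp: col_def)
    next
      fix P assume "P \<in> col ` F"
      thus "primeideal P R" using prime F(2) by blast
    qed (use F in auto)
    then obtain x where x: "x \<in> N" "\<forall>b\<in>F. x \<notin> col b" by blast
    obtain a where a: "a \<in> carrier R" "a \<notin> J" "x \<otimes> a \<in> J" using zd[OF x(1)] by blast
    obtain c where c: "c \<in> A" "col a \<subseteq> col c" using ex[OF a(1,2)] by blast
    have "x \<in> col a" using a x N.Icarr by (simp add: col_def)
    thus False using c fin[OF c(1)] x(2) by blast
  qed
qed

text \<open>A unit \<open>a\<close> would give \<open>I \<subseteq> J\<close>. So \<open>a\<close>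
  is in \<open>m\<close>, and its \<open>I\<close>-component \<open>i\<close> is congruent to it
  modulo \<open>J\<close>; then \<open>x i\<close> lies in \<open>I \<inter> J\<close>.\<close>

lemma (in split_local) socle_lift:
  assumes a: "a \<in> carrier R" "a \<notin> J" "\<And>x. x \<in> m \<Longrightarrow> x \<otimes> a \<in> J"
  obtains s where "s \<in> I" "s \<noteq> \<zero>" "\<And>x. x \<in> m \<Longrightarrow> x \<otimes> s = \<zero>"
proof -
  have "a \<in> m"
  proof (rule ccontr)
    assume "a \<notin> m"
    hence u: "a \<in> Units R" using a Units_if_notin_m by blast
    have "I \<subseteq> {\<zero>}"
    proof
      fix x assume x: "x \<in> I"
      hence "(x \<otimes> a) \<otimes> inv a \<in> J" using a(3)[OF I_m] u J.I_r_closed by simp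
      hence "x \<in> J" using u a(1) I.Icarr[OF x] by (simp add: m_assoc)
      thus "x \<in> {\<zero>}" using x I_Int_J by blast
    qed
    thus False using I_nz I.zero_closed by blast
  qed
  then obtain i j where ij: "i \<in> I" "j \<in> J" "a = i \<oplus> j" using mem_m by blast
  show thesis
  proof (rule that[OF ij(1)])
    show "i \<noteq> \<zero>" using a(2) ij by (auto simp: J.Icarr)
    fix x assume x: "x \<in> m"
    have xc: "x \<in> carrier R" using x m.Icarr by blast
    have "x \<otimes> i = x \<otimes> a \<ominus> x \<otimes> j"
      using ij xc I.Icarr[of i] J.Icarr[of j] by (simp add: r_distr a_minus_def a_assoc r_neg)
    also have "\<dots> \<in> J" using a(3)[OF x] ij xc J.I_l_closed[of j x] by (simp add: a_minus_def)
    finally show "x \<otimes> i = \<zero>" using I.I_l_closed[OF ij(1) xc] I_Int_J by blast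
  qed
qed

text \<open>A non-zero-divisor on \<open>R/J\<close> in \<open>m\<close> would give a regular
  sequence of length one. So \<open>m\<close> consists of zero divisors, a single non-zero class is
  killed by all of \<open>m\<close>, and \<open>socle_lift\<close> moves it into
  \<open>I\<close>.\<close>

lemma (in split_local) socle_if_depth_zero:
  assumes noeth: "noetherian_ring R" and depth: "depth (R Quot J) = 0"
  obtains s where "s \<in> I" "s \<noteq> \<zero>" "\<And>x. x \<in> m \<Longrightarrow> x \<otimes> s = \<zero>"
proof -
  let ?Q = "R Quot J" and ?n = "(+>) J ` m"
  interpret Q: cring ?Q by (rule J.quotient_is_cring[OF is_cring])
  have Jm: "J \<subseteq> m" using J_m by blast
  note max = quot_maximalideal[OF J_ideal Jm]
  have the: "(THE n. maximalideal n ?Q) = ?n" unfolding max by simp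
  interpret n: maximalideal ?n ?Q using max by blast
  have zd: "\<exists>a\<in>carrier R - J. x \<otimes> a \<in> J" if x: "x \<in> m" for x
  proof (rule ccontr)
    assume neg: "\<not> ?thesis"
    have xc: "x \<in> carrier R" using x m.Icarr by blast
    let ?x = "J +> x"
    have xn: "?x \<in> ?n" using x by blast
    have empty: "Idl\<^bsub>?Q\<^esub> {} = {\<zero>\<^bsub>?Q\<^esub>}"
      using Q.genideal_minimal[OF Q.zeroideal, of "{}"] Q.genideal_ideal[of "{}"]
        additive_subgroup.zero_closed[OF ideal.axioms(1)] by blast
    have "regular_sequence ?Q [?x]"
      unfolding regular_sequence_def
    proof (intro conjI allI impI ballI)
      show "set [?x] \<subseteq> carrier ?Q" using coset_closed[OF J_ideal xc] by simp
      have "Idl\<^bsub>?Q\<^esub> {?x} \<subseteq> ?n" by (rule Q.genideal_minimal[OF n.is_ideal]) (use xn in simp)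
      thus "Idl\<^bsub>?Q\<^esub> (set [?x]) \<noteq> carrier ?Q"
        using n.I_notcarr n.a_subset by auto
      fix i c assume i: "i < length [?x]" and c: "c \<in> carrier ?Q"
        and mem: "[?x] ! i \<otimes>\<^bsub>?Q\<^esub> c \<in> Idl\<^bsub>?Q\<^esub> (set (take i [?x]))"
      obtain a where a: "a \<in> carrier R" "c = J +> a" using c mem_quot[OF J_ideal] by blast
      have "J +> (x \<otimes> a) = J"
        using mem i a xc by (simp add: empty coset_mult[OF J_ideal] quot_zero[OF J_ideal])
      hence "x \<otimes> a \<in> J" using coset_eq_zero_iff[OF J_ideal] xc a by simp
      hence "a \<in> J" using neg a by blast
      thus "c \<in> Idl\<^bsub>?Q\<^esub> (set (take i [?x]))"
        using i a by (simp add: empty quot_zero[OF J_ideal] coset_eq_zero_iff[OF J_ideal])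
    qed
    hence "[?x] \<in> {xs. regular_sequence ?Q xs \<and> set xs \<subseteq> ?n}" using xn by simp
    hence "enat (length [?x]) \<le> depth ?Q"
      unfolding depth_def the by (rule SUP_upper)
    thus False using depth by (simp add: zero_enat_def)
  qed
  obtain a where a: "a \<in> carrier R" "a \<notin> J" "\<And>x. x \<in> m \<Longrightarrow> x \<otimes> a \<in> J"
    using zero_divisors_annihilated[OF is_cring noeth J_ideal m_ideal zd] by blast
  from socle_lift[OF this] show thesis using that by blast
qed

subsection \<open>Free modules over a quotient ring\<close>

lemma quot_module_simps [simp]:
  "carrier (quot_module R K Y) = carrier Y"
  "\<zero>\<^bsub>quot_module R K Y\<^esub> = \<zero>\<^bsub>Y\<^esub>"
  "x \<oplus>\<^bsub>quot_module R K Y\<^esub> y = x \<oplus>\<^bsub>Y\<^esub> y"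
  "c \<odot>\<^bsub>quot_module R K Y\<^esub> x = (SOME r. r \<in> c) \<odot>\<^bsub>Y\<^esub> x"
  by (simp_all add: quot_module_def)

context cring
begin

lemma quot_smult_rep:
  assumes "module R Y" and K: "ideal K R"
    and ann: "\<And>r x. r \<in> K \<Longrightarrow> x \<in> carrier Y \<Longrightarrow> r \<odot>\<^bsub>Y\<^esub> x = \<zero>\<^bsub>Y\<^esub>"
    and s: "s \<in> carrier R" and x: "x \<in> carrier Y"
  shows "(SOME r. r \<in> K +> s) \<odot>\<^bsub>Y\<^esub> x = s \<odot>\<^bsub>Y\<^esub> x"
proof -
  interpret Y: module R Y by fact
  let ?r = "SOME r. r \<in> K +> s"
  note rep = coset_rep[OF K coset_closed[OF K s]]
  have k: "?r \<ominus> s \<in> K" using coset_eq_iff[OF K rep(1) s] rep(2) by simp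
  have "?r \<odot>\<^bsub>Y\<^esub> x = ((?r \<ominus> s) \<oplus> s) \<odot>\<^bsub>Y\<^esub> x"
    using rep(1) s by (simp add: a_minus_def a_assoc l_neg)
  also have "\<dots> = (?r \<ominus> s) \<odot>\<^bsub>Y\<^esub> x \<oplus>\<^bsub>Y\<^esub> s \<odot>\<^bsub>Y\<^esub> x"
    using rep(1) s x by (intro Y.smult_l_distr) auto
  also have "\<dots> = s \<odot>\<^bsub>Y\<^esub> x" using ann[OF k x] s x by simp
  finally show ?thesis .
qed

lemma module_quot_module:
  assumes Y: "module R Y" and K: "ideal K R"
    and ann: "\<And>r x. r \<in> K \<Longrightarrow> x \<in> carrier Y \<Longrightarrow> r \<odot>\<^bsub>Y\<^esub> x = \<zero>\<^bsub>Y\<^esub>"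
  shows "module (R Quot K) (quot_module R K Y)"
proof -
  interpret Y: module R Y by fact
  interpret K: ideal K R by fact
  interpret Q: cring "R Quot K" by (rule K.quotient_is_cring[OF is_cring])
  have rep: "(SOME r. r \<in> K +> s) \<odot>\<^bsub>Y\<^esub> x = s \<odot>\<^bsub>Y\<^esub> x"
    if "s \<in> carrier R" "x \<in> carrier Y" for s x
    by (rule quot_smult_rep[OF Y K ann that])
  have ex: "\<exists>a\<in>carrier R. c = K +> a" if "c \<in> carrier (R Quot K)" for c
    using that unfolding mem_quot[OF K] .
  show ?thesis
  proof (rule moduleI)
    show "cring (R Quot K)" by (rule Q.is_cring)
    show "abelian_group (quot_module R K Y)"
    proof (rule abelian_groupI)
      fix x assume "x \<in> carrier (quot_module R K Y)"
      thus "\<exists>y\<in>carrier (quot_module R K Y). y \<oplus>\<^bsub>quot_module R K Y\<^esub> x = \<zero>\<^bsub>quot_module R K Y\<^esub>"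
        by (intro bexI[of _ "\<ominus>\<^bsub>Y\<^esub> x"]) (auto simp: Y.M.l_neg)
    qed (auto simp: Y.M.a_ac)
  next
    fix a x assume a: "a \<in> carrier (R Quot K)" and x: "x \<in> carrier (quot_module R K Y)"
    show "a \<odot>\<^bsub>quot_module R K Y\<^esub> x \<in> carrier (quot_module R K Y)"
      using coset_rep(1)[OF K a] x by simp
    fix y assume y: "y \<in> carrier (quot_module R K Y)"
    show "a \<odot>\<^bsub>quot_module R K Y\<^esub> (x \<oplus>\<^bsub>quot_module R K Y\<^esub> y) =
        a \<odot>\<^bsub>quot_module R K Y\<^esub> x \<oplus>\<^bsub>quot_module R K Y\<^esub> a \<odot>\<^bsub>quot_module R K Y\<^esub> y"
      using coset_rep(1)[OF K a] x y by (simp add: Y.smult_r_distr)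
  next
    fix a b x assume a: "a \<in> carrier (R Quot K)" and b: "b \<in> carrier (R Quot K)"
      and x: "x \<in> carrier (quot_module R K Y)"
    obtain r where r: "r \<in> carrier R" "a = K +> r" using ex[OF a] by (elim bexE)
    obtain s where s: "s \<in> carrier R" "b = K +> s" using ex[OF b] by (elim bexE)
    show "(a \<oplus>\<^bsub>R Quot K\<^esub> b) \<odot>\<^bsub>quot_module R K Y\<^esub> x =
        a \<odot>\<^bsub>quot_module R K Y\<^esub> x \<oplus>\<^bsub>quot_module R K Y\<^esub> b \<odot>\<^bsub>quot_module R K Y\<^esub> x"
      using r s x by (simp add: coset_add[OF K] rep Y.smult_l_distr)
    show "(a \<otimes>\<^bsub>R Quot K\<^esub> b) \<odot>\<^bsub>quot_module R K Y\<^esub> x =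
        a \<odot>\<^bsub>quot_module R K Y\<^esub> (b \<odot>\<^bsub>quot_module R K Y\<^esub> x)"
      using r s x by (simp add: coset_mult[OF K] rep Y.smult_assoc1)
  next
    fix x assume "x \<in> carrier (quot_module R K Y)"
    thus "\<one>\<^bsub>R Quot K\<^esub> \<odot>\<^bsub>quot_module R K Y\<^esub> x = x"
      using rep[OF one_closed] by (simp add: quot_one[OF K])
  qed
qed

lemma single_one_inj:
  assumes "\<one> \<noteq> \<zero>" "single R i \<one> = single R j \<one>"
  shows "i = j"
  using fun_cong[OF assms(2), of i] assms(1) by (simp add: single_apply split: if_splits)

text \<open>The kernel of \<open>p\<close> is exactly \<open>K R\<^sup>B\<close>: one inclusion is
  \<open>ker\<close>, the other holds because \<open>K\<close> kills \<open>Y\<close>. So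
  \<open>p\<close> induces an isomorphism from the free \<open>R/K\<close>-module on
  \<open>B\<close>.\<close>

lemma quot_freeI:
  fixes Y :: "('a, 'i \<Rightarrow> 'a) module"
  assumes Y: "module R Y" and K: "ideal K R" and nz: "\<one> \<noteq> \<zero>"
    and ann: "\<And>r x. r \<in> K \<Longrightarrow> x \<in> carrier Y \<Longrightarrow> r \<odot>\<^bsub>Y\<^esub> x = \<zero>\<^bsub>Y\<^esub>"
    and B: "finite (B :: 'i set)" and p: "p \<in> module_hom R (free_module R B) Y"
      "p ` carrier (free_module R B) = carrier Y"
    and ker: "\<And>v i. v \<in> carrier (free_module R B) \<Longrightarrow> p v = \<zero>\<^bsub>Y\<^esub> \<Longrightarrow> v i \<in> K"
  shows "quot_free R K Y"
proof -
  interpret Y: module R Y by fact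
  interpret K: ideal K R by fact
  let ?Q = "R Quot K"
  interpret Q: cring ?Q by (rule K.quotient_is_cring[OF is_cring])
  \<comment> \<open>In \<open>is_free\<close> the basis is indexed over the element type of the
    module, here functions on the index type; so the unit vectors serve as indices, distinct because
    \<open>\<one> \<noteq> \<zero>\<close>.\<close>
  define E where "E = (\<lambda>i. single R i \<one>) ` B"
  have E: "finite E" using B by (simp add: E_def)
  define rep where "rep c = (SOME r. r \<in> c)" for c :: "'a set"
  note rep = coset_rep[OF K, folded rep_def]
  \<comment> \<open>A choice of representatives for the coordinates. It need not be additive, but
    \<open>p\<close> does not see the difference, by \<open>p_eq\<close>.\<close>
  define lift where "lift w i = (if i \<in> B then rep (w (single R i \<one>)) else \<zero>)" for w i
  have wE: "w (single R i \<one>) \<in> carrier ?Q" if "w \<in> carrier (free_module ?Q E)" for w i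
    using that by auto
  have liftF: "lift w \<in> carrier (free_module R B)" if "w \<in> carrier (free_module ?Q E)" for w
    using rep(1)[OF wE[OF that]] B by (auto simp: mem_free_module_finite lift_def)
  have p_eq: "p v = p v'" if v: "v \<in> carrier (free_module R B)" "v' \<in> carrier (free_module R B)"
    and d: "\<And>i. i \<in> B \<Longrightarrow> K +> v i = K +> v' i" for v v'
  proof -
    have "v i \<ominus> v' i \<in> K" for i
    proof (cases "i \<in> B")
      case True
      thus ?thesis using coset_eq_iff[OF K, of "v i" "v' i"] d[OF True] v by auto
    next
      case False
      thus ?thesis using v by (auto simp: mem_free_module a_minus_def)
    qed
    from hom_annihilated[OF Y p(1) K ann free_module_minus_closed[OF v] this]
    have "p v \<ominus>\<^bsub>Y\<^esub> p v' = \<zero>\<^bsub>Y\<^esub>" using hom_free_diff[OF Y p(1) v] by simp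
    moreover have "p v = (p v \<ominus>\<^bsub>Y\<^esub> p v') \<oplus>\<^bsub>Y\<^esub> p v'"
      using hom_closed[OF p(1)] v by (simp add: a_minus_def Y.M.a_assoc Y.M.l_neg)
    ultimately show ?thesis using hom_closed[OF p(1)] v by simp
  qed
  have coset_lift: "K +> lift w i = w (single R i \<one>)" if "w \<in> carrier (free_module ?Q E)" "i \<in> B" for w i
    using rep(2)[OF wE[OF that(1)]] that(2) by (simp add: lift_def)
  have lift_c: "lift w i \<in> carrier R" if "w \<in> carrier (free_module ?Q E)" for w i
    using liftF[OF that] by auto
  define f where "f w = p (lift w)" for w
  have "f \<in> module_hom ?Q (free_module ?Q E) (quot_module R K Y)"
  proof (rule module_homI)
    fix w assume "w \<in> carrier (free_module ?Q E)"
    thus "f w \<in> carrier (quot_module R K Y)" using hom_closed[OF p(1) liftF] by (simp add: f_def)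
  next
    fix w w' assume w: "w \<in> carrier (free_module ?Q E)" "w' \<in> carrier (free_module ?Q E)"
    note c = Q.free_module_closed(2)[OF w]
    have "f (\<lambda>i. w i \<oplus>\<^bsub>?Q\<^esub> w' i) = p (\<lambda>i. lift w i \<oplus> lift w' i)"
      unfolding f_def
    proof (rule p_eq)
      fix i assume i: "i \<in> B"
      have "K +> (lift w i \<oplus> lift w' i) = (K +> lift w i) \<oplus>\<^bsub>?Q\<^esub> (K +> lift w' i)"
        using coset_add[OF K lift_c[OF w(1)] lift_c[OF w(2)]] by simp
      thus "K +> lift (\<lambda>i. w i \<oplus>\<^bsub>?Q\<^esub> w' i) i = K +> (lift w i \<oplus> lift w' i)"
        unfolding coset_lift[OF c i] coset_lift[OF w(1) i] coset_lift[OF w(2) i] by simp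
    qed (use liftF c w in auto)
    thus "f (w \<oplus>\<^bsub>free_module ?Q E\<^esub> w') = f w \<oplus>\<^bsub>quot_module R K Y\<^esub> f w'"
      using hom_add[OF p(1) liftF[OF w(1)] liftF[OF w(2)]] by (simp add: f_def)
  next
    fix a w assume a: "a \<in> carrier ?Q" and w: "w \<in> carrier (free_module ?Q E)"
    note c = Q.free_module_closed(3)[OF a w]
    have "f (\<lambda>i. a \<otimes>\<^bsub>?Q\<^esub> w i) = p (\<lambda>i. rep a \<otimes> lift w i)"
      unfolding f_def
    proof (rule p_eq)
      fix i assume i: "i \<in> B"
      have "K +> (rep a \<otimes> lift w i) = (K +> rep a) \<otimes>\<^bsub>?Q\<^esub> (K +> lift w i)"
        using coset_mult[OF K rep(1)[OF a] lift_c[OF w]] by simp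
      thus "K +> lift (\<lambda>i. a \<otimes>\<^bsub>?Q\<^esub> w i) i = K +> (rep a \<otimes> lift w i)"
        unfolding coset_lift[OF c i] coset_lift[OF w i] rep(2)[OF a] by simp
    qed (use liftF[OF c] liftF[OF w] rep(1)[OF a] in auto)
    thus "f (a \<odot>\<^bsub>free_module ?Q E\<^esub> w) = a \<odot>\<^bsub>quot_module R K Y\<^esub> f w"
      using hom_smult[OF p(1) rep(1)[OF a] liftF[OF w]] by (simp add: f_def rep_def)
  qed
  moreover have "bij_betw f (carrier (free_module ?Q E)) (carrier (quot_module R K Y))"
    unfolding bij_betw_def
  proof
    show "inj_on f (carrier (free_module ?Q E))"
    proof (rule inj_onI)
      fix w w' assume w: "w \<in> carrier (free_module ?Q E)" "w' \<in> carrier (free_module ?Q E)"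
        and eq: "f w = f w'"
      have "p (\<lambda>i. lift w i \<ominus> lift w' i) = \<zero>\<^bsub>Y\<^esub>"
        using hom_free_diff[OF Y p(1) liftF[OF w(1)] liftF[OF w(2)]] eq hom_closed[OF p(1) liftF[OF w(1)]]
        by (simp add: f_def a_minus_def[of Y] Y.M.r_neg)
      from ker[OF free_module_minus_closed[OF liftF[OF w(1)] liftF[OF w(2)]] this]
      have d: "K +> lift w i = K +> lift w' i" for i
        using coset_eq_iff[OF K lift_c[OF w(1)] lift_c[OF w(2)]] by simp
      show "w = w'"
      proof
        fix x show "w x = w' x"
        proof (cases "x \<in> E")
          case True
          then obtain i where i: "i \<in> B" "x = single R i \<one>" by (auto simp: E_def)
          show ?thesis
            unfolding i(2) coset_lift[OF w(1) i(1), symmetric] coset_lift[OF w(2) i(1), symmetric]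
            by (rule d)
        next
          case False
          thus ?thesis using w by (simp add: Q.mem_free_module)
        qed
      qed
    qed
    show "f ` carrier (free_module ?Q E) = carrier (quot_module R K Y)"
    proof (intro equalityI subsetI)
      fix y assume "y \<in> carrier (quot_module R K Y)"
      hence "y \<in> p ` carrier (free_module R B)" unfolding p(2) by simp
      then obtain v where v: "v \<in> carrier (free_module R B)" "y = p v" by (elim imageE)
      have vc: "v i \<in> carrier R" for i using v by auto
      define w where "w x = (if x \<in> E then K +> v (THE i. x = single R i \<one>) else \<zero>\<^bsub>?Q\<^esub>)" for x
      have w: "w \<in> carrier (free_module ?Q E)"
        using coset_closed[OF K vc] by (simp add: Q.mem_free_module_finite[OF E] w_def)
      have "y = f w"
        unfolding v(2) f_def
      proof (rule p_eq[OF v(1) liftF[OF w]])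
        fix i assume i: "i \<in> B"
        have "(THE j. single R i \<one> = single R j \<one>) = i"
          by (rule the_equality, rule refl, rule single_one_inj[OF nz], erule sym)
        thus "K +> v i = K +> lift w i"
          unfolding coset_lift[OF w i] using i by (simp add: w_def E_def)
      qed
      thus "y \<in> f ` carrier (free_module ?Q E)" using w by (rule image_eqI)
    next
      fix y assume "y \<in> f ` carrier (free_module ?Q E)"
      then obtain w where "w \<in> carrier (free_module ?Q E)" "y = f w" by (elim imageE)
      thus "y \<in> carrier (quot_module R K Y)" using hom_closed[OF p(1) liftF] by (simp add: f_def)
    qed
  qed
  ultimately have "module_iso ?Q (free_module ?Q E) (quot_module R K Y)"
    unfolding module_iso_def by blast
  thus ?thesis
    unfolding quot_free_def is_free_def using module_quot_module[OF Y K ann] ann by blast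
qed

text \<open>The two consequences of freeness that the socle argument needs: \<open>f\<close> is a
  basis element, and \<open>s\<close> represents a non-zero coordinate of \<open>w\<close>, which is
  killed by everything that kills \<open>w\<close>.\<close>

lemma quot_freeD:
  assumes Y: "module R Y" and K: "ideal K R" and free: "quot_free R K Y"
    and nz: "carrier Y \<noteq> {\<zero>\<^bsub>Y\<^esub>}"
  obtains f where "f \<in> carrier Y" "\<And>s. s \<in> carrier R \<Longrightarrow> s \<odot>\<^bsub>Y\<^esub> f = \<zero>\<^bsub>Y\<^esub> \<Longrightarrow> s \<in> K"
    and "\<And>w. w \<in> carrier Y \<Longrightarrow> w \<noteq> \<zero>\<^bsub>Y\<^esub> \<Longrightarrow>
      \<exists>s\<in>carrier R - K. \<forall>r\<in>carrier R. r \<odot>\<^bsub>Y\<^esub> w = \<zero>\<^bsub>Y\<^esub> \<longrightarrow> r \<otimes> s \<in> K"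
proof -
  interpret Y: module R Y by fact
  interpret K: ideal K R by fact
  let ?Q = "R Quot K"
  interpret Q: cring ?Q by (rule K.quotient_is_cring[OF is_cring])
  have ann: "\<And>r x. r \<in> K \<Longrightarrow> x \<in> carrier Y \<Longrightarrow> r \<odot>\<^bsub>Y\<^esub> x = \<zero>\<^bsub>Y\<^esub>"
    using free by (simp add: quot_free_def)
  have QY: "module ?Q (quot_module R K Y)" by (rule module_quot_module[OF Y K ann])
  obtain B h where h: "h \<in> module_hom ?Q (free_module ?Q (B :: 'c set)) (quot_module R K Y)"
    "bij_betw h (carrier (free_module ?Q B)) (carrier Y)"
    using free by (auto simp: quot_free_def is_free_def module_iso_def)
  have h0: "h (\<lambda>i. \<zero>\<^bsub>?Q\<^esub>) = \<zero>\<^bsub>Y\<^esub>" using hom_zero[OF Q.module_free_module QY h(1)] by simp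
  have h_zero: "v = (\<lambda>i. \<zero>\<^bsub>?Q\<^esub>)" if "v \<in> carrier (free_module ?Q B)" "h v = \<zero>\<^bsub>Y\<^esub>" for v
    using h(2) h0 that Q.free_module_closed(1) unfolding bij_betw_def inj_on_def by metis
  have hs: "h (\<lambda>i. (K +> s) \<otimes>\<^bsub>?Q\<^esub> v i) = s \<odot>\<^bsub>Y\<^esub> h v"
    if "s \<in> carrier R" "v \<in> carrier (free_module ?Q B)" for s v
    using hom_smult[OF h(1) coset_closed[OF K that(1)] that(2)]
      quot_smult_rep[OF Y K ann that(1)] hom_closed[OF h(1) that(2)] by simp
  have "B \<noteq> {}"
  proof
    assume [simp]: "B = {}"
    have "carrier (free_module ?Q B) = {\<lambda>i. \<zero>\<^bsub>?Q\<^esub>}" by (auto simp: Q.mem_free_module)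
    hence "carrier Y = {h (\<lambda>i. \<zero>\<^bsub>?Q\<^esub>)}" using h(2) by (auto simp: bij_betw_def)
    thus False using nz h0 by simp
  qed
  then obtain k where k: "k \<in> B" by blast
  let ?e = "single ?Q k \<one>\<^bsub>?Q\<^esub>"
  have e: "?e \<in> carrier (free_module ?Q B)" using k by simp
  show thesis
  proof (rule that)
    show "h ?e \<in> carrier Y" using hom_closed[OF h(1) e] by simp
    fix s assume s: "s \<in> carrier R" "s \<odot>\<^bsub>Y\<^esub> h ?e = \<zero>\<^bsub>Y\<^esub>"
    have "(\<lambda>i. (K +> s) \<otimes>\<^bsub>?Q\<^esub> ?e i) = (\<lambda>i. \<zero>\<^bsub>?Q\<^esub>)"
      using h_zero[OF Q.free_module_closed(3)[OF coset_closed[OF K s(1)] e]] hs[OF s(1) e] s(2) by simp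
    from fun_cong[OF this, of k] have "K +> s = K"
      using coset_closed[OF K s(1)] by (simp add: single_apply quot_zero[OF K])
    thus "s \<in> K" using coset_eq_zero_iff[OF K s(1)] by simp
  next
    fix w assume w: "w \<in> carrier Y" "w \<noteq> \<zero>\<^bsub>Y\<^esub>"
    have "w \<in> h ` carrier (free_module ?Q B)" using h(2) w(1) by (simp add: bij_betw_def)
    then obtain v where v: "v \<in> carrier (free_module ?Q B)" "w = h v" by (elim imageE)
    have "v \<noteq> (\<lambda>i. \<zero>\<^bsub>?Q\<^esub>)" using w(2) v(2) h0 by auto
    then obtain i where i: "v i \<noteq> \<zero>\<^bsub>?Q\<^esub>" by (auto simp: fun_eq_iff)
    have "v i \<in> carrier ?Q" using v(1) by auto
    then obtain s where s: "s \<in> carrier R" "v i = K +> s" unfolding mem_quot[OF K] by (elim bexE)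
    have "s \<notin> K" using i s coset_eq_zero_iff[OF K s(1)] quot_zero[OF K] by simp
    moreover have "r \<otimes> s \<in> K" if r: "r \<in> carrier R" "r \<odot>\<^bsub>Y\<^esub> w = \<zero>\<^bsub>Y\<^esub>" for r
    proof -
      have "(\<lambda>i. (K +> r) \<otimes>\<^bsub>?Q\<^esub> v i) = (\<lambda>i. \<zero>\<^bsub>?Q\<^esub>)"
        using h_zero[OF Q.free_module_closed(3)[OF coset_closed[OF K r(1)] v(1)]] hs[OF r(1) v(1)] r(2) v(2)
        by simp
      from fun_cong[OF this, of i] have "K +> (r \<otimes> s) = K"
        using s r by (simp add: coset_mult[OF K] quot_zero[OF K])
      thus ?thesis using coset_eq_zero_iff[OF K] r(1) s(1) by simp
    qed
    ultimately show "\<exists>s\<in>carrier R - K. \<forall>r\<in>carrier R. r \<odot>\<^bsub>Y\<^esub> w = \<zero>\<^bsub>Y\<^esub> \<longrightarrow> r \<otimes> s \<in> K"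
      using s(1) by blast
  qed
qed

text \<open>In \<open>projective\<close> the index set is taken over the element type of the module,
  so a free module is compared with the one indexed by its own unit vectors.\<close>

lemma retract_free_module_reindex:
  fixes B :: "'i set"
  assumes "finite B" "\<one> \<noteq> \<zero>"
  shows "retract R (free_module R B) (free_module R ((\<lambda>i. single R i \<one>) ` B))"
proof -
  let ?E = "(\<lambda>i. single R i \<one>) ` B"
  note E = mem_free_module_finite[OF finite_imageI[OF assms(1)]]
  note B = mem_free_module_finite[OF assms(1)]
  have the: "(THE i. single R k \<one> = single R i \<one>) = k" for k :: 'i
    by (rule the_equality, rule refl, rule single_one_inj[OF assms(2)], erule sym)
  show ?thesis
  proof (rule retractI)
    let ?i = "\<lambda>f x. if x \<in> ?E then f (THE i. x = single R i \<one>) else \<zero>"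
    show "?i \<in> module_hom R (free_module R B) (free_module R ?E)"
      by (rule module_homI) (auto simp: B E the intro!: ext)
    let ?r = "\<lambda>g i. if i \<in> B then g (single R i \<one>) else \<zero>"
    show "?r \<in> module_hom R (free_module R ?E) (free_module R B)"
      by (rule module_homI) (auto simp: B E intro!: ext)
    show "\<And>f. f \<in> carrier (free_module R B) \<Longrightarrow> ?r (?i f) = f"
      by (auto simp: B the intro!: ext)
  qed
qed

lemma projective_free_module:
  assumes "finite B" "\<one> \<noteq> \<zero>"
  shows "projective R (free_module R B)"
  unfolding projective_def
  using retract_imp_direct_summand[OF module_free_module module_free_module
      retract_free_module_reindex[OF assms]] module_free_module by blast

end

lemma (in split_local) quot_free_imp_depth_nonzero:
  assumes noeth: "noetherian_ring R" and B: "finite B"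
    and h: "h \<in> module_hom R (free_module R B) (free_module R C)"
    and hm: "\<And>v i. v \<in> carrier (free_module R B) \<Longrightarrow> h v i \<in> m"
    and Km: "\<And>v i. v \<in> carrier (free_module R B) \<Longrightarrow> h v = (\<lambda>i. \<zero>) \<Longrightarrow> v i \<in> m"
  defines "Y \<equiv> ker_module (free_module R B) (free_module R C) h"
  assumes nz: "carrier Y \<noteq> {\<zero>\<^bsub>Y\<^esub>}" and free: "quot_free R J Y"
  shows "depth (R Quot I) \<noteq> 0 \<and> depth (R Quot J) \<noteq> 0"
proof -
  interpret sw: split_local R m J I by (rule swap)
  have Y: "module R Y"
    unfolding Y_def by (rule module_ker_module[OF module_free_module module_free_module h])
  obtain f where f: "f \<in> carrier Y" "\<And>s. s \<in> carrier R \<Longrightarrow> s \<odot>\<^bsub>Y\<^esub> f = \<zero>\<^bsub>Y\<^esub> \<Longrightarrow> s \<in> J"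
    and f': "\<And>w. w \<in> carrier Y \<Longrightarrow> w \<noteq> \<zero>\<^bsub>Y\<^esub> \<Longrightarrow>
      \<exists>s\<in>carrier R - J. \<forall>r\<in>carrier R. r \<odot>\<^bsub>Y\<^esub> w = \<zero>\<^bsub>Y\<^esub> \<longrightarrow> r \<otimes> s \<in> J"
    by (rule quot_freeD[OF Y J_ideal free nz]) (rule that)
  have no_socle: "s = \<zero>" if s: "s \<in> I" "\<And>x. x \<in> m \<Longrightarrow> x \<otimes> s = \<zero>" for s
  proof -
    have "s \<otimes> f i = \<zero>" for i
    proof -
      have fm: "f i \<in> m" using f(1) Km by (simp add: Y_def)
      show ?thesis using s(2)[OF fm] m_comm[OF I.Icarr[OF s(1)] m.Icarr[OF fm]] by simp
    qed
    hence "s \<odot>\<^bsub>Y\<^esub> f = \<zero>\<^bsub>Y\<^esub>" by (simp add: Y_def)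
    hence "s \<in> J" using f(2) s(1) I.Icarr by blast
    thus ?thesis using s(1) I_Int_J by blast
  qed
  have "depth (R Quot J) \<noteq> 0"
  proof
    assume "depth (R Quot J) = 0"
    from socle_if_depth_zero[OF noeth this] obtain s where "s \<in> I" "s \<noteq> \<zero>" "\<And>x. x \<in> m \<Longrightarrow> x \<otimes> s = \<zero>" by metis
    thus False using no_socle by blast
  qed
  moreover have "depth (R Quot I) \<noteq> 0"
  proof
    assume "depth (R Quot I) = 0"
    from sw.socle_if_depth_zero[OF noeth this] obtain t
      where t: "t \<in> J" "t \<noteq> \<zero>" "\<And>x. x \<in> m \<Longrightarrow> x \<otimes> t = \<zero>" by metis
    have tc: "t \<in> carrier R" using t(1) by (rule J.Icarr)
    have "B \<noteq> {}"
    proof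
      assume "B = {}"
      hence "carrier Y \<subseteq> {\<zero>\<^bsub>Y\<^esub>}" by (auto simp: Y_def mem_free_module)
      moreover have "\<zero>\<^bsub>Y\<^esub> \<in> carrier Y"
        using abelian_monoid.zero_closed[OF abelian_group.axioms(1)[OF module.axioms(2)[OF Y]]] .
      ultimately show False using nz by blast
    qed
    then obtain k where k: "k \<in> B" by blast
    \<comment> \<open>\<open>t e_k\<close> is in the kernel because \<open>h\<close> has its values
      in \<open>m\<close>, and it is killed by \<open>m\<close>. A non-zero coordinate
      \<open>s\<close> of it over \<open>R/J\<close> is then killed by \<open>m\<close> modulo
      \<open>J\<close>, and \<open>socle_lift\<close> turns \<open>s\<close> into a socle element of
      \<open>I\<close>, contrary to \<open>no_socle\<close>.\<close>
    let ?w = "single R k t"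
    have e: "single R k \<one> \<in> carrier (free_module R B)" using k by simp
    have "h ?w = (\<lambda>i. t \<otimes> h (single R k \<one>) i)"
      using hom_smult[OF h tc e] tc by (simp add: smult_single)
    also have "\<dots> = (\<lambda>i. \<zero>)"
      using t(3)[OF hm[OF e]] m_comm[OF tc m.Icarr[OF hm[OF e]]] by simp
    finally have w: "?w \<in> carrier Y" using k tc by (simp add: Y_def)
    moreover have "?w \<noteq> \<zero>\<^bsub>Y\<^esub>"
    proof
      assume "?w = \<zero>\<^bsub>Y\<^esub>"
      hence "?w k = \<zero>" by (simp add: Y_def)
      thus False using t(2) by (simp add: single_apply)
    qed
    ultimately obtain s where s: "s \<in> carrier R" "s \<notin> J"
      "\<forall>r\<in>carrier R. r \<odot>\<^bsub>Y\<^esub> ?w = \<zero>\<^bsub>Y\<^esub> \<longrightarrow> r \<otimes> s \<in> J"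
      using f' by blast
    have rs: "r \<otimes> s \<in> J" if r: "r \<in> m" for r
    proof -
      have "r \<odot>\<^bsub>Y\<^esub> ?w = \<zero>\<^bsub>Y\<^esub>"
        using t(3)[OF r] m.Icarr[OF r] tc by (simp add: Y_def smult_single) (simp add: single_def)
      thus ?thesis using s(3) m.Icarr[OF r] by blast
    qed
    obtain i where "i \<in> I" "i \<noteq> \<zero>" "\<And>x. x \<in> m \<Longrightarrow> x \<otimes> i = \<zero>"
      using socle_lift[OF s(1,2) rs] by metis
    thus False using no_socle by blast
  qed
  ultimately show ?thesis by blast
qed

text \<open>Outside the first alternative the \<open>I\<close>-part of \<open>syz B p Y\<close> is
  zero. Then the kernel of \<open>p\<close> has its coordinates in \<open>J\<close>, and
  \<open>quot_freeI\<close> applies to \<open>Y\<close>.\<close>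

lemma (in split_local) annihilated_summand:
  fixes Y :: "('a, 'i \<Rightarrow> 'a) module" and B :: "'i set"
  assumes noeth: "noetherian_ring R"
    and Y: "module R Y" "cover B p Y" "carrier Y \<noteq> {\<zero>\<^bsub>Y\<^esub>}"
    and ann: "\<And>r x. r \<in> J \<Longrightarrow> x \<in> carrier Y \<Longrightarrow> r \<odot>\<^bsub>Y\<^esub> x = \<zero>\<^bsub>Y\<^esub>"
    and c1: "cover B1 p1 (syz B p Y)" and c2: "cover B2 p2 (syz B1 p1 (syz B p Y))"
  shows "retract R (ideal_module R m) (syz B1 p1 (syz B p Y)) \<or>
    retract R (ideal_module R m) (syz B2 p2 (syz B1 p1 (syz B p Y))) \<and> quot_free R J Y \<or>
    retract R (ideal_module R m) (direct_sum (syz B p Y) (syz B1 p1 (syz B p Y))) \<and>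
      discrete_valuation_ring (R Quot I) \<and> quot_free R J Y"
proof -
  interpret sw: split_local R m J I by (rule swap)
  note p = coverD[OF Y(2)]
  have free: "quot_free R J Y" if triv: "carrier (part I (syz B p Y)) = {\<lambda>i. \<zero>}"
  proof (rule quot_freeI[OF Y(1) J_ideal _ ann p(1-3)])
    show "\<one> \<noteq> \<zero>" using one_notin_m m.zero_closed by metis
    fix v i assume v: "v \<in> carrier (free_module R B)" "p v = \<zero>\<^bsub>Y\<^esub>"
    have vm: "v i \<in> m" for i using p(4)[OF v] .
    note a = pr_free_closed[OF v(1) vm] and b = sw.pr_free_closed[OF v(1) vm]
    have "p (\<lambda>i. pr R J I (v i)) = \<zero>\<^bsub>Y\<^esub>"
      using hom_annihilated[OF Y(1) p(2) J_ideal ann b] pr_decomp[OF vm] by blast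
    moreover have "p (\<lambda>i. pr R I J (v i) \<oplus> pr R J I (v i)) = p (\<lambda>i. pr R I J (v i)) \<oplus>\<^bsub>Y\<^esub> p (\<lambda>i. pr R J I (v i))"
      using hom_add[OF p(2) a b] by simp
    ultimately have "p (\<lambda>i. pr R I J (v i)) = \<zero>\<^bsub>Y\<^esub>"
      using pr_decomp(3)[OF vm] v(2) hom_closed[OF p(2) a]
        abelian_monoid.r_zero[OF abelian_group.axioms(1)[OF module.axioms(2)[OF Y(1)]]] by simp
    hence "(\<lambda>i. pr R I J (v i)) \<in> carrier (part I (syz B p Y))"
      using a pr_decomp(1)[OF vm] by simp
    hence "pr R I J (v i) = \<zero>" unfolding triv by (auto dest: fun_cong)
    thus "v i \<in> J" using pr_decomp(2,3)[OF vm, of i] J.Icarr[OF pr_decomp(2)[OF vm, of i]] by simp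
  qed
  show ?thesis
  proof (rule annihilated_cases[OF Y ann c1 c2])
    fix y assume "carrier (part I (syz B p Y)) = {\<lambda>i. \<zero>}"
      and ret: "retract R (ideal_module R m) (direct_sum (syz B p Y) (syz B1 p1 (syz B p Y)))"
      and y: "y \<in> J" "\<And>x. x \<in> J \<Longrightarrow> \<exists>r\<in>carrier R. x = r \<otimes> y"
        "\<And>a. a \<in> carrier R \<Longrightarrow> a \<otimes> y = \<zero> \<Longrightarrow> a \<in> I"
    thus ?thesis using free discrete_valuation_ring_quot[OF noeth y] by blast
  qed (use free in blast)+
qed

subsection \<open>The resolution\<close>

text \<open>If the second syzygy vanishes, the resolution can be cut off after \<open>R\<^bsup>b 1\<^esup>\<close>; it is
  transported to the element type used in the definition of \<open>proj_dim\<close>.\<close>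

lemma (in cring) proj_dim_le_1:
  fixes M :: "('a, 'c, 'l) module_scheme" and b :: "nat \<Rightarrow> nat"
  assumes nz: "\<one> \<noteq> \<zero>" and M: "module R M"
    and resol: "resolution R M (\<lambda>n. free_module R {..<b n}) d e"
    and triv: "d 2 ` carrier (free_module R {..<b 2}) = {\<lambda>i. \<zero>}"
  shows "proj_dim R M \<le> 1"
proof -
  let ?F = "\<lambda>n. free_module R {..<b n}"
  \<comment> \<open>The coordinates are placed in the left summand of the index type fixed by
    \<open>proj_dim\<close>; \<open>res\<close> and \<open>ext\<close> pass between the two index
    types. The empty index set gives the zero module in degrees above 1.\<close>
  define P :: "nat \<Rightarrow> ('a, (nat + 'a + 'c) \<Rightarrow> 'a) module" where
    "P n = free_module R (if n \<le> 1 then Inl ` {..<b n} else {})" for n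
  define res where "res f = (\<lambda>k. f (Inl k))" for f :: "(nat + 'a + 'c) \<Rightarrow> 'a"
  define ext :: "(nat \<Rightarrow> 'a) \<Rightarrow> nat + 'a + 'c \<Rightarrow> 'a" where
    "ext g = case_sum g (\<lambda>_. \<zero>)" for g
  define d' where "d' n f = (if n = 1 then ext (d 1 (res f)) else (\<lambda>_. \<zero>))" for n :: nat and f
  define e' where "e' f = e (res f)" for f
  have P: "module R (P n)" for n unfolding P_def by (rule module_free_module)
  have P01: "P 0 = free_module R (Inl ` {..<b 0})" "P 1 = free_module R (Inl ` {..<b 1})"
    "P (Suc 0) = free_module R (Inl ` {..<b 1})"
    by (simp_all add: P_def)
  have P2: "carrier (P n) = {\<lambda>_. \<zero>}" if "n > 1" for n
    using that by (auto simp: P_def mem_free_module)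
  have res: "res f \<in> carrier (free_module R B)"
    if "f \<in> carrier (free_module R (Inl ` B))" "finite B" for f and B :: "nat set"
    using that by (auto simp: mem_free_module_finite res_def)
  have ext: "ext g \<in> carrier (free_module R (Inl ` B))"
    if "g \<in> carrier (free_module R B)" "finite B" for g and B :: "nat set"
    using that by (auto simp: mem_free_module_finite ext_def split: sum.splits)
  have res_ext: "res (ext g) = g" for g by (simp add: res_def ext_def)
  have ext_res: "ext (res f) = f" if "f \<in> carrier (free_module R (Inl ` B))" "finite B" for f and B :: "nat set"
  proof
    fix x show "ext (res f) x = f x"
    proof (cases x)
      case (Inr y)
      hence "x \<notin> Inl ` B" by auto
      hence "f x = \<zero>" using that by (simp add: mem_free_module)
      thus ?thesis using Inr by (simp add: ext_def)
    qed (simp add: res_def ext_def)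
  qed
  have res_hom: "res \<in> module_hom R (free_module R (Inl ` B)) (free_module R B)" if "finite B" for B :: "nat set"
    by (rule module_homI) (use res that in \<open>auto simp: res_def fun_eq_iff\<close>)
  have ext_hom: "ext \<in> module_hom R (free_module R B) (free_module R (Inl ` B))" if "finite B" for B :: "nat set"
    by (rule module_homI) (use ext that in \<open>auto simp: ext_def fun_eq_iff split: sum.splits\<close>)
  have d1: "d 1 \<in> module_hom R (?F 1) (?F 0)" and e: "e \<in> module_hom R (?F 0) M"
    and e_surj: "e ` carrier (?F 0) = carrier M"
    and ker_e: "d 1 ` carrier (?F 1) = a_kernel (?F 0) M e"
    and ker_d1: "d 2 ` carrier (?F 2) = a_kernel (?F 1) (?F 0) (d 1)"
    using resol unfolding resolution_def by (auto simp: numeral_2_eq_2)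
  have inj: "v = (\<lambda>i. \<zero>)" if "v \<in> carrier (?F 1)" "d 1 v = (\<lambda>i. \<zero>)" for v
    using ker_d1 triv that by (auto simp: a_kernel_def')
  have d10: "d 1 (\<lambda>i. \<zero>) = (\<lambda>i. \<zero>)"
    using hom_zero[OF module_free_module module_free_module d1] by simp
  have res_inj: "f = g" if "f \<in> carrier (free_module R (Inl ` B))" "g \<in> carrier (free_module R (Inl ` B))"
    "finite B" "res f = res g" for f g and B :: "nat set"
    using ext_res[OF that(1,3)] ext_res[OF that(2,3)] that(4) by metis
  have res0: "res (\<lambda>_. \<zero>) = (\<lambda>_. \<zero>)" by (simp add: res_def)
  have ext0: "ext (\<lambda>_. \<zero>) = (\<lambda>_. \<zero>)" by (auto simp: ext_def split: sum.splits)
  have d'1: "d' 1 \<in> module_hom R (P 1) (P 0)"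
    using hom_compose[OF res_hom[OF finite_lessThan] hom_compose[OF d1 ext_hom[OF finite_lessThan]]]
    by (simp add: d'_def[abs_def] P01)
  have res_img: "res ` carrier (free_module R (Inl ` B)) = carrier (free_module R B)" if "finite B" for B :: "nat set"
    using res ext that res_ext by (auto intro!: image_eqI[of _ res "ext _"])
  have "resolution R M P d' e'"
    unfolding resolution_def
  proof (intro conjI allI)
    show "module R (P n)" for n by (rule P)
    show "d' (Suc n) \<in> module_hom R (P (Suc n)) (P n)" for n
    proof (cases "n = 0")
      case False
      hence "d' (Suc n) = (\<lambda>_. \<zero>\<^bsub>P n\<^esub>)" by (auto simp: d'_def P_def)
      moreover have "(\<lambda>_. \<zero>\<^bsub>P n\<^esub>) \<in> module_hom R (P (Suc n)) (P n)"
        by (rule module_homI) (auto simp: P_def)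
      ultimately show ?thesis by simp
    qed (use d'1 in simp)
    show "e' \<in> module_hom R (P 0) M"
      using hom_compose[OF res_hom[OF finite_lessThan] e] by (simp add: e'_def[abs_def] P01)
    show "e' ` carrier (P 0) = carrier M"
      using e_surj res_img[of "{..<b 0}"] by (simp add: P01 e'_def[abs_def] image_image[of e res, symmetric])
    show "d' 1 ` carrier (P 1) = a_kernel (P 0) M e'"
    proof (intro equalityI subsetI)
      fix f assume "f \<in> d' 1 ` carrier (P 1)"
      then obtain v where v: "v \<in> carrier (free_module R (Inl ` {..<b 1}))" "f = ext (d 1 (res v))"
        by (auto simp: d'_def P01)
      have "d 1 (res v) \<in> a_kernel (?F 0) M e" using ker_e res[OF v(1)] by blast
      thus "f \<in> a_kernel (P 0) M e'"
        using v(2) by (auto simp: a_kernel_def' P01 e'_def res_ext intro: ext)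
    next
      fix f assume "f \<in> a_kernel (P 0) M e'"
      hence f: "f \<in> carrier (free_module R (Inl ` {..<b 0}))" "e (res f) = \<zero>\<^bsub>M\<^esub>"
        by (auto simp: a_kernel_def' P01 e'_def)
      hence "res f \<in> d 1 ` carrier (?F 1)" using ker_e res[OF f(1)] by (simp add: a_kernel_def')
      then obtain v where v: "v \<in> carrier (?F 1)" "res f = d 1 v" by (elim imageE)
      have "f = d' 1 (ext v)"
        using ext_res[OF f(1)] v(2) by (simp add: d'_def res_ext)
      thus "f \<in> d' 1 ` carrier (P 1)" using ext[OF v(1)] by (auto simp: P01)
    qed
    show "d' (Suc (Suc n)) ` carrier (P (Suc (Suc n))) = a_kernel (P (Suc n)) (P n) (d' (Suc n))" for n
    proof -
      have l: "d' (Suc (Suc n)) ` carrier (P (Suc (Suc n))) = {\<lambda>_. \<zero>}"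
        using P2[of "Suc (Suc n)"] by (simp add: d'_def)
      show ?thesis
      proof (cases "n = 0")
        case True
        have "a_kernel (P 1) (P 0) (d' 1) = {\<lambda>_. \<zero>}"
        proof (intro equalityI subsetI)
          fix f assume "f \<in> a_kernel (P 1) (P 0) (d' 1)"
          hence f: "f \<in> carrier (free_module R (Inl ` {..<b 1}))" "ext (d 1 (res f)) = (\<lambda>_. \<zero>)"
            by (auto simp: a_kernel_def' P01 d'_def)
          have "d 1 (res f) = (\<lambda>_. \<zero>)"
            using res_ext[of "d 1 (res f)"] f(2) res0 by simp
          hence "res f = (\<lambda>_. \<zero>)" using inj res[OF f(1)] by simp
          hence "f = (\<lambda>_. \<zero>)" using ext_res[OF f(1)] ext0 by simp
          thus "f \<in> {\<lambda>_. \<zero>}" by simp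
        next
          fix f :: "(nat + 'a + 'c) \<Rightarrow> 'a" assume "f \<in> {\<lambda>_. \<zero>}"
          thus "f \<in> a_kernel (P 1) (P 0) (d' 1)"
            using d10 by (auto simp: a_kernel_def' P01 d'_def res0 ext0)
        qed
        thus ?thesis using l True by simp
      next
        case False
        thus ?thesis
          using l P2[of "Suc n"] by (auto simp: a_kernel_def' d'_def P_def)
      qed
    qed
  qed
  moreover have "projective R (P i)" for i
    unfolding P_def by (rule projective_free_module[OF _ nz]) simp
  moreover have "carrier (P i) = {\<zero>\<^bsub>P i\<^esub>}" if "i > 1" for i
    using P2[OF that] by (simp add: P_def)
  ultimately have "1 \<in> {n. \<exists>(P :: nat \<Rightarrow> ('a, (nat + 'a + 'c) \<Rightarrow> 'a) module) d e.
      resolution R M P d e \<and> (\<forall>i. projective R (P i)) \<and> (\<forall>i > n. carrier (P i) = {\<zero>\<^bsub>P i\<^esub>})}"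
    by blast
  hence "proj_dim R M \<le> enat 1"
    unfolding proj_dim_def by (rule INF_lower)
  thus ?thesis by (simp add: one_enat_def)
qed

section \<open>The given syzygies as iterated kernels of covers\<close>

lemma ker_module_cong: "\<zero>\<^bsub>N\<^esub> = \<zero>\<^bsub>N'\<^esub> \<Longrightarrow> ker_module M N f = ker_module M N' f"
  by (simp add: ker_module_def)

lemma syzygy_zero [simp]: "\<zero>\<^bsub>syzygy R b d n\<^esub> = (\<lambda>i. \<zero>\<^bsub>R\<^esub>)"
  by (simp add: syzygy_def)

context local_ring
begin

context
  fixes M :: "('a, 'c, 'l) module_scheme" and b d e
  assumes M: "module R M" and mfr: "minimal_free_resolution R m M b d e"
begin

abbreviation (input) "F n \<equiv> free_module R {..<b n}"

lemma d_hom: "d (Suc n) \<in> module_hom R (F (Suc n)) (F n)"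
  and d_in_m: "f \<in> carrier (F (Suc n)) \<Longrightarrow> d (Suc n) f i \<in> m"
  and d1_img: "d 1 ` carrier (F 1) = a_kernel (F 0) M e"
  and d_img: "d (Suc (Suc n)) ` carrier (F (Suc (Suc n))) = a_kernel (F (Suc n)) (F n) (d (Suc n))"
  and e_hom: "e \<in> module_hom R (F 0) M"
proof -
  note r = mfr[unfolded minimal_free_resolution_def resolution_def]
  show d: "d (Suc n) \<in> module_hom R (F (Suc n)) (F n)" for n using r by blast
  show "d 1 ` carrier (F 1) = a_kernel (F 0) M e" "e \<in> module_hom R (F 0) M" using r by blast+
  show "d (Suc (Suc n)) ` carrier (F (Suc (Suc n))) = a_kernel (F (Suc n)) (F n) (d (Suc n))"
    using r by blast
  assume f: "f \<in> carrier (F (Suc n))"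
  show "d (Suc n) f i \<in> m"
  proof (cases "i < b n")
    case False
    hence "d (Suc n) f i = \<zero>" using hom_closed[OF d f] by (simp add: mem_free_module)
    thus ?thesis by simp
  qed (use r f in blast)
qed

lemma syzygy_Suc_Suc: "syzygy R b d (Suc (Suc n)) = ker_module (F (Suc n)) (F n) (d (Suc n))"
  using d_img[of n] by (simp add: syzygy_def ker_module_def a_kernel_def')

text \<open>The differential is read as a map onto the \<open>n\<close>-th syzygy instead of into
  the free module around it; both have the same zero vector, so the kernel does not change.\<close>

lemma syzygy_Suc: "n > 0 \<Longrightarrow> syzygy R b d (Suc n) = syz {..<b n} (d n) (syzygy R b d n)"
  by (cases n) (auto simp: syzygy_Suc_Suc intro: ker_module_cong)

lemma module_syzygy: "n > 0 \<Longrightarrow> module R (syzygy R b d n)"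
proof -
  assume "n > 0"
  show ?thesis
  proof (cases "n = 1")
    case True
    have "syzygy R b d 1 = ker_module (F 0) M e"
      using d1_img by (simp add: syzygy_def ker_module_def a_kernel_def')
    thus ?thesis using True module_ker_module[OF module_free_module M e_hom] by simp
  next
    case False
    then obtain k where "n = Suc (Suc k)" using \<open>n > 0\<close> by (cases n; cases "n - 1") auto
    thus ?thesis
      using module_ker_module[OF module_free_module module_free_module d_hom]
      by (simp add: syzygy_Suc_Suc)
  qed
qed

text \<open>By exactness the kernel is the image of the next differential, which minimality puts
  into \<open>m\<close>.\<close>

lemma kernel_in_m: "v \<in> carrier (F (Suc n)) \<Longrightarrow> d (Suc n) v = (\<lambda>i. \<zero>) \<Longrightarrow> v i \<in> m"
proof -
  assume "v \<in> carrier (F (Suc n))" "d (Suc n) v = (\<lambda>i. \<zero>)"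
  hence "v \<in> d (Suc (Suc n)) ` carrier (F (Suc (Suc n)))"
    unfolding d_img by (simp add: a_kernel_def')
  thus ?thesis using d_in_m by blast
qed

lemma cover_syzygy: "n > 0 \<Longrightarrow> cover {..<b n} (d n) (syzygy R b d n)"
proof -
  assume "n > 0"
  then obtain k where n: "n = Suc k" by (cases n) auto
  show ?thesis
    unfolding cover_def
  proof (intro conjI ballI allI impI)
    show "d n \<in> module_hom R (F n) (syzygy R b d n)"
      by (rule module_homI)
        (use hom_add[OF d_hom[of k]] hom_smult[OF d_hom[of k]] in \<open>auto simp: n syzygy_def\<close>)
    fix v i assume "v \<in> carrier (F n)" "d n v = \<zero>\<^bsub>syzygy R b d n\<^esub>"
    thus "v i \<in> m" using kernel_in_m[of v k i] by (simp add: n)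
  qed (auto simp: syzygy_def)
qed

lemma syzygy_2_nonzero:
  assumes "2 \<le> proj_dim R M"
  shows "carrier (syzygy R b d 2) \<noteq> {\<zero>\<^bsub>syzygy R b d 2\<^esub>}"
proof
  assume "carrier (syzygy R b d 2) = {\<zero>\<^bsub>syzygy R b d 2\<^esub>}"
  hence triv: "d 2 ` carrier (F 2) = {\<lambda>i. \<zero>}" by (simp add: syzygy_def)
  have "\<one> \<noteq> \<zero>" using one_notin_m m.zero_closed by metis
  moreover have "resolution R M (\<lambda>n. F n) d e"
    using mfr by (simp add: minimal_free_resolution_def)
  ultimately have "proj_dim R M \<le> 1" using proj_dim_le_1 M triv by blast
  with assms have "(2 :: enat) \<le> 1" by (rule order_trans)
  thus False by (simp add: one_enat_def numeral_eq_enat)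
qed

end

end

text \<open>With zero \<open>J\<close>-part, every vector of the second syzygy is its own
  \<open>I\<close>-component. So \<open>J\<close> kills this syzygy, and
  \<open>annihilated_summand\<close> applies with the covers \<open>d 2\<close>, \<open>d 3\<close>
  and \<open>d 4\<close>.\<close>

lemma (in split_local) syzygy_cases:
  assumes M: "module R M" and mfr: "minimal_free_resolution R m M b d e"
    and noeth: "noetherian_ring R"
    and nz: "carrier (syzygy R b d 2) \<noteq> {\<zero>\<^bsub>syzygy R b d 2\<^esub>}"
    and triv: "carrier (part J (syzygy R b d 2)) = {\<lambda>i. \<zero>}"
  shows "retract R (ideal_module R m) (syzygy R b d 4) \<or>
    retract R (ideal_module R m) (syzygy R b d 5) \<and> quot_free R J (syzygy R b d 2) \<or>
    retract R (ideal_module R m) (direct_sum (syzygy R b d 3) (syzygy R b d 4)) \<and>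
      discrete_valuation_ring (R Quot I) \<and> quot_free R J (syzygy R b d 2)"
proof -
  interpret sw: split_local R m J I by (rule swap)
  note cover = cover_syzygy[OF M mfr] and suc = syzygy_Suc[OF M mfr]
  let ?S = "syzygy R b d"
  have S2: "?S 2 = ker_module (free_module R {..<b (Suc 0)}) (free_module R {..<b 0}) (d (Suc 0))"
    using syzygy_Suc_Suc[OF M mfr, of 0] by (simp add: numeral_2_eq_2)
  have S3: "?S 3 = syz {..<b 2} (d 2) (?S 2)" using suc[of 2] by simp
  have S4: "?S 4 = syz {..<b 3} (d 3) (?S 3)" using suc[of 3] by simp
  have S5: "?S 5 = syz {..<b 4} (d 4) (?S 4)" using suc[of 4] by simp
  have in_I: "v i \<in> I" if v: "v \<in> carrier (?S 2)" for v i
  proof -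
    have vm: "v i \<in> m" for i
      using v kernel_in_m[OF M mfr, of v 0] by (simp add: S2)
    have "(\<lambda>i. pr R J I (v i)) \<in> carrier (part J (?S 2))"
      unfolding S2
    proof (rule sw.retract_parts(2)[OF d_hom[OF M mfr]])
      fix w i assume "w \<in> carrier (free_module R {..<b (Suc 0)})" "d (Suc 0) w = (\<lambda>i. \<zero>)"
      thus "w i \<in> m" by (rule kernel_in_m[OF M mfr])
    qed (use v in \<open>simp add: S2\<close>)
    hence "pr R J I (v i) = \<zero>" unfolding triv by (auto dest: fun_cong)
    thus ?thesis using pr_decomp(1,3)[OF vm, of i] I.Icarr[OF pr_decomp(1)[OF vm, of i]] by simp
  qed
  have ann: "r \<odot>\<^bsub>?S 2\<^esub> x = \<zero>\<^bsub>?S 2\<^esub>" if "r \<in> J" "x \<in> carrier (?S 2)" for r x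
    using J_I_zero[OF in_I[OF that(2)] that(1)] by (simp add: S2)
  have "retract R (ideal_module R m) (syz {..<b 3} (d 3) (syz {..<b 2} (d 2) (?S 2))) \<or>
    retract R (ideal_module R m) (syz {..<b 4} (d 4) (syz {..<b 3} (d 3) (syz {..<b 2} (d 2) (?S 2)))) \<and> quot_free R J (?S 2) \<or>
    retract R (ideal_module R m) (direct_sum (syz {..<b 2} (d 2) (?S 2)) (syz {..<b 3} (d 3) (syz {..<b 2} (d 2) (?S 2)))) \<and>
      discrete_valuation_ring (R Quot I) \<and> quot_free R J (?S 2)"
  proof (rule annihilated_summand[OF noeth module_syzygy[OF M mfr] _ nz ann])
    show "cover {..<b 2} (d 2) (?S 2)" by (rule cover) simp
    show "cover {..<b 3} (d 3) (syz {..<b 2} (d 2) (?S 2))" using cover[of 3] by (simp add: S3)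
    show "cover {..<b 4} (d 4) (syz {..<b 3} (d 3) (syz {..<b 2} (d 2) (?S 2)))"
      using cover[of 4] by (simp add: S4 S3)
  qed simp
  thus ?thesis by (simp only: S3[symmetric] S4[symmetric] S5[symmetric])
qed

lemma (in split_local) depth_nonzero:
  assumes M: "module R M" and mfr: "minimal_free_resolution R m M b d e"
    and noeth: "noetherian_ring R"
    and nz: "carrier (syzygy R b d 2) \<noteq> {\<zero>\<^bsub>syzygy R b d 2\<^esub>}"
    and free: "quot_free R J (syzygy R b d 2)"
  shows "depth (R Quot I) \<noteq> 0 \<and> depth (R Quot J) \<noteq> 0"
proof -
  have S2: "syzygy R b d 2 = ker_module (free_module R {..<b (Suc 0)}) (free_module R {..<b 0}) (d (Suc 0))"
    using syzygy_Suc_Suc[OF M mfr, of 0] by (simp add: numeral_2_eq_2)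
  show ?thesis
  proof (rule quot_free_imp_depth_nonzero[OF noeth finite_lessThan d_hom[OF M mfr, of 0]])
    fix v i assume v: "v \<in> carrier (free_module R {..<b (Suc 0)})"
    thus "d (Suc 0) v i \<in> m" by (rule d_in_m[OF M mfr])
    assume "d (Suc 0) v = (\<lambda>i. \<zero>)"
    with v show "v i \<in> m" by (rule kernel_in_m[OF M mfr])
  qed (use nz free in \<open>simp_all add: S2\<close>)
qed

theorem theorem3p6:
  fixes R :: "('a, 'k) ring_scheme" and m I J :: "'a set"
    and M :: "('a, 'b, 'l) module_scheme"
    and b :: "nat \<Rightarrow> nat" and d :: "nat \<Rightarrow> (nat \<Rightarrow> 'a) \<Rightarrow> (nat \<Rightarrow> 'a)" and e :: "(nat \<Rightarrow> 'a) \<Rightarrow> 'b"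
  assumes "noetherian_local_ring R m"
    and "ideal I R" and "ideal J R" and "I \<noteq> {\<zero>\<^bsub>R\<^esub>}" and "J \<noteq> {\<zero>\<^bsub>R\<^esub>}"
    and "m = I <+>\<^bsub>R\<^esub> J" and "I \<inter> J = {\<zero>\<^bsub>R\<^esub>}"
    and "module R M" and "fin_gen R M" and "2 \<le> proj_dim R M"
    and "minimal_free_resolution R m M b d e"
  shows
    "let \<Omega> = syzygy R b d;
         mm = ideal_module R m;
         c1 = direct_summand R mm (\<Omega> 3) \<or> direct_summand R mm (\<Omega> 4);
         c2 = direct_summand R mm (\<Omega> 5) \<and> quot_free R I (\<Omega> 2);
         c3 = direct_summand R mm (\<Omega> 5) \<and> quot_free R J (\<Omega> 2);
         c4 = direct_summand R mm (direct_sum (\<Omega> 3) (\<Omega> 4)) \<and>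
              discrete_valuation_ring (R Quot I) \<and> quot_free R J (\<Omega> 2);
         c5 = direct_summand R mm (direct_sum (\<Omega> 3) (\<Omega> 4)) \<and>
              discrete_valuation_ring (R Quot J) \<and> quot_free R I (\<Omega> 2)
     in (c1 \<or> c2 \<or> c3 \<or> c4 \<or> c5) \<and>
        (depth (R Quot I) = 0 \<or> depth (R Quot J) = 0 \<longrightarrow> \<not> c2 \<and> \<not> c3 \<and> \<not> c4 \<and> \<not> c5)"
proof -
  have noeth: "noetherian_ring R"
    using assms(1) by (simp add: noetherian_local_ring_def)
  interpret local_ring R m by (rule noetherian_local_ring.local_ring[OF assms(1)])
  interpret split_local R m I J
    by (intro split_local.intro split_local_axioms.intro local_ring_axioms assms)
  interpret sw: split_local R m J I by (rule swap)
  note M = assms(8) and mfr = assms(11)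
  let ?S = "syzygy R b d" and ?m = "ideal_module R m"
  have nz: "carrier (?S 2) \<noteq> {\<zero>\<^bsub>?S 2\<^esub>}" by (rule syzygy_2_nonzero[OF M mfr assms(10)])
  have mod: "module R (?S n)" if "n > 0" for n by (rule module_syzygy[OF M mfr that])
  have mm: "module R ?m" by (rule module_ideal_module[OF m_ideal])
  have summand: "direct_summand R ?m N" if "retract R ?m N" "module R N"
    for N :: "('a, 'z) module"
    by (rule retract_imp_direct_summand[OF mm that(2,1)])
  have S2: "?S 2 = ker_module (free_module R {..<b (Suc 0)}) (free_module R {..<b 0}) (d (Suc 0))"
    using syzygy_Suc_Suc[OF M mfr, of 0] by (simp add: numeral_2_eq_2)
  have S3: "?S 3 = syz {..<b 2} (d 2) (?S 2)" using syzygy_Suc[OF M mfr, of 2] by simp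
  have cases: "retract R ?m (?S 3) \<or> retract R ?m (?S 4) \<or>
    retract R ?m (?S 5) \<and> quot_free R I (?S 2) \<or> retract R ?m (?S 5) \<and> quot_free R J (?S 2) \<or>
    retract R ?m (direct_sum (?S 3) (?S 4)) \<and> discrete_valuation_ring (R Quot I) \<and> quot_free R J (?S 2) \<or>
    retract R ?m (direct_sum (?S 3) (?S 4)) \<and> discrete_valuation_ring (R Quot J) \<and> quot_free R I (?S 2)"
  proof -
    consider "carrier (part J (?S 2)) = {\<lambda>i. \<zero>\<^bsub>R\<^esub>}" | "carrier (part I (?S 2)) = {\<lambda>i. \<zero>\<^bsub>R\<^esub>}"
      | "carrier (part I (?S 2)) \<noteq> {\<lambda>i. \<zero>\<^bsub>R\<^esub>}" "carrier (part J (?S 2)) \<noteq> {\<lambda>i. \<zero>\<^bsub>R\<^esub>}"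
      by blast
    thus ?thesis
    proof cases
      case 1
      from syzygy_cases[OF M mfr noeth nz this] show ?thesis by blast
    next
      case 2
      \<comment> \<open>The mirror image supplies the alternatives (ii) and (v), the direct form
        above (iii) and (iv).\<close>
      from sw.syzygy_cases[OF M mfr noeth nz this] show ?thesis by blast
    next
      case 3
      have ret: "retract R (direct_sum (part I (?S 2)) (part J (?S 2))) (?S 2)"
        unfolding S2
      proof (rule retract_parts(1)[OF d_hom[OF M mfr]])
        fix w i assume "w \<in> carrier (free_module R {..<b (Suc 0)})" "d (Suc 0) w = (\<lambda>i. \<zero>\<^bsub>R\<^esub>)"
        thus "w i \<in> m" by (rule kernel_in_m[OF M mfr])
      qed
      note A = module_part[OF I_ideal module_free_module d_hom[OF M mfr], of 0, folded S2]
        and C = module_part[OF J_ideal module_free_module d_hom[OF M mfr], of 0, folded S2]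
      have "retract R ?m (?S 3)"
        unfolding S3
      proof (rule retract_m_syz[OF mod cover_syzygy[OF M mfr] A _ _ C _ _ ret])
        show "carrier (part I (?S 2)) \<noteq> {\<zero>\<^bsub>part I (?S 2)\<^esub>}" using 3 by simp
        show "carrier (part J (?S 2)) \<noteq> {\<zero>\<^bsub>part J (?S 2)\<^esub>}" using 3 by simp
        show "\<And>r x. r \<in> J \<Longrightarrow> x \<in> carrier (part I (?S 2)) \<Longrightarrow> r \<odot>\<^bsub>part I (?S 2)\<^esub> x = \<zero>\<^bsub>part I (?S 2)\<^esub>"
          by (simp add: S2 J_I_zero)
        show "\<And>r x. r \<in> I \<Longrightarrow> x \<in> carrier (part J (?S 2)) \<Longrightarrow> r \<odot>\<^bsub>part J (?S 2)\<^esub> x = \<zero>\<^bsub>part J (?S 2)\<^esub>"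
          by (simp add: S2 I_J_zero)
      qed simp_all
      thus ?thesis by blast
    qed
  qed
  \<comment> \<open>Each of (ii) to (v) contains freeness of the second syzygy over
    \<open>R/I\<close> or over \<open>R/J\<close>, so this settles the second claim.\<close>
  have dep: "depth (R Quot I) \<noteq> 0 \<and> depth (R Quot J) \<noteq> 0"
    if "quot_free R I (?S 2) \<or> quot_free R J (?S 2)"
    using that depth_nonzero[OF M mfr noeth nz] sw.depth_nonzero[OF M mfr noeth nz] by blast
  have S34: "module R (direct_sum (?S 3) (?S 4))" by (intro module_direct_sum mod) simp_all
  have "retract R ?m (?S 3) \<Longrightarrow> direct_summand R ?m (?S 3)"
    "retract R ?m (?S 4) \<Longrightarrow> direct_summand R ?m (?S 4)"
    "retract R ?m (?S 5) \<Longrightarrow> direct_summand R ?m (?S 5)"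
    "retract R ?m (direct_sum (?S 3) (?S 4)) \<Longrightarrow> direct_summand R ?m (direct_sum (?S 3) (?S 4))"
    using summand[OF _ mod[of 3]] summand[OF _ mod[of 4]] summand[OF _ mod[of 5]] summand[OF _ S34]
    by simp_all
  with cases dep show ?thesis
    unfolding Let_def by blast
qed

end
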